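(* Let $G=\mathbb{Z}_2$ and let $(\Gamma,\alpha)$ be an abstract 1-skeleton of type $(1,n)$. Then $(\Gamma,\alpha)$ is a $G$-colored graph of a $G$-action if and only if the number of vertices of $\Gamma$ is even.
   Context: Let $G=\mathbb{Z}_2$. The group $\mathrm{Hom}(G,\mathbb{Z}_2)$, regarded as a vector space over $\mathbb{Z}_2$, has exactly one non-trivial element $\rho$ and trivial element $\rho_0$. An abstract 1-skeleton of type $(1,n)$ (with $n\ge 1$) is a pair $(\Gamma,\alpha)$ where $\Gamma$ is a finite $n$-valent regular graph without loops (a loop is an edge with only one endpoint), with vertex set $V_\Gamma$ and edge set $E_\Gamma$, and $\alpha:E_\Gamma\to\mathrm{Hom}(G,\mathbb{Z}_2)\setminus\{\rho_0\}$ is a map such that, with $E_p$ the set of edges adjacent to the vertex $p$: (1) for each vertex $p$, $\alpha(E_p)$ spans $\mathrm{Hom}(G,\mathbb{Z}_2)$; (2) for each edge $e$ with endpoints $p,q$, $\alpha(E_p)\equiv\alpha(E_q)\bmod\alpha(e)$. For $G=\mathbb{Z}_2$ the map $\alpha$ is necessarily constant with value $\rho$. A $G$-action here means an effective smooth action $\Phi$ of $G$ on a smooth connected closed manifold $M$ of dimension $n$ with finite fixed point set $M^G$ (for $G=\mathbb{Z}_2$, an involution with isolated fixed points). A $G$-colored graph of $(\Phi,M)$ is an $n$-valent regular graph associated to the action, with vertex set $M^G$, together with a map $\alpha$ from its edges to the non-trivial elements of $\mathrm{Hom}(G,\mathbb{Z}_2)$ satisfying (1) and (2), such that for each $p\in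 M^G$ the colors $\alpha(E_p)$ give the tangent $G$-representation at $p$. For $G=\mathbb{Z}_2$ all tangent representations at fixed points are the same, namely $n$ copies of $\rho$.
   Formalization: For n = 1 the graph Γ is assumed connected: two disjoint edges form a 1-skeleton with 4 vertices, but an involution of a circle has at most 2 isolated fixed points. The points of M are taken, up to bijection, to be real sequences with an arbitrary topology, which loses no manifold. *)

theory Defs
  imports
    "HOL-Analysis.Analysis"
    "HOL-Library.Function_Algebras"
    "HOL-Library.Multiset"
    "HOL-Library.Z2"
begin

section \<open>Smooth closed manifolds\<close>

text \<open>Meaningful for open domains only, where the derivative is determined by the values on the
  domain.\<close>

fun Ck_on :: "nat \<Rightarrow> 'a::euclidean_space set \<Rightarrow> ('a \<Rightarrow> 'b::euclidean_space) \<Rightarrow> bool" where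
  "Ck_on 0 S f \<longleftrightarrow> continuous_on S f"
| "Ck_on (Suc k) S f \<longleftrightarrow>
     (\<forall>x\<in>S. f differentiable (at x)) \<and> (\<forall>v. Ck_on k S (\<lambda>x. frechet_derivative f (at x) v))"

definition smooth_on :: "'a::euclidean_space set \<Rightarrow> ('a \<Rightarrow> 'b::euclidean_space) \<Rightarrow> bool" where
  "smooth_on S f \<longleftrightarrow> (\<forall>k. Ck_on k S f)"

type_synonym ('a, 'n) chart = "'a set \<times> ('a \<Rightarrow> real ^ 'n)"

definition is_chart :: "'a topology \<Rightarrow> ('a, 'n::finite) chart \<Rightarrow> bool" where
  "is_chart X c \<longleftrightarrow> (case c of (U, \<phi>) \<Rightarrow>
     openin X U \<and> open (\<phi> ` U) \<and> homeomorphic_map (subtopology X U) (top_of_set (\<phi> ` U)) \<phi>)"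

text \<open>The local representative \<open>\<psi> \<circ> f \<circ> \<phi>\<inverse>\<close> of \<open>f\<close>, with its domain.\<close>

definition local_rep ::
  "('a, 'n::finite) chart \<Rightarrow> ('a, 'n) chart \<Rightarrow> ('a \<Rightarrow> 'a) \<Rightarrow> real ^ 'n \<Rightarrow> real ^ 'n" where
  "local_rep c d f = snd d \<circ> f \<circ> inv_into (fst c) (snd c)"

definition local_dom ::
  "('a, 'n::finite) chart \<Rightarrow> ('a, 'n) chart \<Rightarrow> ('a \<Rightarrow> 'a) \<Rightarrow> (real ^ 'n) set" where
  "local_dom c d f = snd c ` {x \<in> fst c. f x \<in> fst d}"

text \<open>The atlas need not be maximal: an atlas determines the smooth structure.  The dimension is
  \<open>CARD('n)\<close>.\<close>

definition smooth_manifold :: "'a topology \<Rightarrow> ('a, 'n::finite) chart set \<Rightarrow> bool" where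
  "smooth_manifold X A \<longleftrightarrow>
     Hausdorff_space X \<and> second_countable X \<and>
     (\<forall>c\<in>A. is_chart X c) \<and> (\<Union>c\<in>A. fst c) = topspace X \<and>
     (\<forall>c\<in>A. \<forall>d\<in>A. smooth_on (local_dom c d id) (local_rep c d id))"

definition closed_connected_manifold :: "'a topology \<Rightarrow> ('a, 'n::finite) chart set \<Rightarrow> bool" where
  "closed_connected_manifold X A \<longleftrightarrow>
     smooth_manifold X A \<and> compact_space X \<and> connected_space X"

definition smooth_self_map ::
  "'a topology \<Rightarrow> ('a, 'n::finite) chart set \<Rightarrow> ('a \<Rightarrow> 'a) \<Rightarrow> bool" where
  "smooth_self_map X A f \<longleftrightarrow> continuous_map X X f \<and>
     (\<forall>c\<in>A. \<forall>d\<in>A. smooth_on (local_dom c d f) (local_rep c d f))"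


section \<open>Actions with finite fixed point set\<close>

text \<open>Groups are written additively; \<open>bit\<close> is the two-element group.\<close>

definition fixed_points :: "'a topology \<Rightarrow> ('g \<Rightarrow> 'a \<Rightarrow> 'a) \<Rightarrow> 'a set" where
  "fixed_points X \<Phi> = {x \<in> topspace X. \<forall>g. \<Phi> g x = x}"

definition G_action ::
  "'a topology \<Rightarrow> ('a, 'n::finite) chart set \<Rightarrow> ('g::ab_group_add \<Rightarrow> 'a \<Rightarrow> 'a) \<Rightarrow> bool" where
  "G_action X A \<Phi> \<longleftrightarrow>
     closed_connected_manifold X A \<and>
     (\<forall>g. smooth_self_map X A (\<Phi> g)) \<and>
     (\<forall>x\<in>topspace X. \<Phi> 0 x = x) \<and>
     (\<forall>g h. \<forall>x\<in>topspace X. \<Phi> (g + h) x = \<Phi> g (\<Phi> h x)) \<and>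
     (\<forall>g. (\<forall>x\<in>topspace X. \<Phi> g x = x) \<longrightarrow> g = 0) \<and>
     finite (fixed_points X \<Phi>)"


section \<open>Abstract 1-skeleta\<close>

definition HomZ2 :: "('g::ab_group_add \<Rightarrow> bit) set" where
  "HomZ2 = {\<rho>. Modules.additive \<rho>}"

definition spanZ2 :: "('g \<Rightarrow> bit) set \<Rightarrow> ('g \<Rightarrow> bit) set" where
  "spanZ2 = module.span (\<lambda>c \<rho> g. c * \<rho> g)"

text \<open>The coset of \<open>\<rho>\<close> modulo the subspace spanned by \<open>\<sigma>\<close>.\<close>

definition cosetZ2 :: "('g \<Rightarrow> bit) \<Rightarrow> ('g \<Rightarrow> bit) \<Rightarrow> ('g \<Rightarrow> bit) set" where
  "cosetZ2 \<sigma> \<rho> = (\<lambda>\<tau>. \<rho> + \<tau>) ` spanZ2 {\<sigma>}"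

text \<open>Undirected graphs; multiple edges are allowed.\<close>

record ('v, 'e) multigraph =
  verts :: "'v set"
  edges :: "'e set"
  ends :: "'e \<Rightarrow> 'v set"

definition edges_at :: "('v, 'e) multigraph \<Rightarrow> 'v \<Rightarrow> 'e set" where
  "edges_at \<Gamma> p = {e \<in> edges \<Gamma>. p \<in> ends \<Gamma> e}"

definition loopless_finite_graph :: "('v, 'e) multigraph \<Rightarrow> bool" where
  "loopless_finite_graph \<Gamma> \<longleftrightarrow> finite (verts \<Gamma>) \<and> finite (edges \<Gamma>) \<and>
     (\<forall>e\<in>edges \<Gamma>. ends \<Gamma> e \<subseteq> verts \<Gamma> \<and> card (ends \<Gamma> e) = 2)"

definition regular_graph :: "nat \<Rightarrow> ('v, 'e) multigraph \<Rightarrow> bool" where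
  "regular_graph n \<Gamma> \<longleftrightarrow> (\<forall>p\<in>verts \<Gamma>. card (edges_at \<Gamma> p) = n)"

text \<open>Graphs are not assumed connected.  Connectedness matters for valence 1 only: a connected closed
  1-manifold is a circle, and a nontrivial involution of a circle fixes at most two points.\<close>

definition connected_graph :: "('v, 'e) multigraph \<Rightarrow> bool" where
  "connected_graph \<Gamma> \<longleftrightarrow> (\<forall>p\<in>verts \<Gamma>. \<forall>q\<in>verts \<Gamma>.
     (p, q) \<in> {(u, v). \<exists>e\<in>edges \<Gamma>. ends \<Gamma> e = {u, v}}\<^sup>*)"

text \<open>The colors at a vertex form a multiset (several edges may carry the same color), so the
  congruence \<open>\<alpha>(E\<^sub>p) \<equiv> \<alpha>(E\<^sub>q) mod \<alpha>(e)\<close> is an equality of multisets of cosets.\<close>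

definition abstract_1_skeleton ::
  "nat \<Rightarrow> ('v, 'e) multigraph \<Rightarrow> ('e \<Rightarrow> 'g::ab_group_add \<Rightarrow> bit) \<Rightarrow> bool" where
  "abstract_1_skeleton n \<Gamma> \<alpha> \<longleftrightarrow>
     loopless_finite_graph \<Gamma> \<and> regular_graph n \<Gamma> \<and>
     (\<forall>e\<in>edges \<Gamma>. \<alpha> e \<in> HomZ2 - {0}) \<and>
     (\<forall>p\<in>verts \<Gamma>. spanZ2 (\<alpha> ` edges_at \<Gamma> p) = HomZ2) \<and>
     (\<forall>e\<in>edges \<Gamma>. \<forall>p q. ends \<Gamma> e = {p, q} \<longrightarrow>
        image_mset (cosetZ2 (\<alpha> e)) (image_mset \<alpha> (mset_set (edges_at \<Gamma> p))) =
        image_mset (cosetZ2 (\<alpha> e)) (image_mset \<alpha> (mset_set (edges_at \<Gamma> q))))"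


section \<open>Colored graphs of actions\<close>

text \<open>The tangent representation at the fixed point \<open>x\<close> is the direct sum of the one-dimensional
  real representations \<open>g \<mapsto> (-1)\<^bsup>\<alpha> e g\<^esup>\<close>, where \<open>e\<close> ranges over \<open>S\<close>: the tangent space, read in a
  chart, has a basis \<open>(b e)\<close>, \<open>e \<in> S\<close>, of simultaneous eigenvectors.  The chart does not matter,
  since a change of charts conjugates the representation.\<close>

definition tangent_rep_given_by ::
  "('a, 'n::finite) chart set \<Rightarrow> ('g \<Rightarrow> 'a \<Rightarrow> 'a) \<Rightarrow> 'a \<Rightarrow> 'e set \<Rightarrow> ('e \<Rightarrow> 'g \<Rightarrow> bit) \<Rightarrow> bool" where
  "tangent_rep_given_by A \<Phi> x S \<alpha> \<longleftrightarrow>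
     (\<exists>c\<in>A. x \<in> fst c \<and>
       (\<exists>b. inj_on b S \<and> independent (b ` S) \<and> span (b ` S) = UNIV \<and>
         (\<forall>g. \<forall>e\<in>S. frechet_derivative (local_rep c c (\<Phi> g)) (at (snd c x)) (b e) =
            (if \<alpha> e g = 0 then b e else - b e))))"

text \<open>The vertex set is \<open>fixed_points X \<Phi>\<close> up to a relabelling \<open>\<iota>\<close>.\<close>

definition colored_graph_of ::
  "('v, 'e) multigraph \<Rightarrow> ('e \<Rightarrow> 'g::ab_group_add \<Rightarrow> bit) \<Rightarrow>
   'a topology \<Rightarrow> ('a, 'n::finite) chart set \<Rightarrow> ('g \<Rightarrow> 'a \<Rightarrow> 'a) \<Rightarrow> bool" where
  "colored_graph_of \<Gamma> \<alpha> X A \<Phi> \<longleftrightarrow>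
     abstract_1_skeleton CARD('n) \<Gamma> \<alpha> \<and>
     (\<exists>\<iota>. bij_betw \<iota> (verts \<Gamma>) (fixed_points X \<Phi>) \<and>
       (\<forall>p\<in>verts \<Gamma>. tangent_rep_given_by A \<Phi> (\<iota> p) (edges_at \<Gamma> p) \<alpha>))"

text \<open>HOL cannot quantify over the type of points, so the points are taken in \<open>nat \<Rightarrow> real\<close>.  This
  loses nothing: a second countable Hausdorff space has at most continuum many points, hence is
  homeomorphic to a topology on some set of real sequences.  The topology \<open>X\<close> is arbitrary; it is
  not meant to be a subspace topology.\<close>

definition is_colored_graph_of_G_action ::
  "'n::finite itself \<Rightarrow> ('v, 'e) multigraph \<Rightarrow> ('e \<Rightarrow> 'g::ab_group_add \<Rightarrow> bit) \<Rightarrow> bool" where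
  "is_colored_graph_of_G_action _ \<Gamma> \<alpha> \<longleftrightarrow>
     (\<exists>(X :: (nat \<Rightarrow> real) topology) (A :: (nat \<Rightarrow> real, 'n) chart set) \<Phi>.
        G_action X A \<Phi> \<and> colored_graph_of \<Gamma> \<alpha> X A \<Phi>)"

end

theory Submission
  imports Defs
begin

text \<open>Suppose an involution \<open>t\<close> of a closed \<open>n\<close>-manifold \<open>M\<close> acts as \<open>-1\<close> on the tangent spaces at its
  finitely many fixed points.  There is an odd map \<open>f : M \<rightarrow> \<real>\<^sup>n\<close> all of whose zeros are nondegenerate:
  take a sum of localized coordinate maps at the fixed points, made odd, and add generic multiples of odd bumps, using
  Sard's theorem.  The zeros of \<open>f\<close> are the fixed points together with free orbits, which come in pairs.
  On the other hand the number of zeros is even: \<open>f\<close> can be changed, inside one chart at a time, to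
  \<open>f + \<Psi> s\<close> with \<open>\<Psi> > 0\<close> and a large generic vector \<open>s\<close>, which has no zeros, and a change inside a
  chart preserves the parity, because the signed count of zeros in a chart is the integral of a pulled back
  bump form and such forms are divergences.

  Conversely, removing \<open>m\<close> small balls along an axis from a large ball in \<open>\<real>\<^sup>n\<close> and doubling the result gives
  a hypersurface of \<open>\<real>\<^bsup>n+1\<^esup>\<close> on which the rotation by \<open>-1\<close> around the axis has \<open>2 m + 2\<close> fixed points, where
  the axis crosses the boundary spheres.  It is connected for \<open>n \<ge> 2\<close> or \<open>m = 0\<close>.
  The antipodal map of the sphere (\<open>m = 0\<close>) serves the graph without vertices.\<close>

section \<open>Functions of class \<open>C\<^sup>k\<close>\<close>

text \<open>The manifold may be non-orientable, so signed counts of zeros make sense only inside a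
  chart, and only their parity survives globally. Each change of the map is therefore confined to
  one chart, and every intermediate map must again have nondegenerate zeros; one vector outside
  finitely many negligible sets serves all of them.

  A generic perturbation could spoil zeros that are already good. A perturbation
  \<open>f + \<beta> s\<close> is harmless at the zeros of \<open>\<beta>\<close> if the derivative
  of \<open>\<beta>\<close> vanishes there (\<open>flat_zeros\<close>). Nonnegative functions have
  this property, and so do the differences \<open>b - b \<circ> t\<close> of bumps that are never
  both nonzero. The latter keep the map odd. They vanish at the fixed points, so nondegeneracy there
  has to be arranged beforehand; this is where the tangent action \<open>-1\<close> enters.

  In the converse all fixed points look alike, so an arbitrary bijection matches them with the
  vertices.\<close>

lemma Ck_on_subset: "Ck_on k S f \<Longrightarrow> T \<subseteq> S \<Longrightarrow> Ck_on k T f"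
  by (induction k arbitrary: f) (auto intro: continuous_on_subset)

lemma Ck_on_cong_open:
  assumes "open S" "\<And>x. x \<in> S \<Longrightarrow> f x = g x" "Ck_on k S f"
  shows "Ck_on k S g"
  using assms(2,3)
proof (induction k arbitrary: f g)
  case 0
  then show ?case by (metis Ck_on.simps(1) continuous_on_cong)
next
  case (Suc k)
  have d: "f differentiable (at x)" if "x \<in> S" for x
    using Suc.prems that by simp
  have g: "g differentiable (at x)" if "x \<in> S" for x
    using d[OF that] Suc.prems(1) that assms(1)
    unfolding differentiable_def by (metis has_derivative_transform_within_open)
  have e: "frechet_derivative f (at x) = frechet_derivative g (at x)" if "x \<in> S" for x
    using frechet_derivative_transform_within_open[OF d[OF that] assms(1) that Suc.prems(1)] .
  have "Ck_on k S (\<lambda>x. frechet_derivative g (at x) v)" for v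
    by (rule Suc.IH[of "\<lambda>x. frechet_derivative f (at x) v"]) (use e Suc.prems in auto)
  with g show ?case by simp
qed

lemma Ck_on_local:
  assumes "\<And>x. x \<in> S \<Longrightarrow> \<exists>T. open T \<and> x \<in> T \<and> Ck_on k T f"
  shows "Ck_on k S f"
  using assms
proof (induction k arbitrary: f)
  case 0
  show ?case unfolding Ck_on.simps
    using 0 by (metis Ck_on.simps(1) continuous_at_imp_continuous_on continuous_on_eq_continuous_at)
next
  case (Suc k)
  then show ?case unfolding Ck_on.simps by metis
qed

lemma Ck_on_Suc_imp: "Ck_on (Suc k) S f \<Longrightarrow> Ck_on k S f"
proof (induction k arbitrary: f)
  case 0
  then show ?case
    by (simp add: continuous_at_imp_continuous_on differentiable_imp_continuous_within)
next
  case (Suc k)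
  then show ?case by (metis Ck_on.simps(2))
qed

lemma Ck_on_imp_continuous_on: "Ck_on k S f \<Longrightarrow> continuous_on S f"
proof (induction k)
  case (Suc k)
  then show ?case using Ck_on_Suc_imp[OF Suc.prems] by blast
qed simp

lemma smooth_on_imp_Ck_on: "smooth_on S f \<Longrightarrow> Ck_on k S f"
  by (simp add: smooth_on_def)

lemma Ck_on_SucI:
  assumes "open S" and d: "\<And>x. x \<in> S \<Longrightarrow> (f has_derivative f' x) (at x)"
    and c: "\<And>v. Ck_on k S (\<lambda>x. f' x v)"
  shows "Ck_on (Suc k) S f"
proof -
  have "frechet_derivative f (at x) = f' x" if "x \<in> S" for x
    using frechet_derivative_at[OF d[OF that]] by simp
  then have "Ck_on k S (\<lambda>x. frechet_derivative f (at x) v)" for v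
    by (intro Ck_on_cong_open[OF assms(1) _ c[of v]]) simp
  moreover have "f differentiable (at x)" if "x \<in> S" for x
    using d[OF that] by (rule differentiableI)
  ultimately show ?thesis by simp
qed

lemma Ck_on_has_derivative:
  "Ck_on (Suc k) S f \<Longrightarrow> x \<in> S \<Longrightarrow> (f has_derivative frechet_derivative f (at x)) (at x)"
  by (simp add: frechet_derivative_works)

lemma Ck_on_const [simp]: "Ck_on k S (\<lambda>x. c)"
  by (induction k arbitrary: c) auto

lemma Ck_on_bounded_linear:
  assumes "bounded_linear L" shows "Ck_on k S L"
proof (cases k)
  case 0
  then show ?thesis by (simp add: assms linear_continuous_on)
next
  case (Suc j)
  have "frechet_derivative L (at x) = L" for x
    using frechet_derivative_at[OF bounded_linear_imp_has_derivative[OF assms]] by simp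
  then show ?thesis using Suc assms by (simp add: bounded_linear_imp_differentiable)
qed

lemma Ck_on_ident [simp]: "Ck_on k S (\<lambda>x. x)"
  by (rule Ck_on_bounded_linear) simp

lemma Ck_on_linear_comp:
  assumes "open S" "bounded_linear L" "Ck_on k S f"
  shows "Ck_on k S (\<lambda>x. L (f x))"
  using assms(3)
proof (induction k arbitrary: f)
  case 0
  then show ?case using bounded_linear.continuous_on[OF assms(2)] by auto
next
  case (Suc k)
  show ?case
  proof (rule Ck_on_SucI[OF assms(1)])
    show "((\<lambda>x. L (f x)) has_derivative (\<lambda>v. L (frechet_derivative f (at x) v))) (at x)" if "x \<in> S" for x
      using bounded_linear.has_derivative[OF assms(2) Ck_on_has_derivative[OF Suc.prems that]] .
    show "Ck_on k S (\<lambda>x. L (frechet_derivative f (at x) v))" for v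
      using Suc.prems by (intro Suc.IH) simp
  qed
qed

lemma Ck_on_add:
  assumes "open S" "Ck_on k S f" "Ck_on k S g"
  shows "Ck_on k S (\<lambda>x. f x + g x)"
  using assms(2,3)
proof (induction k arbitrary: f g)
  case 0
  then show ?case by (simp add: continuous_on_add)
next
  case (Suc k)
  show ?case
  proof (rule Ck_on_SucI[OF assms(1)])
    show "((\<lambda>x. f x + g x) has_derivative
        (\<lambda>v. frechet_derivative f (at x) v + frechet_derivative g (at x) v)) (at x)" if "x \<in> S" for x
      using Suc.prems that by (intro has_derivative_add Ck_on_has_derivative)
    show "Ck_on k S (\<lambda>x. frechet_derivative f (at x) v + frechet_derivative g (at x) v)" for v
      using Suc.prems by (intro Suc.IH) simp_all
  qed
qed

lemma Ck_on_bounded_bilinear: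
  assumes "open S" "bounded_bilinear P" "Ck_on k S f" "Ck_on k S g"
  shows "Ck_on k S (\<lambda>x. P (f x) (g x))"
  using assms(3,4)
proof (induction k arbitrary: f g)
  case 0
  then show ?case using bounded_bilinear.continuous_on[OF assms(2)] by auto
next
  case (Suc k)
  show ?case
  proof (rule Ck_on_SucI[OF assms(1)])
    show "((\<lambda>x. P (f x) (g x)) has_derivative
        (\<lambda>v. P (f x) (frechet_derivative g (at x) v) + P (frechet_derivative f (at x) v) (g x))) (at x)"
      if "x \<in> S" for x
      using Suc.prems that by (intro bounded_bilinear.FDERIV[OF assms(2)] Ck_on_has_derivative)
    show "Ck_on k S (\<lambda>x. P (f x) (frechet_derivative g (at x) v) + P (frechet_derivative f (at x) v) (g x))" for v
      using Suc.prems Suc.prems[THEN Ck_on_Suc_imp] by (intro Ck_on_add assms(1) Suc.IH) auto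
  qed
qed

lemmas Ck_on_scaleR = Ck_on_bounded_bilinear[OF _ bounded_bilinear_scaleR]
lemmas Ck_on_mult = Ck_on_bounded_bilinear[OF _ bounded_bilinear_mult]
lemmas Ck_on_inner = Ck_on_bounded_bilinear[OF _ bounded_bilinear_inner]

lemma Ck_on_minus: "open S \<Longrightarrow> Ck_on k S f \<Longrightarrow> Ck_on k S (\<lambda>x. - f x)"
  by (rule Ck_on_linear_comp[OF _ bounded_linear_minus[OF bounded_linear_ident]])

lemma Ck_on_diff:
  "open S \<Longrightarrow> Ck_on k S f \<Longrightarrow> Ck_on k S g \<Longrightarrow> Ck_on k S (\<lambda>x. f x - g x)"
  using Ck_on_add[of S k f "\<lambda>x. - g x"] Ck_on_minus[of S k g] by simp

lemma Ck_on_sum: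
  "open S \<Longrightarrow> (\<And>i. i \<in> I \<Longrightarrow> Ck_on k S (f i)) \<Longrightarrow> Ck_on k S (\<lambda>x. \<Sum>i\<in>I. f i x)"
  by (induction I rule: infinite_finite_induct) (auto intro: Ck_on_add)

lemma Ck_on_prod:
  fixes f :: "'i \<Rightarrow> 'a::euclidean_space \<Rightarrow> real"
  shows "open S \<Longrightarrow> (\<And>i. i \<in> I \<Longrightarrow> Ck_on k S (f i)) \<Longrightarrow> Ck_on k S (\<lambda>x. \<Prod>i\<in>I. f i x)"
  by (induction I rule: infinite_finite_induct) (auto intro: Ck_on_mult)

lemma Ck_on_power:
  fixes f :: "'a::euclidean_space \<Rightarrow> real"
  shows "open S \<Longrightarrow> Ck_on k S f \<Longrightarrow> Ck_on k S (\<lambda>x. f x ^ m)"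
  by (induction m) (auto intro: Ck_on_mult)

text \<open>By the chain rule the derivative of \<open>g\<close> is taken at \<open>f x\<close> in
  the direction \<open>?f' x v\<close>, which also varies with \<open>x\<close>. Expanding that
  direction in the basis leaves derivatives of \<open>g\<close> in fixed directions, to which the
  induction hypothesis applies.\<close>

lemma Ck_on_compose:
  assumes "open S" "open T" "Ck_on k S f" "Ck_on k T g" "f ` S \<subseteq> T"
  shows "Ck_on k S (\<lambda>x. g (f x))"
  using assms(3,4)
proof (induction k arbitrary: g)
  case 0
  then show ?case using assms(5) by (simp add: continuous_on_compose2)
next
  case (Suc k)
  let ?f' = "\<lambda>x. frechet_derivative f (at x)" and ?g' = "\<lambda>y. frechet_derivative g (at y)"
  have lin: "linear (?g' (f x))" if "x \<in> S" for x
    using Suc.prems(2) assms(5) that by (intro linear_frechet_derivative) (auto simp: image_subset_iff)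
  have *: "?g' (f x) w = (\<Sum>b\<in>Basis. (w \<bullet> b) *\<^sub>R ?g' (f x) b)" if "x \<in> S" for x w
    using linear_sum[OF lin[OF that], of "\<lambda>b. (w \<bullet> b) *\<^sub>R b" Basis]
    by (simp add: euclidean_representation linear_cmul[OF lin[OF that]])
  show ?case
  proof (rule Ck_on_SucI[OF assms(1)])
    show "((\<lambda>x. g (f x)) has_derivative (\<lambda>v. ?g' (f x) (?f' x v))) (at x)" if "x \<in> S" for x
      using Suc.prems assms(5) that
      by (intro has_derivative_compose[OF Ck_on_has_derivative[of k S f]] Ck_on_has_derivative[of k T g]) auto
    fix v
    have "Ck_on k T (\<lambda>y. ?g' y b)" for b
      using Suc.prems(2) by simp
    then have "Ck_on k S (\<lambda>x. ?g' (f x) b)" for b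
      by (intro Suc.IH Ck_on_Suc_imp[OF Suc.prems(1)])
    moreover have "Ck_on k S (\<lambda>x. ?f' x v \<bullet> b)" for b
      using Suc.prems by (intro Ck_on_inner) (auto simp: assms(1))
    ultimately have "Ck_on k S (\<lambda>x. \<Sum>b\<in>Basis. (?f' x v \<bullet> b) *\<^sub>R ?g' (f x) b)"
      by (intro Ck_on_sum Ck_on_scaleR assms(1))
    then show "Ck_on k S (\<lambda>x. ?g' (f x) (?f' x v))"
      by (rule Ck_on_cong_open[OF assms(1), rotated]) (simp add: *)
  qed
qed

text \<open>The derivative is a product of copies of \<open>inverse\<close> itself, so each order of
  differentiability yields the next.\<close>

lemma Ck_on_inverse: "Ck_on k (- {0::real}) inverse"
proof (induction k)
  case 0
  then show ?case by (auto intro!: continuous_intros)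
next
  case (Suc k)
  show ?case
  proof (rule Ck_on_SucI)
    show "(inverse has_derivative (\<lambda>v. - (inverse x * v * inverse x))) (at x)" if "x \<in> - {0::real}" for x
      using that by (auto intro!: has_derivative_inverse')
    show "Ck_on k (- {0}) (\<lambda>x::real. - (inverse x * v * inverse x))" for v
      using Suc by (intro Ck_on_minus Ck_on_mult) auto
  qed auto
qed

lemma Ck_on_divide:
  fixes f g :: "'a::euclidean_space \<Rightarrow> real"
  assumes "open S" "Ck_on k S f" "Ck_on k S g" "\<And>x. x \<in> S \<Longrightarrow> g x \<noteq> 0"
  shows "Ck_on k S (\<lambda>x. f x / g x)"
  unfolding divide_inverse
  using assms by (intro Ck_on_mult Ck_on_compose[OF _ _ _ Ck_on_inverse]) auto

text \<open>Schwarz's theorem, by the mean value theorem for the second difference quotient.\<close>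

lemma second_derivative_symmetric:
  fixes f :: "'a::euclidean_space \<Rightarrow> real"
  assumes "open S" "Ck_on 2 S f" "x \<in> S"
  shows "frechet_derivative (\<lambda>y. frechet_derivative f (at y) u) (at x) v
       = frechet_derivative (\<lambda>y. frechet_derivative f (at y) v) (at x) u"
proof -
  have C: "Ck_on (Suc (Suc 0)) S f" using assms(2) by (simp add: numeral_2_eq_2)
  define D where "D = (\<lambda>u y. frechet_derivative f (at y) u)"
  define H where "H = (\<lambda>u v y. frechet_derivative (D u) (at y) v)"
  have fD: "(f has_derivative (\<lambda>u. D u y)) (at y)" if "y \<in> S" for y
    using Ck_on_has_derivative[OF C that] by (simp add: D_def)
  have DH: "(D u has_derivative (\<lambda>v. H u v y)) (at y)" if "y \<in> S" for y u
    using C that Ck_on_has_derivative[of 0 S "D u"] by (simp add: D_def H_def)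
  have cH: "continuous_on S (H u v)" for u v
    using C by (simp add: D_def H_def)
  obtain e where e: "e > 0" "ball x e \<subseteq> S" using assms(1,3) openE by blast
  \<comment> \<open>The mean value theorem along \<open>u\<close> and then along \<open>v\<close>
    turns the second difference into one value of \<open>H u v\<close>, while the second difference
    itself is symmetric in \<open>u\<close> and \<open>v\<close>.\<close>
  have key: "\<exists>y. dist y x \<le> t * (norm u + norm v) \<and>
      f (x + t *\<^sub>R u + t *\<^sub>R v) - f (x + t *\<^sub>R u) - f (x + t *\<^sub>R v) + f x = t * t * H u v y"
    if t: "t > 0" "t * (norm u + norm v) < e" for t u v
  proof -
    have inS: "x + s *\<^sub>R u + r *\<^sub>R v \<in> S" "dist (x + s *\<^sub>R u + r *\<^sub>R v) x \<le> t * (norm u + norm v)"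
      if "0 \<le> s" "s \<le> t" "0 \<le> r" "r \<le> t" for s r
    proof -
      have "dist (x + s *\<^sub>R u + r *\<^sub>R v) x = norm (s *\<^sub>R u + r *\<^sub>R v)" by (simp add: dist_norm algebra_simps)
      also have "\<dots> \<le> s * norm u + r * norm v" using norm_triangle_ineq[of "s *\<^sub>R u" "r *\<^sub>R v"] that by simp
      also have "\<dots> \<le> t * norm u + t * norm v" using that by (intro add_mono mult_right_mono) auto
      finally show *: "dist (x + s *\<^sub>R u + r *\<^sub>R v) x \<le> t * (norm u + norm v)" by (simp add: algebra_simps)
      then show "x + s *\<^sub>R u + r *\<^sub>R v \<in> S"
        using t e(2) by (metis dist_commute mem_ball order_le_less_trans subsetD)
    qed
    let ?g = "\<lambda>s. f (x + s *\<^sub>R u + t *\<^sub>R v) - f (x + s *\<^sub>R u)"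
    have dg: "(?g has_derivative (\<lambda>h. D (h *\<^sub>R u) (x + s *\<^sub>R u + t *\<^sub>R v) - D (h *\<^sub>R u) (x + s *\<^sub>R u))) (at s)"
      if "0 \<le> s" "s \<le> t" for s
      using inS(1)[OF that, of t] inS(1)[OF that, of 0] t
      by (intro has_derivative_diff has_derivative_compose[where g = f, OF _ fD]) (auto intro!: derivative_eq_intros)
    have D_lin: "D (h *\<^sub>R w) y = h * D w y" if "y \<in> S" for h w y
      using linear_cmul[OF has_derivative_linear[OF fD[OF that]]] by simp
    obtain s where s: "0 < s" "s < t" "?g t - ?g 0 = D ((t - 0) *\<^sub>R u) (x + s *\<^sub>R u + t *\<^sub>R v) - D ((t - 0) *\<^sub>R u) (x + s *\<^sub>R u)"
      using mvt[of 0 t ?g "\<lambda>s h. D (h *\<^sub>R u) (x + s *\<^sub>R u + t *\<^sub>R v) - D (h *\<^sub>R u) (x + s *\<^sub>R u)"]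
        dg t by (metis (no_types, lifting) DERIV_isCont continuous_at_imp_continuous_on has_derivative_continuous less_eq_real_def atLeastAtMost_iff)
    let ?h = "\<lambda>r. D u (x + s *\<^sub>R u + r *\<^sub>R v)"
    have dh: "(?h has_derivative (\<lambda>k. H u (k *\<^sub>R v) (x + s *\<^sub>R u + r *\<^sub>R v))) (at r)"
      if "0 \<le> r" "r \<le> t" for r
      using inS(1)[of s r] that s
      by (intro has_derivative_compose[where g = "D u", OF _ DH]) (auto intro!: derivative_eq_intros)
    obtain r where r: "0 < r" "r < t" "?h t - ?h 0 = H u ((t - 0) *\<^sub>R v) (x + s *\<^sub>R u + r *\<^sub>R v)"
      using mvt[of 0 t ?h "\<lambda>r k. H u (k *\<^sub>R v) (x + s *\<^sub>R u + r *\<^sub>R v)"] dh t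
      by (metis (no_types, lifting) continuous_at_imp_continuous_on has_derivative_continuous less_eq_real_def atLeastAtMost_iff)
    have H_lin: "H u (h *\<^sub>R w) y = h * H u w y" if "y \<in> S" for h w y
      using linear_cmul[OF has_derivative_linear[OF DH[OF that]]] by simp
    have "?g t - ?g 0 = t * (?h t - ?h 0)"
      using s inS(1)[of s t] inS(1)[of s 0] t by (simp add: D_lin algebra_simps)
    also have "\<dots> = t * t * H u v (x + s *\<^sub>R u + r *\<^sub>R v)"
      using r s inS(1)[of s r] by (simp add: H_lin)
    finally show ?thesis using inS(2)[of s r] s r by (intro exI[of _ "x + s *\<^sub>R u + r *\<^sub>R v"]) auto
  qed
  \<comment> \<open>Tends to 0 and keeps the whole parallelogram inside \<open>ball x e\<close>; the
    \<open>+ 1\<close> covers \<open>u = v = 0\<close>.\<close>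
  define t where "t = (\<lambda>n::nat. e / ((norm u + norm v + 1) * (real n + 1)))"
  have pos: "norm u + norm v + 1 > 0" by (simp add: add_nonneg_pos)
  have t: "t n > 0" "t n * (norm u + norm v) < e" for n
  proof -
    show "t n > 0" using e(1) pos by (simp add: t_def)
    have "t n * (norm u + norm v) < t n * (norm u + norm v + 1)" using \<open>t n > 0\<close> by simp
    also have "\<dots> = e / (real n + 1)" using pos by (simp add: t_def)
    also have "\<dots> \<le> e" using e(1) by (simp add: field_simps)
    finally show "t n * (norm u + norm v) < e" .
  qed
  have t0: "t \<longlonglongrightarrow> 0" unfolding t_def
    using tendsto_mult[OF tendsto_const[of "e / (norm u + norm v + 1)"] LIMSEQ_inverse_real_of_nat]
    by (simp add: field_simps)
  have lim: "\<exists>Y. Y \<longlonglongrightarrow> x \<and> (\<forall>n. f (x + t n *\<^sub>R u + t n *\<^sub>R v) - f (x + t n *\<^sub>R u) - f (x + t n *\<^sub>R v) + f x = t n * t n * H u v (Y n))"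
    if uv: "\<And>n. t n * (norm u + norm v) < e" for u v
  proof -
    have "\<forall>n. \<exists>y. dist y x \<le> t n * (norm u + norm v) \<and>
      f (x + t n *\<^sub>R u + t n *\<^sub>R v) - f (x + t n *\<^sub>R u) - f (x + t n *\<^sub>R v) + f x = t n * t n * H u v y"
      by (intro allI key t(1) uv)
    then obtain Y where Y: "\<And>n. dist (Y n) x \<le> t n * (norm u + norm v)"
      "\<And>n. f (x + t n *\<^sub>R u + t n *\<^sub>R v) - f (x + t n *\<^sub>R u) - f (x + t n *\<^sub>R v) + f x = t n * t n * H u v (Y n)"
      by (auto simp: choice_iff)
    have "(\<lambda>n. t n * (norm u + norm v)) \<longlonglongrightarrow> 0" using tendsto_mult_right[OF t0] by simp
    then have "(\<lambda>n. dist (Y n) x) \<longlonglongrightarrow> 0"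
      by (rule tendsto_sandwich[OF _ _ tendsto_const, rotated 2]) (use Y(1) in auto)
    then have "Y \<longlonglongrightarrow> x" by (subst tendsto_dist_iff)
    then show ?thesis using Y(2) by (intro exI[of _ Y] conjI allI)
  qed
  obtain Y where Y: "Y \<longlonglongrightarrow> x" "\<And>n. f (x + t n *\<^sub>R u + t n *\<^sub>R v) - f (x + t n *\<^sub>R u) - f (x + t n *\<^sub>R v) + f x = t n * t n * H u v (Y n)"
    using lim[OF t(2)] by blast
  have t': "t n * (norm v + norm u) < e" for n using t(2)[of n] by (simp only: add.commute)
  obtain Z where Z: "Z \<longlonglongrightarrow> x" "\<And>n. f (x + t n *\<^sub>R v + t n *\<^sub>R u) - f (x + t n *\<^sub>R v) - f (x + t n *\<^sub>R u) + f x = t n * t n * H v u (Z n)"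
    using lim[OF t'] by blast
  have "H u v (Y n) = H v u (Z n)" for n
  proof -
    have "t n * t n * H u v (Y n) = t n * t n * H v u (Z n)"
      unfolding Y(2)[symmetric] Z(2)[symmetric] by (simp add: algebra_simps)
    then show ?thesis using t(1)[of n] by simp
  qed
  moreover have "(\<lambda>n. H u v (Y n)) \<longlonglongrightarrow> H u v x" "(\<lambda>n. H v u (Z n)) \<longlonglongrightarrow> H v u x"
    using cH assms(1,3) Y(1) Z(1) by (auto simp: continuous_on_eq_continuous_at intro: isCont_tendsto_compose)
  ultimately have "H u v x = H v u x" by (simp add: LIMSEQ_unique)
  then show ?thesis by (simp add: H_def D_def)
qed

section \<open>Divergence of pulled back vector fields\<close>

text \<open>The product rule in the Leibniz expansion differentiates one entry of each product;
  regrouping by the row of that entry gives one determinant per row.\<close>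

lemma has_derivative_det:
  fixes R :: "'n::finite \<Rightarrow> 'a::real_normed_vector \<Rightarrow> real^'n"
  assumes R: "\<And>l. (R l has_derivative R' l) (at x)"
  shows "((\<lambda>x. det (\<chi> l. R l x)) has_derivative
           (\<lambda>h. \<Sum>l\<in>UNIV. det (\<chi> m. if m = l then R' l h else R m x))) (at x)"
proof -
  let ?P = "{p. p permutes (UNIV::'n set)}"
  have c: "((\<lambda>x. R l x $ j) has_derivative (\<lambda>h. R' l h $ j)) (at x)" for l j
    using bounded_linear.has_derivative[OF bounded_linear_vec_nth R] .
  have "((\<lambda>x. \<Sum>p\<in>?P. of_int (sign p) * (\<Prod>i\<in>UNIV. R i x $ p i)) has_derivative
      (\<lambda>h. \<Sum>p\<in>?P. of_int (sign p) * (\<Sum>l\<in>UNIV. R' l h $ p l * (\<Prod>m\<in>UNIV - {l}. R m x $ p m)))) (at x)"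
    by (intro has_derivative_sum has_derivative_mult_right has_derivative_prod c)
  moreover have "(\<Sum>p\<in>?P. of_int (sign p) * (\<Sum>l\<in>UNIV. R' l h $ p l * (\<Prod>m\<in>UNIV - {l}. R m x $ p m)))
     = (\<Sum>l\<in>UNIV. det (\<chi> m. if m = l then R' l h else R m x))" for h
  proof -
    have "R' l h $ p l * (\<Prod>m\<in>UNIV - {l}. R m x $ p m) = (\<Prod>m\<in>UNIV. (if m = l then R' l h else R m x) $ p m)" for p l
      by (subst (2) prod.remove[of _ l]) auto
    then show ?thesis
      unfolding det_def by (simp add: sum_distrib_left sum.swap[of _ _ ?P])
  qed
  ultimately show ?thesis by (simp add: det_def)
qed

lemma Ck_on_det:
  fixes R :: "'n::finite \<Rightarrow> 'a::euclidean_space \<Rightarrow> real^'n"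
  assumes "open S" "\<And>l. Ck_on k S (R l)"
  shows "Ck_on k S (\<lambda>x. det (\<chi> l. R l x))"
  unfolding det_def
  by (intro Ck_on_sum Ck_on_mult Ck_on_prod assms(1) Ck_on_const)
     (simp add: Ck_on_linear_comp[OF assms(1) bounded_linear_vec_nth assms(2)])

lemma second_derivative_symmetric_vec:
  fixes f :: "'a::euclidean_space \<Rightarrow> 'b::euclidean_space"
  assumes "open S" "Ck_on 2 S f" "x \<in> S"
  shows "frechet_derivative (\<lambda>y. frechet_derivative f (at y) u) (at x) v
       = frechet_derivative (\<lambda>y. frechet_derivative f (at y) v) (at x) u"
proof (rule euclidean_eqI)
  fix b :: 'b assume "b \<in> Basis"
  have C: "Ck_on (Suc (Suc 0)) S f" using assms(2) by (simp add: numeral_2_eq_2)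
  have 1: "frechet_derivative (\<lambda>z. f z \<bullet> b) (at y) w = frechet_derivative f (at y) w \<bullet> b" if "y \<in> S" for y w
    using frechet_derivative_at[OF bounded_linear.has_derivative[OF bounded_linear_inner_left Ck_on_has_derivative[OF C that], of b]]
    by metis
  have 2: "frechet_derivative (\<lambda>y. frechet_derivative (\<lambda>z. f z \<bullet> b) (at y) w) (at x) w'
      = frechet_derivative (\<lambda>y. frechet_derivative f (at y) w) (at x) w' \<bullet> b" for w w'
  proof -
    have "((\<lambda>y. frechet_derivative f (at y) w \<bullet> b) has_derivative
        (\<lambda>w'. frechet_derivative (\<lambda>y. frechet_derivative f (at y) w) (at x) w' \<bullet> b)) (at x)"
      using C assms(3)
      by (intro bounded_linear.has_derivative[OF bounded_linear_inner_left] Ck_on_has_derivative[of 0 S]) auto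
    then have "((\<lambda>y. frechet_derivative (\<lambda>z. f z \<bullet> b) (at y) w) has_derivative
        (\<lambda>w'. frechet_derivative (\<lambda>y. frechet_derivative f (at y) w) (at x) w' \<bullet> b)) (at x)"
      by (rule has_derivative_transform_within_open[OF _ assms(1,3)]) (simp add: 1)
    then show ?thesis using frechet_derivative_at by metis
  qed
  have "Ck_on 2 S (\<lambda>z. f z \<bullet> b)"
    by (intro Ck_on_inner assms Ck_on_const)
  from second_derivative_symmetric[OF assms(1) this assms(3), of u v]
  show "frechet_derivative (\<lambda>y. frechet_derivative f (at y) u) (at x) v \<bullet> b =
     frechet_derivative (\<lambda>y. frechet_derivative f (at y) v) (at x) u \<bullet> b"
    by (simp add: 2)
qed

text \<open>The \<open>(i, j)\<close> cofactor of the Jacobian matrix. Replacing row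
  \<open>i\<close> by a unit vector, rather than deleting a row and a column, keeps the size of the
  matrix, so that the derivative formula for determinants applies.\<close>

definition cofactor_map :: "(real^'n \<Rightarrow> real^'n) \<Rightarrow> 'n \<Rightarrow> 'n::finite \<Rightarrow> real^'n \<Rightarrow> real" where
  "cofactor_map f i j x = det (\<chi> m. if m = i then axis j 1 else jacobian f (at x) $ m)"

lemma jacobian_row_has_derivative:
  fixes f :: "real^'n \<Rightarrow> real^'n::finite"
  assumes "open U" "Ck_on 2 U f" "x \<in> U"
  shows "((\<lambda>y. jacobian f (at y) $ l) has_derivative
    (\<lambda>h. \<chi> j. frechet_derivative (\<lambda>y. frechet_derivative f (at y) (axis j 1)) (at x) h $ l)) (at x)"
proof -
  have C: "Ck_on (Suc (Suc 0)) U f" using assms(2) by (simp add: numeral_2_eq_2)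
  show ?thesis
    unfolding has_derivative_componentwise_within[of "\<lambda>y. jacobian f (at y) $ l"]
  proof
    fix b :: "real^'n" assume "b \<in> Basis"
    then obtain j where b: "b = axis j 1" by (auto simp: Basis_vec_def)
    have "((\<lambda>y. frechet_derivative f (at y) (axis j 1)) has_derivative
        (frechet_derivative (\<lambda>y. frechet_derivative f (at y) (axis j 1)) (at x))) (at x)"
      using C assms(3) by (intro Ck_on_has_derivative[of 0 U]) auto
    from bounded_linear.has_derivative[OF bounded_linear_vec_nth this, of l]
    show "((\<lambda>y. jacobian f (at y) $ l \<bullet> b) has_derivative
         (\<lambda>h. (\<chi> j. frechet_derivative (\<lambda>y. frechet_derivative f (at y) (axis j 1)) (at x) h $ l) \<bullet> b)) (at x)"
      by (simp add: b inner_axis jacobian_def matrix_def)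
  qed
qed

lemma Ck_on_jacobian_row:
  fixes f :: "real^'n \<Rightarrow> real^'n::finite"
  assumes "open U" "Ck_on (Suc k) U f"
  shows "Ck_on k U (\<lambda>y. jacobian f (at y) $ l)"
proof -
  have "Ck_on k U (\<lambda>y. \<Sum>j\<in>UNIV. (frechet_derivative f (at y) (axis j 1) $ l) *\<^sub>R (axis j 1 :: real^'n))"
    using assms by (intro Ck_on_sum Ck_on_scaleR Ck_on_linear_comp[OF _ bounded_linear_vec_nth]) auto
  moreover have "(\<Sum>j\<in>UNIV. (frechet_derivative f (at y) (axis j 1) $ l) *\<^sub>R (axis j 1 :: real^'n)) = jacobian f (at y) $ l" for y
    by (simp add: vec_eq_iff jacobian_def matrix_def axis_def if_distrib cong: if_cong)
  ultimately show ?thesis by simp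
qed

lemma Ck_on_cofactor_map:
  assumes "open U" "Ck_on (Suc k) U f"
  shows "Ck_on k U (cofactor_map f i j)"
proof -
  have "Ck_on k U (\<lambda>x. if m = i then axis j 1 else jacobian f (at x) $ m)" for m
    using Ck_on_jacobian_row[OF assms] by (cases "m = i") auto
  from Ck_on_det[OF assms(1), of k "\<lambda>m x. if m = i then axis j 1 else jacobian f (at x) $ m", OF this]
  show ?thesis by (simp add: cofactor_map_def[abs_def])
qed

lemma Ck_on_det_jacobian:
  fixes f :: "real^'n \<Rightarrow> real^'n::finite"
  assumes "open U" "Ck_on (Suc k) U f"
  shows "Ck_on k U (\<lambda>x. det (jacobian f (at x)))"
  using Ck_on_det[OF assms(1), of k "\<lambda>l y. jacobian f (at y) $ l", OF Ck_on_jacobian_row[OF assms]] by (simp add: vec_lambda_eta)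

text \<open>A transposition of rows changes the sign. Paired with the symmetry of second
  derivatives, this makes the sum in Piola's identity cancel.\<close>

lemma det_two_rows_antisym:
  fixes A :: "'n::finite \<Rightarrow> real^'n"
  assumes "l \<noteq> i"
  shows "det (\<chi> m. if m = l then u else if m = i then v else A m)
       = - det (\<chi> m. if m = l then v else if m = i then u else A m)"
proof -
  let ?M = "(\<chi> m. if m = l then u else if m = i then v else A m) :: real^'n^'n"
  let ?p = "Transposition.transpose l i"
  have "det (\<chi> m. ?M $ ?p m) = of_int (sign ?p) * det ?M"
    by (intro det_permute_rows) (auto intro: permutes_swap_id)
  moreover have "(\<chi> m. ?M $ ?p m) = (\<chi> m. if m = l then v else if m = i then u else A m)"
    using assms by (auto simp: vec_eq_iff Transposition.transpose_def)
  ultimately show ?thesis using assms by (simp add: sign_swap_id)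
qed

lemma vec_eq_sum_axis: "(v :: real^'n::finite) = (\<Sum>k\<in>UNIV. (v $ k) *s axis k 1)"
  by (simp add: vec_eq_iff axis_def if_distrib cong: if_cong)

lemma det_row_expand:
  fixes v :: "real^'n::finite"
  shows "det (\<chi> m. if m = l then v else c m) = (\<Sum>k\<in>UNIV. v $ k * det (\<chi> m. if m = l then axis k 1 else c m))"
proof -
  have "det (\<chi> m. if m = l then v else c m) = det (\<chi> m. if m = l then (\<Sum>k\<in>UNIV. (v $ k) *s axis k 1) else c m)"
    by (rule arg_cong[OF vec_eq_sum_axis])
  also have "\<dots> = (\<Sum>k\<in>UNIV. det (\<chi> m. if m = l then (v $ k) *s axis k 1 else c m))"
    by (rule det_linear_row_sum) simp
  also have "\<dots> = (\<Sum>k\<in>UNIV. v $ k * det (\<chi> m. if m = l then axis k 1 else c m))"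
    by (simp add: det_row_mul)
  finally show ?thesis .
qed

text \<open>Piola's identity.\<close>

lemma cofactor_map_divergence:
  fixes f :: "real^'n \<Rightarrow> real^'n::finite"
  assumes "open U" "Ck_on 2 U f" "x \<in> U"
  shows "(\<Sum>j\<in>UNIV. frechet_derivative (cofactor_map f i j) (at x) (axis j 1)) = 0"
proof -
  define g' where "g' = (\<lambda>l h. (\<chi> j. frechet_derivative (\<lambda>y. frechet_derivative f (at y) (axis j 1)) (at x) h $ l))"
  define T where "T = (\<lambda>l k j. det (\<chi> m. if m = l then axis k 1 else if m = i then axis j 1 else jacobian f (at x) $ m))"
  have g': "((\<lambda>y. jacobian f (at y) $ l) has_derivative g' l) (at x)" for l
    unfolding g'_def by (rule jacobian_row_has_derivative[OF assms])
  have row: "((\<lambda>y. if l = i then axis j 1 else jacobian f (at y) $ l) has_derivative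
        (\<lambda>h. if l = i then 0 else g' l h)) (at x)" for l j
    using g' by (cases "l = i") auto
  have der: "frechet_derivative (cofactor_map f i j) (at x) h
      = (\<Sum>l\<in>UNIV. det (\<chi> m. if m = l then (if l = i then 0 else g' l h)
           else if m = i then axis j 1 else jacobian f (at x) $ m))" for j h
    using frechet_derivative_at[OF has_derivative_det[of "\<lambda>l y. if l = i then axis j 1 else jacobian f (at y) $ l"
      "\<lambda>l h. if l = i then 0 else g' l h", OF row]]
    by (simp add: cofactor_map_def[abs_def] fun_eq_iff)
  have sym: "g' l (axis j 1) $ k = g' l (axis k 1) $ j" for l j k
    unfolding g'_def using second_derivative_symmetric_vec[OF assms] by simp
  have "(\<Sum>j\<in>UNIV. det (\<chi> m. if m = l then (if l = i then 0 else g' l (axis j 1))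
           else if m = i then axis j 1 else jacobian f (at x) $ m)) = 0" for l
  proof (cases "l = i")
    case True
    then show ?thesis using det_row_0[of i] by (simp cong: if_cong)
  next
    case False
    have e: "det (\<chi> m. if m = l then (if l = i then 0 else g' l (axis j 1))
           else if m = i then axis j 1 else jacobian f (at x) $ m) = (\<Sum>k\<in>UNIV. g' l (axis j 1) $ k * T l k j)" for j
      unfolding if_not_P[OF False] T_def by (rule det_row_expand)
    \<comment> \<open>The second derivatives are symmetric in \<open>j\<close> and \<open>k\<close>
      and \<open>T l k j\<close> is antisymmetric, so exchanging the two sums gives
      \<open>X = - X\<close>.\<close>
    define X where "X = (\<Sum>j\<in>UNIV. \<Sum>k\<in>UNIV. g' l (axis j 1) $ k * T l k j)"
    have T: "T l j k = - T l k j" for j k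
      unfolding T_def by (rule det_two_rows_antisym[OF False])
    have "X = (\<Sum>k\<in>UNIV. \<Sum>j\<in>UNIV. g' l (axis j 1) $ k * T l k j)"
      unfolding X_def by (rule sum.swap)
    also have "\<dots> = (\<Sum>k\<in>UNIV. \<Sum>j\<in>UNIV. - (g' l (axis k 1) $ j * T l j k))"
      by (intro sum.cong refl) (subst T, subst sym, simp)
    also have "\<dots> = - X"
      by (simp add: sum_negf X_def)
    finally have "X = 0" by simp
    then show ?thesis unfolding e X_def .
  qed
  then show ?thesis
    unfolding der by (subst sum.swap) simp
qed

text \<open>Laplace expansion of the determinant in which row \<open>i\<close> is replaced by row
  \<open>l\<close>: nothing changes for \<open>l = i\<close>, and for \<open>l \<noteq> i\<close>
  two rows agree. In matrix terms, the Jacobian times its adjugate is the determinant times the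
  identity.\<close>

lemma cofactor_map_expand:
  fixes f :: "real^'n \<Rightarrow> real^'n::finite"
  shows "(\<Sum>j\<in>UNIV. jacobian f (at x) $ l $ j * cofactor_map f i j x) = (if l = i then det (jacobian f (at x)) else 0)"
proof -
  have "(\<Sum>j\<in>UNIV. jacobian f (at x) $ l $ j * cofactor_map f i j x)
      = det (\<chi> m. if m = i then jacobian f (at x) $ l else jacobian f (at x) $ m)"
    unfolding cofactor_map_def det_row_expand[of i "jacobian f (at x) $ l"] by simp
  also have "\<dots> = (if l = i then det (jacobian f (at x)) else 0)"
  proof (cases "l = i")
    case True
    then have "(\<chi> m. if m = i then jacobian f (at x) $ l else jacobian f (at x) $ m) = jacobian f (at x)"
      by (simp add: vec_eq_iff)
    then show ?thesis using True by simp
  next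
    case False
    then show ?thesis
      by (auto intro!: det_identical_rows[of i l] simp: row_def vec_eq_iff)
  qed
  finally show ?thesis .
qed

text \<open>The adjugate of the derivative of \<open>f\<close>, applied to \<open>V (f x)\<close>.
  This is the coordinate form of the pullback under \<open>f\<close> of the (n-1)-form obtained by
  contracting the volume form with \<open>V\<close>.\<close>

definition pullback_field ::
  "(real^'n \<Rightarrow> real^'n) \<Rightarrow> (real^'n \<Rightarrow> real^'n) \<Rightarrow> 'n::finite \<Rightarrow> real^'n \<Rightarrow> real" where
  "pullback_field V f j x = (\<Sum>i\<in>UNIV. V (f x) $ i * cofactor_map f i j x)"

lemma Ck_on_pullback_field:
  assumes "open U" "Ck_on (Suc k) U f" "Ck_on k UNIV V"
  shows "Ck_on k U (pullback_field V f j)"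
proof -
  have "Ck_on k U (\<lambda>x. V (f x))"
    using Ck_on_compose[OF assms(1) open_UNIV Ck_on_Suc_imp[OF assms(2)] assms(3)] by simp
  then show ?thesis
    unfolding pullback_field_def[abs_def]
    by (intro Ck_on_sum Ck_on_mult Ck_on_linear_comp[OF _ bounded_linear_vec_nth] Ck_on_cofactor_map assms)
qed

text \<open>In the product rule the terms with derivatives of cofactors cancel by Piola's identity,
  and the others combine through \<open>cofactor_map_expand\<close>. In the language of forms,
  pullback commutes with the exterior derivative.\<close>

lemma pullback_field_divergence:
  fixes f :: "real^'n \<Rightarrow> real^'n::finite"
  assumes "open U" "Ck_on 2 U f" "x \<in> U" and V: "(V has_derivative V') (at (f x))"
  shows "(\<Sum>j\<in>UNIV. frechet_derivative (pullback_field V f j) (at x) (axis j 1))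
       = (\<Sum>i\<in>UNIV. V' (axis i 1) $ i) * det (jacobian f (at x))"
proof -
  let ?f' = "frechet_derivative f (at x)"
  have C: "Ck_on (Suc (Suc 0)) U f" using assms(2) by (simp add: numeral_2_eq_2)
  have f: "(f has_derivative ?f') (at x)"
    by (rule Ck_on_has_derivative[OF C assms(3)])
  have Vf: "((\<lambda>y. V (f y) $ i) has_derivative (\<lambda>h. V' (?f' h) $ i)) (at x)" for i
    by (intro bounded_linear.has_derivative[OF bounded_linear_vec_nth] has_derivative_compose[OF f V])
  have cof: "(cofactor_map f i j has_derivative frechet_derivative (cofactor_map f i j) (at x)) (at x)" for i j
    using Ck_on_has_derivative[OF Ck_on_cofactor_map[OF assms(1) C] assms(3)] .
  have "(pullback_field V f j has_derivative (\<lambda>h. \<Sum>i\<in>UNIV. V (f x) $ i * frechet_derivative (cofactor_map f i j) (at x) h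
          + V' (?f' h) $ i * cofactor_map f i j x)) (at x)" for j
    unfolding pullback_field_def[abs_def] by (intro has_derivative_sum has_derivative_mult Vf cof)
  from frechet_derivative_at[OF this, symmetric]
  have "(\<Sum>j\<in>UNIV. frechet_derivative (pullback_field V f j) (at x) (axis j 1))
      = (\<Sum>j\<in>UNIV. \<Sum>i\<in>UNIV. V (f x) $ i * frechet_derivative (cofactor_map f i j) (at x) (axis j 1))
        + (\<Sum>j\<in>UNIV. \<Sum>i\<in>UNIV. V' (?f' (axis j 1)) $ i * cofactor_map f i j x)"
    by (simp add: sum.distrib)
  also have "(\<Sum>j\<in>UNIV. \<Sum>i\<in>UNIV. V (f x) $ i * frechet_derivative (cofactor_map f i j) (at x) (axis j 1)) = 0"
    by (subst sum.swap) (simp add: sum_distrib_left[symmetric] cofactor_map_divergence[OF assms(1-3)])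
  also have "(\<Sum>j\<in>UNIV. \<Sum>i\<in>UNIV. V' (?f' (axis j 1)) $ i * cofactor_map f i j x)
      = (\<Sum>i\<in>UNIV. V' (axis i 1) $ i) * det (jacobian f (at x))"
  proof -
    have lin: "linear V'" using V by (rule has_derivative_linear)
    have "V' (?f' (axis j 1)) $ i = (\<Sum>l\<in>UNIV. jacobian f (at x) $ l $ j * V' (axis l 1) $ i)" for i j
    proof -
      have "V' (?f' (axis j 1)) = V' (\<Sum>l\<in>UNIV. (?f' (axis j 1) $ l) *\<^sub>R axis l 1)"
        using vec_eq_sum_axis[of "?f' (axis j 1)"] by (simp add: scalar_mult_eq_scaleR)
      also have "\<dots> = (\<Sum>l\<in>UNIV. (?f' (axis j 1) $ l) *\<^sub>R V' (axis l 1))"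
        by (simp add: linear_sum[OF lin] linear_cmul[OF lin])
      finally show ?thesis by (simp add: jacobian_def matrix_def)
    qed
    then have "(\<Sum>j\<in>UNIV. \<Sum>i\<in>UNIV. V' (?f' (axis j 1)) $ i * cofactor_map f i j x)
       = (\<Sum>j\<in>UNIV. \<Sum>i\<in>UNIV. \<Sum>l\<in>UNIV. V' (axis l 1) $ i * (jacobian f (at x) $ l $ j * cofactor_map f i j x))"
      by (simp add: sum_distrib_left sum_distrib_right mult_ac)
    also have "\<dots> = (\<Sum>i\<in>UNIV. \<Sum>j\<in>UNIV. \<Sum>l\<in>UNIV. V' (axis l 1) $ i * (jacobian f (at x) $ l $ j * cofactor_map f i j x))"
      by (rule sum.swap)
    also have "\<dots> = (\<Sum>i\<in>UNIV. \<Sum>l\<in>UNIV. \<Sum>j\<in>UNIV. V' (axis l 1) $ i * (jacobian f (at x) $ l $ j * cofactor_map f i j x))"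
      by (intro sum.cong refl sum.swap)
    also have "\<dots> = (\<Sum>i\<in>UNIV. \<Sum>l\<in>UNIV. V' (axis l 1) $ i * (if l = i then det (jacobian f (at x)) else 0))"
      by (simp add: sum_distrib_left[symmetric] cofactor_map_expand)
    also have "\<dots> = (\<Sum>i\<in>UNIV. V' (axis i 1) $ i) * det (jacobian f (at x))"
      by (simp add: if_distrib sum_distrib_right cong: if_cong)
    finally show ?thesis .
  qed
  finally show ?thesis by simp
qed

text \<open>Translations preserve the integral, so every difference quotient of \<open>w\<close>
  integrates to 0; dominated convergence carries this over to the derivative.\<close>

lemma integral_derivative_compact_support:
  fixes w :: "'a::euclidean_space \<Rightarrow> real"
  assumes C: "Ck_on 1 UNIV w" and K: "compact K" and w0: "\<And>x. x \<notin> K \<Longrightarrow> w x = 0"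
  shows "((\<lambda>x. frechet_derivative w (at x) v) has_integral 0) UNIV"
proof -
  let ?dw = "\<lambda>x. frechet_derivative w (at x) v"
  have C': "Ck_on (Suc 0) UNIV w" using C by simp
  have der: "(w has_derivative frechet_derivative w (at x)) (at x)" for x
    using Ck_on_has_derivative[OF C'] by simp
  have cdw: "continuous_on UNIV ?dw" using C' by simp
  have cw: "continuous_on UNIV w" using Ck_on_imp_continuous_on[OF C] .
  have dw0: "?dw x = 0" if "x \<notin> K" for x
  proof -
    have "frechet_derivative w (at x) = frechet_derivative (\<lambda>_. 0) (at x)"
      using that w0 K by (intro frechet_derivative_transform_within_open[OF differentiableI[OF der], of "- K"])
        (auto simp: open_Compl compact_imp_closed)
    then show ?thesis by simp
  qed
  have "bounded (?dw ` K)"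
    using compact_continuous_image[OF continuous_on_subset[OF cdw] K] compact_imp_bounded by blast
  then obtain B where B: "\<And>x. x \<in> K \<Longrightarrow> \<bar>?dw x\<bar> \<le> B"
    by (auto simp: bounded_iff)
  define B' where "B' = max B 0"
  have B': "\<bar>?dw x\<bar> \<le> B'" for x
    using B[of x] dw0[of x] by (cases "x \<in> K") (auto simp: B'_def)
  have B'0: "B' \<ge> 0" by (simp add: B'_def)
  obtain R where R: "\<And>x. x \<in> K \<Longrightarrow> norm x \<le> R"
    using compact_imp_bounded[OF K] by (auto simp: bounded_iff)
  have "integrable lborel (\<lambda>x. indicator K x *\<^sub>R w x)"
    using borel_integrable_compact[OF K continuous_on_subset[OF cw]] by simp
  moreover have "(\<lambda>x. indicator K x *\<^sub>R w x) = w"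
    using w0 by (auto simp: indicator_def fun_eq_iff)
  ultimately have iw: "integrable lborel w" by simp
  have trans: "((\<lambda>x. w (c + x)) has_integral integral\<^sup>L lborel w) UNIV" for c
  proof -
    have m: "w \<in> borel_measurable borel" using cw by (simp add: borel_measurable_continuous_onI)
    have "integrable lborel (\<lambda>x. w (c + x))"
      using iw integrable_distr_eq[of "(+) c" lborel borel w] m by (simp add: lborel_distr_plus)
    moreover have "integral\<^sup>L lborel (\<lambda>x. w (c + x)) = integral\<^sup>L lborel w"
      using integral_distr[of "(+) c" lborel borel w] m by (simp add: lborel_distr_plus)
    ultimately show ?thesis
      using has_integral_integral_lborel[of "\<lambda>x. w (c + x)"] by simp
  qed
  define t where "t = (\<lambda>n::nat. inverse (real (Suc n)))"
  have t: "0 < t n" "t n \<le> 1" for n by (auto simp: t_def field_simps)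
  have t0: "t \<longlonglongrightarrow> 0" unfolding t_def by (rule LIMSEQ_inverse_real_of_nat)
  define q where "q = (\<lambda>n x. (w (t n *\<^sub>R v + x) - w (0 + x)) / t n)"
  have line: "((\<lambda>s. w (s *\<^sub>R v + x)) has_derivative (\<lambda>h. h * ?dw (s *\<^sub>R v + x))) (at s)" for s x
  proof -
    have "((\<lambda>s. w (s *\<^sub>R v + x)) has_derivative (\<lambda>h. frechet_derivative w (at (s *\<^sub>R v + x)) (h *\<^sub>R v))) (at s)"
      by (rule has_derivative_compose[OF _ der]) (auto intro!: derivative_eq_intros)
    then show ?thesis
      by (simp add: linear_cmul[OF has_derivative_linear[OF der]])
  qed
  have "((\<lambda>x. ?dw x) has_integral 0) UNIV"
  proof (rule has_integral_dominated_convergence[where f = q and h = "\<lambda>x. if x \<in> cball 0 (R + norm v) then B' else 0" and y = "\<lambda>_. 0"])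
    show "(q n has_integral 0) UNIV" for n
      using has_integral_diff[OF trans[of "t n *\<^sub>R v"] trans[of 0]] has_integral_divide[of _ 0 UNIV "t n"]
      by (auto simp: q_def)
    show "(\<lambda>x. if x \<in> cball 0 (R + norm v) then B' else 0) integrable_on UNIV"
      by (simp only: integrable_restrict_UNIV) (rule integrable_on_const, simp)
    \<comment> \<open>The mean value theorem gives the bound \<open>B'\<close>. Because
      \<open>t n \<le> 1\<close>, the translate of \<open>K\<close> by
      \<open>- (t n *\<^sub>R v)\<close> stays within radius \<open>R + norm v\<close>.\<close>
    show "\<forall>x\<in>UNIV. norm (q n x) \<le> (if x \<in> cball 0 (R + norm v) then B' else 0)" for n
    proof
      fix x
      have "\<exists>s\<in>{0<..<t n}. w (t n *\<^sub>R v + x) - w (0 *\<^sub>R v + x) = (t n - 0) * ?dw (s *\<^sub>R v + x)"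
        using line has_derivative_continuous t(1)[of n]
        by (intro mvt_simple[where f' = "\<lambda>s h. h * ?dw (s *\<^sub>R v + x)"]) (auto intro: has_derivative_at_withinI)
      then obtain s where "w (t n *\<^sub>R v + x) - w (0 + x) = t n * ?dw (s *\<^sub>R v + x)" by auto
      then have "\<bar>q n x\<bar> \<le> B'"
        using t(1)[of n] B' by (simp add: q_def)
      moreover have "q n x = 0" if "norm x > R + norm v"
      proof -
        have "x \<notin> K" using R[of x] that norm_ge_zero[of v] by linarith
        moreover have "t n *\<^sub>R v + x \<notin> K"
        proof
          assume "t n *\<^sub>R v + x \<in> K"
          then have "norm (t n *\<^sub>R v + x) \<le> R" by (rule R)
          moreover have "norm (t n *\<^sub>R v) \<le> norm v"
            using t[of n] mult_right_mono[OF t(2)[of n] norm_ge_zero[of v]] by simp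
          moreover have "norm x \<le> norm (t n *\<^sub>R v + x) + norm (t n *\<^sub>R v)"
            using norm_triangle_ineq4[of "t n *\<^sub>R v + x" "t n *\<^sub>R v"] by simp
          ultimately show False using that by linarith
        qed
        ultimately show ?thesis using w0 by (simp add: q_def)
      qed
      ultimately show "norm (q n x) \<le> (if x \<in> cball 0 (R + norm v) then B' else 0)"
        by (auto simp: not_le)
    qed
    show "\<forall>x\<in>UNIV. (\<lambda>n. q n x) \<longlonglongrightarrow> ?dw x"
    proof
      fix x
      have "((\<lambda>s. w (s *\<^sub>R v + x)) has_real_derivative ?dw x) (at 0)"
        using line[of x 0] by (simp add: has_field_derivative_def mult_commute_abs)
      then have "((\<lambda>h. (w ((0 + h) *\<^sub>R v + x) - w (0 *\<^sub>R v + x)) / h) \<longlongrightarrow> ?dw x) (at 0)"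
        unfolding DERIV_def .
      moreover have "filterlim t (at 0) sequentially"
        using t0 t(1) by (auto simp: filterlim_at intro!: always_eventually less_imp_neq[THEN not_sym])
      ultimately have "(\<lambda>n. (w ((0 + t n) *\<^sub>R v + x) - w (0 *\<^sub>R v + x)) / t n) \<longlonglongrightarrow> ?dw x"
        by (rule filterlim_compose)
      then show "(\<lambda>n. q n x) \<longlonglongrightarrow> ?dw x" by (simp add: q_def)
    qed
  qed auto
  then show ?thesis .
qed

text \<open>The field is \<open>r\<^sup>n y / |y|\<^sup>n\<close> outside the ball, extended to a \<open>C\<^sup>1\<close> field by the first order
  Taylor polynomial of the radial factor in \<open>|y|\<^sup>2\<close>.\<close>

lemma ex_field_with_bump_divergence:
  assumes "r > 0"
  shows "\<exists>(V :: real^'n \<Rightarrow> real^'n::finite) \<omega>. Ck_on 1 UNIV V \<and> continuous_on UNIV \<omega> \<and>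
     (\<forall>y. \<omega> y \<ge> 0) \<and> \<omega> 0 > 0 \<and> (\<forall>y. norm y \<ge> r \<longrightarrow> \<omega> y = 0) \<and>
     (\<forall>y. \<exists>V'. (V has_derivative V') (at y) \<and> (\<Sum>i\<in>UNIV. V' (axis i 1) $ i) = \<omega> y)"
proof -
  define n where "n = real CARD('n)"
  have n: "n > 0" by (simp add: n_def)
  define \<eta> where "\<eta> = (\<lambda>u::real. if u \<in> {1..} then u powr (- n / 2) else 1 - n / 2 * (u - 1))"
  define \<eta>' where "\<eta>' = (\<lambda>u::real. - (n / 2) * max u 1 powr (- n / 2 - 1))"
  have d\<eta>: "(\<eta> has_real_derivative \<eta>' u) (at u)" for u
  proof -
    have "(\<eta> has_derivative (if u \<in> {1..} then (\<lambda>h. h * \<eta>' u) else (\<lambda>h. h * \<eta>' u))) (at u within ({1..} \<union> {..1}))"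
      unfolding \<eta>_def
    proof (rule has_derivative_If_within_closures)
      have *: "{1..} \<union> closure {1..} \<inter> closure {..1} = {1::real..}" "{..1} \<union> closure {1..} \<inter> closure {..1} = {..1::real}"
        by auto
      show "((\<lambda>u. u powr (- n / 2)) has_derivative (\<lambda>h. h * \<eta>' u)) (at u within {1..} \<union> closure {1..} \<inter> closure {..1})"
        if "u \<in> {1..} \<union> closure {1..} \<inter> closure {..1}"
      proof -
        have u: "u \<ge> 1" using that by auto
        then have "((\<lambda>u. u powr (- n / 2)) has_real_derivative - n / 2 * u powr (- n / 2 - 1)) (at u)"
          by (intro has_real_derivative_powr) auto
        then have "((\<lambda>u. u powr (- n / 2)) has_derivative (\<lambda>h. h * \<eta>' u)) (at u)"
          unfolding has_field_derivative_def
          by (rule has_derivative_eq_rhs) (use u in \<open>auto simp: \<eta>'_def max_def\<close>)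
        then show ?thesis by (rule has_derivative_at_withinI)
      qed
      show "((\<lambda>u. 1 - n / 2 * (u - 1)) has_derivative (\<lambda>h. h * \<eta>' u)) (at u within {..1} \<union> closure {1..} \<inter> closure {..1})"
        if "u \<in> {..1} \<union> closure {1..} \<inter> closure {..1}"
      proof -
        have u: "max u 1 = 1" using that by auto
        show ?thesis by (auto intro!: derivative_eq_intros simp: u \<eta>'_def)
      qed
    qed auto
    moreover have "{1..} \<union> {..1} = (UNIV::real set)" by auto
    ultimately show ?thesis
      by (simp add: has_field_derivative_def mult_commute_abs)
  qed
  have c\<eta>: "continuous_on UNIV \<eta>" using d\<eta> by (meson DERIV_continuous_on has_field_derivative_at_within)
  have c\<eta>': "continuous_on UNIV \<eta>'" unfolding \<eta>'_def by (intro continuous_intros) auto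
  define \<nu> where "\<nu> = (\<lambda>y::real^'n. (y \<bullet> y) / r\<^sup>2)"
  have c\<nu>: "continuous_on UNIV \<nu>" unfolding \<nu>_def using assms by (intro continuous_intros) auto
  define V where "V = (\<lambda>y::real^'n. \<eta> (\<nu> y) *\<^sub>R y)"
  define V' where "V' = (\<lambda>y h::real^'n. \<eta> (\<nu> y) *\<^sub>R h + (2 * (y \<bullet> h) / r\<^sup>2 * \<eta>' (\<nu> y)) *\<^sub>R y)"
  \<comment> \<open>The divergence of \<open>V\<close> is \<open>n \<eta> + 2 \<nu> \<eta>'\<close>,
    with \<open>\<eta>\<close> and \<open>\<eta>'\<close> taken at \<open>\<nu> y\<close>. The
    linear piece of \<open>\<eta>\<close> makes it \<open>n (1 + n / 2) (1 - \<nu>)\<close>, and the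
    power piece makes it 0.\<close>
  define \<omega> where "\<omega> = (\<lambda>y::real^'n. n * (1 + n / 2) * max 0 (1 - \<nu> y))"
  have dV: "(V has_derivative V' y) (at y)" for y
  proof -
    have "(\<nu> has_derivative (\<lambda>h. 2 * (y \<bullet> h) / r\<^sup>2)) (at y)"
    proof -
      have "((\<lambda>y. (y \<bullet> y) * inverse (r\<^sup>2)) has_derivative (\<lambda>h. (y \<bullet> h + h \<bullet> y) * inverse (r\<^sup>2))) (at y)"
        by (intro has_derivative_mult_left has_derivative_inner has_derivative_ident)
      then show ?thesis
        unfolding \<nu>_def divide_inverse by (rule has_derivative_eq_rhs) (simp add: inner_commute fun_eq_iff)
    qed
    then have "((\<lambda>y. \<eta> (\<nu> y)) has_derivative (\<lambda>h. 2 * (y \<bullet> h) / r\<^sup>2 * \<eta>' (\<nu> y))) (at y)"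
      by (rule has_derivative_eq_rhs[OF has_derivative_compose[OF _ d\<eta>[unfolded has_field_derivative_def]]])
        (simp add: mult_ac fun_eq_iff)
    then show ?thesis
      unfolding V_def V'_def
      using has_derivative_scaleR[OF _ has_derivative_ident[of "at y"]] by simp
  qed
  have "Ck_on (Suc 0) UNIV V"
  proof (rule Ck_on_SucI[OF open_UNIV dV])
    show "Ck_on 0 UNIV (\<lambda>y. V' y v)" for v
      unfolding V'_def using assms
      by (auto intro!: continuous_intros continuous_on_compose2[OF c\<eta> c\<nu>] continuous_on_compose2[OF c\<eta>' c\<nu>])
  qed
  moreover have "continuous_on UNIV \<omega>" unfolding \<omega>_def by (intro continuous_intros c\<nu>)
  moreover have "\<omega> y \<ge> 0" for y using n by (simp add: \<omega>_def)
  moreover have "\<omega> 0 > 0" using n by (simp add: \<omega>_def \<nu>_def add_pos_pos)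
  moreover have "\<omega> y = 0" if "norm y \<ge> r" for y
  proof -
    have "r\<^sup>2 \<le> y \<bullet> y" using power_mono[OF that, of 2] assms by (simp add: power2_norm_eq_inner)
    then show ?thesis using assms by (simp add: \<omega>_def \<nu>_def)
  qed
  moreover have "\<exists>V''. (V has_derivative V'') (at y) \<and> (\<Sum>i\<in>UNIV. V'' (axis i 1) $ i) = \<omega> y" for y
  proof -
    have "(\<Sum>i\<in>UNIV. V' y (axis i 1) $ i) = (\<Sum>i\<in>UNIV. \<eta> (\<nu> y) + 2 * \<eta>' (\<nu> y) / r\<^sup>2 * (y $ i * y $ i))"
      by (simp add: V'_def inner_axis algebra_simps)
    also have "\<dots> = n * \<eta> (\<nu> y) + 2 * \<nu> y * \<eta>' (\<nu> y)"
    proof -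
      have s: "(\<Sum>i\<in>UNIV. c * (y $ i * y $ i)) = c * (y \<bullet> y)" for c
        by (simp add: inner_vec_def sum_distrib_left)
      show ?thesis unfolding sum.distrib s by (simp add: n_def \<nu>_def)
    qed
    also have "\<dots> = \<omega> y"
    proof (cases "\<nu> y \<ge> 1")
      case True
      then have "\<nu> y * \<nu> y powr (- n / 2 - 1) = \<nu> y powr (- n / 2)"
        by (simp add: powr_diff)
      then show ?thesis using True by (simp add: \<eta>_def \<eta>'_def \<omega>_def max_def algebra_simps)
    next
      case False
      then show ?thesis by (simp add: \<eta>_def \<eta>'_def \<omega>_def max_def field_simps)
    qed
    finally show ?thesis using dV by blast
  qed
  ultimately show ?thesis by (intro exI[of _ V] exI[of _ \<omega>]) simp
qed

section \<open>The parity of the number of zeros in Euclidean space\<close>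

text \<open>The derivatives in the finitely many basis directions control the operator norm, so
  continuity of each of them suffices.\<close>

lemma frechet_derivative_onorm_continuous:
  fixes f :: "'a::euclidean_space \<Rightarrow> 'b::euclidean_space"
  assumes "open U" "Ck_on (Suc 0) U f" "a \<in> U" "e > 0"
  shows "\<exists>d>0. \<forall>x. dist a x < d \<longrightarrow> onorm (\<lambda>v. frechet_derivative f (at x) v - frechet_derivative f (at a) v) < e"
proof -
  let ?D = "\<lambda>x. frechet_derivative f (at x)"
  define E where "E = (\<lambda>x. \<Sum>b\<in>Basis. norm (?D x b - ?D a b))"
  have "continuous_on U (\<lambda>x. ?D x b)" for b using assms(2) by simp
  then have "continuous_on U E" unfolding E_def by (intro continuous_intros)
  then have "isCont E a" using assms(1,3) continuous_on_eq_continuous_at by blast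
  moreover have "E a = 0" by (simp add: E_def)
  ultimately obtain d1 where d1: "d1 > 0" "\<And>x. dist x a < d1 \<Longrightarrow> dist (E x) 0 < e / 2"
    using assms(4) unfolding continuous_at_eps_delta by (metis half_gt_zero)
  obtain d2 where d2: "d2 > 0" "ball a d2 \<subseteq> U" using assms(1,3) openE by blast
  have "onorm (\<lambda>v. ?D x v - ?D a v) < e" if "dist a x < min d1 d2" for x
  proof -
    have x: "x \<in> U" using that d2 by auto
    have lin: "linear (\<lambda>v. ?D x v - ?D a v)"
      using assms(2,3) x by (intro linear_compose_sub linear_frechet_derivative) auto
    have "norm (?D x v - ?D a v) \<le> E x * norm v" for v
    proof -
      have "?D x v - ?D a v = (\<Sum>b\<in>Basis. (v \<bullet> b) *\<^sub>R (?D x b - ?D a b))"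
        using linear_sum[OF lin, of "\<lambda>b. (v \<bullet> b) *\<^sub>R b" Basis] linear_cmul[OF lin]
        by (simp add: euclidean_representation)
      also have "norm \<dots> \<le> (\<Sum>b\<in>Basis. norm v * norm (?D x b - ?D a b))"
        by (rule sum_norm_le) (simp add: Basis_le_norm mult_right_mono)
      finally show ?thesis by (simp add: E_def sum_distrib_left[symmetric] mult.commute)
    qed
    then have "onorm (\<lambda>v. ?D x v - ?D a v) \<le> E x" by (rule onorm_le)
    also have "E x < e" using d1(2)[of x] that assms(4) by (auto simp: dist_commute)
    finally show ?thesis .
  qed
  then show ?thesis using d1 d2 by (intro exI[of _ "min d1 d2"]) auto
qed

lemma locally_injective:
  fixes f :: "'a::euclidean_space \<Rightarrow> 'b::euclidean_space"
  assumes "open U" "Ck_on (Suc 0) U f" "a \<in> U" "inj (frechet_derivative f (at a))"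
  obtains r where "r > 0" "ball a r \<subseteq> U" "inj_on f (ball a r)"
proof -
  have lin: "linear (frechet_derivative f (at a))"
    using assms(2,3) by (intro linear_frechet_derivative) auto
  then obtain g where g: "linear g" "g \<circ> frechet_derivative f (at a) = id"
    using linear_injective_left_inverse assms(4) by blast
  show ?thesis
    using has_derivative_locally_injective[OF assms(3,1) linear_conv_bounded_linear[THEN iffD1, OF g(1)],
        of "\<lambda>x. frechet_derivative f (at x)" f] g(2) Ck_on_has_derivative[OF assms(2)]
      frechet_derivative_onorm_continuous[OF assms(1,2,3)] that by blast
qed

lemma inj_frechet_derivative_iff:
  fixes f :: "real^'n \<Rightarrow> real^'n::finite"
  assumes "f differentiable (at x)"
  shows "inj (frechet_derivative f (at x)) \<longleftrightarrow> det (jacobian f (at x)) \<noteq> 0"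
  unfolding jacobian_def using det_nz_iff_inj[OF linear_frechet_derivative[OF assms]] by blast

text \<open>Reading the scalar integrand as a vector in \<open>real^1\<close> reduces this to the
  formula for vector-valued integrands.\<close>

lemma has_integral_change_of_variables_real:
  fixes g :: "real^'n::{finite,wellorder} \<Rightarrow> real^'n::_" and \<omega> :: "real^'n::_ \<Rightarrow> real"
  assumes "S \<in> sets lebesgue" "\<And>x. x \<in> S \<Longrightarrow> (g has_derivative g' x) (at x within S)" "inj_on g S"
    and "\<omega> absolutely_integrable_on (g ` S)"
  shows "((\<lambda>x. \<bar>det (matrix (g' x))\<bar> * \<omega> (g x)) has_integral integral (g ` S) \<omega>) S"
proof -
  let ?\<omega> = "\<lambda>y. vec (\<omega> y) :: real^1"
  have "?\<omega> absolutely_integrable_on (g ` S)"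
    using assms(4) by (simp add: absolutely_integrable_on_1_iff)
  then have "(\<lambda>x. \<bar>det (matrix (g' x))\<bar> *\<^sub>R ?\<omega> (g x)) absolutely_integrable_on S \<and>
           integral S (\<lambda>x. \<bar>det (matrix (g' x))\<bar> *\<^sub>R ?\<omega> (g x)) = integral (g ` S) ?\<omega>"
    using has_absolute_integral_change_of_variables[OF assms(1-3), of ?\<omega> "integral (g ` S) ?\<omega>"] by blast
  then show ?thesis
    by (simp add: absolutely_integrable_on_1_iff integral_on_1_eq has_integral_iff absolutely_integrable_on_def)
qed

text \<open>For small \<open>r0\<close> the part of \<open>S\<close> where
  \<open>norm (f x) < r0\<close> splits into disjoint neighbourhoods \<open>A z\<close> of the
  zeros, each mapped bijectively onto \<open>ball 0 r0\<close>. The change of variables on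
  \<open>A z\<close> contributes the integral of \<open>\<omega>\<close> with the sign of the
  Jacobian determinant, which is constant there.\<close>

lemma local_degree_formula:
  fixes f :: "real^'n::{finite,wellorder} \<Rightarrow> real^'n::_"
  assumes U: "open U" "Ck_on (Suc 0) U f" and S: "compact S" "S \<subseteq> U"
    and Z: "finite {x\<in>S. f x = 0}" "{x\<in>S. f x = 0} \<subseteq> interior S"
    and nd: "\<And>x. x \<in> S \<Longrightarrow> f x = 0 \<Longrightarrow> det (jacobian f (at x)) \<noteq> 0"
  shows "\<exists>r0>0. \<forall>\<omega>. continuous_on UNIV \<omega> \<longrightarrow> (\<forall>y. r0 \<le> norm y \<longrightarrow> \<omega> y = (0::real)) \<longrightarrow>
     ((\<lambda>x. \<omega> (f x) * det (jacobian f (at x))) has_integral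
        (\<Sum>z | z \<in> S \<and> f z = 0. sgn (det (jacobian f (at z)))) * integral UNIV \<omega>) S"
proof -
  let ?J = "\<lambda>x. det (jacobian f (at x))"
  let ?Z = "{x\<in>S. f x = 0}"
  have cf: "continuous_on U f" using Ck_on_imp_continuous_on[OF U(2)] .
  have cJ: "continuous_on U ?J" using Ck_on_det_jacobian[OF U] by simp
  have df: "f differentiable (at x)" if "x \<in> U" for x using U(2) that by simp
  have "\<exists>e>0. ball z e \<subseteq> interior S \<and> inj_on f (ball z e) \<and> (\<forall>x\<in>ball z e. sgn (?J x) = sgn (?J z))
      \<and> (\<forall>z'\<in>?Z. z' \<noteq> z \<longrightarrow> dist z z' \<ge> 2 * e)" if z: "z \<in> ?Z" for z
  proof -
    have zU: "z \<in> U" using z S by auto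
    have nz: "?J z \<noteq> 0" using nd z by auto
    obtain e1 where e1: "e1 > 0" "inj_on f (ball z e1)"
      using locally_injective[OF U zU] inj_frechet_derivative_iff[OF df[OF zU]] nz by metis
    obtain e2 where e2: "e2 > 0" "ball z e2 \<subseteq> interior S"
      using openE[OF open_interior subsetD[OF Z(2) z]] .
    have "isCont ?J z" using cJ zU U(1) continuous_on_eq_continuous_at by blast
    then obtain e3 where e3: "e3 > 0" "\<And>x. dist x z < e3 \<Longrightarrow> dist (?J x) (?J z) < \<bar>?J z\<bar>"
      using nz unfolding continuous_at_eps_delta by (meson zero_less_abs_iff)
    have e3': "sgn (?J x) = sgn (?J z)" if "dist x z < e3" for x
      using e3(2)[OF that] nz by (auto simp: dist_real_def sgn_if abs_if split: if_splits)
    obtain e4 where e4: "e4 > 0" "\<And>z'. z' \<in> ?Z \<Longrightarrow> z' \<noteq> z \<Longrightarrow> e4 \<le> dist z z'"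
      using finite_set_avoid[OF Z(1), of z] by blast
    \<comment> \<open>Half of \<open>e4\<close> keeps the balls around different zeros
      disjoint.\<close>
    define e where "e = Min {e1, e2, e3, e4 / 2}"
    have "e > 0" "e \<le> e1" "e \<le> e2" "e \<le> e3" "2 * e \<le> e4" using e1 e2 e3 e4 by (auto simp: e_def)
    then have sub: "ball z e \<subseteq> ball z e1" "ball z e \<subseteq> ball z e2" "ball z e \<subseteq> ball z e3"
      by (auto intro: subset_ball)
    have "ball z e \<subseteq> interior S" using sub(2) e2(2) by blast
    moreover have "inj_on f (ball z e)" by (rule inj_on_subset[OF e1(2) sub(1)])
    moreover have "sgn (?J x) = sgn (?J z)" if "x \<in> ball z e" for x
      using subsetD[OF sub(3) that] by (intro e3') (simp add: dist_commute)
    moreover have "dist z z' \<ge> 2 * e" if "z' \<in> ?Z" "z' \<noteq> z" for z'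
      using e4(2)[OF that] \<open>2 * e \<le> e4\<close> by linarith
    ultimately show ?thesis using \<open>e > 0\<close> by (intro exI[of _ e] conjI ballI impI)
  qed
  then have "\<forall>z\<in>?Z. \<exists>e>0. ball z e \<subseteq> interior S \<and> inj_on f (ball z e) \<and> (\<forall>x\<in>ball z e. sgn (?J x) = sgn (?J z))
      \<and> (\<forall>z'\<in>?Z. z' \<noteq> z \<longrightarrow> dist z z' \<ge> 2 * e)" by blast
  from bchoice[OF this] obtain ee where ee': "\<forall>z\<in>?Z. ee z > 0 \<and> ball z (ee z) \<subseteq> interior S \<and>
      inj_on f (ball z (ee z)) \<and> (\<forall>x\<in>ball z (ee z). sgn (?J x) = sgn (?J z))
      \<and> (\<forall>z'\<in>?Z. z' \<noteq> z \<longrightarrow> dist z z' \<ge> 2 * ee z)"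
    by blast
  have ee: "\<And>z. z \<in> ?Z \<Longrightarrow> ee z > 0" "\<And>z. z \<in> ?Z \<Longrightarrow> ball z (ee z) \<subseteq> interior S"
    "\<And>z. z \<in> ?Z \<Longrightarrow> inj_on f (ball z (ee z))" "\<And>z x. z \<in> ?Z \<Longrightarrow> x \<in> ball z (ee z) \<Longrightarrow> sgn (?J x) = sgn (?J z)"
    "\<And>z z'. z \<in> ?Z \<Longrightarrow> z' \<in> ?Z \<Longrightarrow> z' \<noteq> z \<Longrightarrow> dist z z' \<ge> 2 * ee z"
    using ee' by blast+
  have disj: "z = z'" if "z \<in> ?Z" "z' \<in> ?Z" "x \<in> ball z (ee z)" "x \<in> ball z' (ee z')" for z z' x
  proof (rule ccontr)
    assume "z \<noteq> z'"
    then have "2 * ee z \<le> dist z z'" "2 * ee z' \<le> dist z z'"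
      using ee(5)[OF that(1,2)] ee(5)[OF that(2,1)] by (auto simp: dist_commute)
    moreover have "dist z z' \<le> dist z x + dist z' x" by (rule dist_triangle2)
    ultimately show False using that(3,4) by auto
  qed
  have im: "\<exists>r>0. ball 0 r \<subseteq> f ` ball z (ee z)" if "z \<in> ?Z" for z
  proof -
    have "ball z (ee z) \<subseteq> U" using ee(2)[OF that] interior_subset[of S] S(2) by blast
    then have "open (f ` ball z (ee z))"
      by (intro invariance_of_domain continuous_on_subset[OF cf] ee(3) that) auto
    moreover have "0 \<in> f ` ball z (ee z)" using that ee(1)[OF that] by force
    ultimately show ?thesis using openE by blast
  qed
  then have "\<forall>z\<in>?Z. \<exists>r>0. ball 0 r \<subseteq> f ` ball z (ee z)" by blast
  from bchoice[OF this] obtain rr where rr: "\<And>z. z \<in> ?Z \<Longrightarrow> rr z > 0"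
    "\<And>z. z \<in> ?Z \<Longrightarrow> ball 0 (rr z) \<subseteq> f ` ball z (ee z)"
    by blast
  let ?T = "S - (\<Union>z\<in>?Z. ball z (ee z))"
  have "\<exists>\<delta>>0. \<forall>x\<in>?T. \<delta> \<le> norm (f x)"
  proof (cases "?T = {}")
    case False
    have "compact ?T" using S(1) by (intro compact_diff open_UN ballI open_ball)
    moreover have "continuous_on ?T (\<lambda>x. norm (f x))"
      by (intro continuous_intros continuous_on_subset[OF cf]) (use S(2) in auto)
    ultimately have "\<exists>x\<in>?T. \<forall>y\<in>?T. norm (f x) \<le> norm (f y)"
      using False by (intro continuous_attains_inf)
    then obtain x where x: "x \<in> ?T" "\<forall>y\<in>?T. norm (f x) \<le> norm (f y)" by (elim bexE)
    have "f x \<noteq> 0"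
    proof
      assume "f x = 0"
      then have "x \<in> ?Z" using x(1) by simp
      then have "x \<in> (\<Union>z\<in>?Z. ball z (ee z))" by (rule UN_I) (simp add: ee(1)[OF \<open>x \<in> ?Z\<close>])
      then show False using x(1) by simp
    qed
    then show ?thesis using x(2) by (intro exI[of _ "norm (f x)"] conjI) simp_all
  next
    case True
    show ?thesis unfolding True by (rule exI[of _ 1]) simp
  qed
  then obtain \<delta> where \<delta>: "\<delta> > 0" "\<forall>x\<in>?T. \<delta> \<le> norm (f x)" by (elim exE conjE)
  \<comment> \<open>\<open>r0 \<le> \<delta>\<close> confines the points of \<open>S\<close> with
    \<open>norm (f x) < r0\<close> to the balls, and \<open>r0 \<le> rr z\<close> makes
    \<open>f\<close> map \<open>A z\<close> onto the whole of \<open>ball 0 r0\<close>.\<close>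
  define r0 where "r0 = Min (insert \<delta> (rr ` ?Z))"
  have r0: "r0 > 0" "r0 \<le> \<delta>" "\<And>z. z \<in> ?Z \<Longrightarrow> r0 \<le> rr z"
    using Z(1) \<delta> rr(1) by (auto simp: r0_def)
  define A where "A = (\<lambda>z. {x \<in> ball z (ee z). norm (f x) < r0})"
  have AU: "A z \<subseteq> U" "A z \<subseteq> S" if "z \<in> ?Z" for z
  proof -
    have "A z \<subseteq> ball z (ee z)" by (auto simp: A_def)
    then show "A z \<subseteq> S" using ee(2)[OF that] interior_subset[of S] by (meson order_trans)
    then show "A z \<subseteq> U" using S(2) by (rule order_trans)
  qed
  have fA: "f ` A z = ball 0 r0" if z: "z \<in> ?Z" for z
  proof
    show "f ` A z \<subseteq> ball 0 r0" by (auto simp: A_def)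
    show "ball 0 r0 \<subseteq> f ` A z"
    proof
      fix y :: "real^'n::_" assume y: "y \<in> ball 0 r0"
      then have "y \<in> ball 0 (rr z)" using r0(3)[OF that] by simp
      then obtain x where "x \<in> ball z (ee z)" "y = f x" using rr(2)[OF z] by blast
      then show "y \<in> f ` A z" using y by (auto simp: A_def)
    qed
  qed
  have oA: "open (A z)" if "z \<in> ?Z" for z
  proof -
    have "A z = ball z (ee z) \<inter> f -` ball 0 r0" by (auto simp: A_def)
    moreover have "ball z (ee z) \<subseteq> U" using ee(2)[OF that] interior_subset[of S] S(2) by blast
    ultimately show ?thesis
      using continuous_open_preimage[OF continuous_on_subset[OF cf] open_ball open_ball] by metis
  qed
  have "((\<lambda>x. \<omega> (f x) * ?J x) has_integral (\<Sum>z\<in>?Z. sgn (?J z)) * integral UNIV \<omega>) S"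
    if \<omega>: "continuous_on UNIV \<omega>" "\<And>y. r0 \<le> norm y \<Longrightarrow> \<omega> y = (0::real)" for \<omega>
  proof -
    have "\<omega> absolutely_integrable_on ball 0 r0"
    proof -
      have "\<omega> absolutely_integrable_on cball 0 r0"
        using borel_integrable_compact[OF compact_cball continuous_on_subset[OF \<omega>(1) subset_UNIV], of 0 r0]
        unfolding set_integrable_def by (simp add: integrable_completion borel_measurable_integrable)
      then show ?thesis by (rule set_integrable_subset) auto
    qed
    have "integral (ball 0 r0) \<omega> = integral UNIV \<omega>"
    proof -
      have "(\<lambda>y. if y \<in> ball 0 r0 then \<omega> y else 0) = \<omega>"
        using \<omega>(2) by (auto simp: fun_eq_iff)
      then show ?thesis using integral_restrict_UNIV[of "ball 0 r0" \<omega>] by simp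
    qed
    have cov: "((\<lambda>x. \<bar>?J x\<bar> * \<omega> (f x)) has_integral integral UNIV \<omega>) (A z)" if "z \<in> ?Z" for z
    proof -
      have "((\<lambda>x. \<bar>det (matrix (frechet_derivative f (at x)))\<bar> * \<omega> (f x)) has_integral integral (f ` A z) \<omega>) (A z)"
      proof (rule has_integral_change_of_variables_real)
        show "A z \<in> sets lebesgue" using oA[OF that] by (simp add: lmeasurable_open borel_open)
        show "(f has_derivative frechet_derivative f (at x)) (at x within A z)" if x: "x \<in> A z" for x
          using Ck_on_has_derivative[OF U(2) subsetD[OF AU(1)[OF \<open>z \<in> ?Z\<close>] x]] by (rule has_derivative_at_withinI)
        show "inj_on f (A z)" by (rule inj_on_subset[OF ee(3)[OF that]]) (auto simp: A_def)
        show "\<omega> absolutely_integrable_on f ` A z" unfolding fA[OF that] by fact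
      qed
      then show ?thesis unfolding fA[OF that] jacobian_def using \<open>integral (ball 0 r0) \<omega> = integral UNIV \<omega>\<close> by simp
    qed
    have one: "((\<lambda>x. if x \<in> A z then \<omega> (f x) * ?J x else 0) has_integral sgn (?J z) * integral UNIV \<omega>) S" if "z \<in> ?Z" for z
    proof -
      have "((\<lambda>x. sgn (?J z) * (\<bar>?J x\<bar> * \<omega> (f x))) has_integral sgn (?J z) * integral UNIV \<omega>) (A z)"
        by (rule has_integral_mult_right[OF cov[OF that]])
      then have "((\<lambda>x. \<omega> (f x) * ?J x) has_integral sgn (?J z) * integral UNIV \<omega>) (A z)"
      proof (rule has_integral_eq[rotated])
        fix x assume "x \<in> A z"
        then have "sgn (?J z) = sgn (?J x)" using ee(4)[OF that, of x] by (simp add: A_def)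
        then have "sgn (?J z) * (\<bar>?J x\<bar> * \<omega> (f x)) = (sgn (?J x) * \<bar>?J x\<bar>) * \<omega> (f x)" by simp
        then show "sgn (?J z) * (\<bar>?J x\<bar> * \<omega> (f x)) = \<omega> (f x) * ?J x"
          unfolding mult_sgn_abs by (simp add: mult.commute)
      qed
      then show ?thesis by (simp only: has_integral_restrict[OF AU(2)[OF that]])
    qed
    have "((\<lambda>x. \<Sum>z\<in>?Z. if x \<in> A z then \<omega> (f x) * ?J x else 0) has_integral (\<Sum>z\<in>?Z. sgn (?J z) * integral UNIV \<omega>)) S"
      by (intro has_integral_sum Z(1) one)
    then show ?thesis
      unfolding sum_distrib_right
    proof (rule has_integral_eq[rotated])
      fix x assume x: "x \<in> S"
      show "(\<Sum>z\<in>?Z. if x \<in> A z then \<omega> (f x) * ?J x else 0) = \<omega> (f x) * ?J x"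
      proof (cases "\<exists>z\<in>?Z. x \<in> A z")
        case True
        then obtain z where z: "z \<in> ?Z" "x \<in> A z" by blast
        have "(\<Sum>z\<in>?Z. if x \<in> A z then \<omega> (f x) * ?J x else 0) = (\<Sum>z'\<in>?Z. if z' = z then \<omega> (f x) * ?J x else 0)"
        proof (rule sum.cong)
          fix z' assume z': "z' \<in> ?Z"
          have "x \<in> A z' \<longleftrightarrow> z' = z"
            using disj[OF z' z(1)] z(2) unfolding A_def by blast
          then show "(if x \<in> A z' then \<omega> (f x) * ?J x else 0) = (if z' = z then \<omega> (f x) * ?J x else 0)" by simp
        qed simp
        also have "\<dots> = \<omega> (f x) * ?J x" using z(1) Z(1) by simp
        finally show ?thesis .
      next
        case False
        have "r0 \<le> norm (f x)"
        proof (cases "x \<in> ?T")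
          case True
          then have "\<delta> \<le> norm (f x)" using \<delta>(2) by (rule bspec[rotated])
          then show ?thesis using r0(2) by linarith
        next
          case F: False
          then obtain z where "z \<in> ?Z" "x \<in> ball z (ee z)" using x by blast
          then have "x \<notin> A z" using False by blast
          then show ?thesis using \<open>x \<in> ball z (ee z)\<close> by (simp add: A_def)
        qed
        then have "\<omega> (f x) = 0" by (rule \<omega>(2))
        then show ?thesis by (simp cong: if_cong)
      qed
    qed
  qed
  with r0(1) show ?thesis by blast
qed

text \<open>Both signs are odd, so modulo 2 only the number of summands counts.\<close>

lemma sum_signs_parity:
  fixes s :: "'a \<Rightarrow> real"
  assumes "finite A" "\<And>x. x \<in> A \<Longrightarrow> s x = 1 \<or> s x = -1"
  shows "\<exists>k::int. (\<Sum>x\<in>A. s x) = of_int (int (card A) + 2 * k)"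
  using assms
proof (induction A)
  case empty
  show ?case by (intro exI[of _ 0]) simp
next
  case (insert x A)
  then obtain k where k: "(\<Sum>x\<in>A. s x) = of_int (int (card A) + 2 * k)" by blast
  have "s x = 1 \<or> s x = -1" using insert.prems by blast
  then show ?case
  proof
    assume "s x = 1"
    then show ?thesis using insert.hyps k by (intro exI[of _ k]) simp
  next
    assume "s x = -1"
    then show ?thesis using insert.hyps k by (intro exI[of _ "k - 1"]) simp
  qed
qed

text \<open>The pulled back fields of \<open>f\<close> and \<open>g\<close> agree outside
  \<open>cball a \<rho>\<close>, so their difference has compact support and its divergence
  integrates to 0. Hence both maps have the same sum of signs over a slightly larger ball, and the
  parity of this sum is the parity of the number of zeros in it. Outside that ball the zeros are the
  same.\<close>

lemma zeros_parity_local: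
  fixes f g :: "real^'n::{finite,wellorder} \<Rightarrow> real^'n::_"
  assumes U: "open U" "Ck_on 2 U f" "Ck_on 2 U g"
    and a: "cball a \<rho> \<subseteq> U" "\<And>x. x \<in> U \<Longrightarrow> x \<notin> cball a \<rho> \<Longrightarrow> f x = g x"
    and Z: "finite {x\<in>U. f x = 0}" "finite {x\<in>U. g x = 0}"
    and nd: "\<And>x. x \<in> U \<Longrightarrow> f x = 0 \<Longrightarrow> det (jacobian f (at x)) \<noteq> 0"
      "\<And>x. x \<in> U \<Longrightarrow> g x = 0 \<Longrightarrow> det (jacobian g (at x)) \<noteq> 0"
    and "\<rho> > 0"
  shows "even (card {x\<in>U. f x = 0} + card {x\<in>U. g x = 0})"
proof -
  let ?J = "\<lambda>f x. det (jacobian f (at x))"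
  have U2: "Ck_on (Suc (Suc 0)) U f" "Ck_on (Suc (Suc 0)) U g"
    using U(2,3) unfolding numeral_2_eq_2 .
  note U1 = U2[THEN Ck_on_Suc_imp]
  obtain e where e: "e > 0" "(\<Union>x\<in>cball a \<rho>. cball x e) \<subseteq> U"
    using compact_subset_open_imp_cball_epsilon_subset[OF compact_cball U(1) a(1)] .
  have cb: "cball a (\<rho> + e) \<subseteq> U"
  proof
    fix x assume x: "x \<in> cball a (\<rho> + e)"
    have "x \<in> (\<Union>x\<in>cball a \<rho>. cball x e)"
    proof (cases "dist a x \<le> \<rho>")
      case True
      then show ?thesis using e(1) by (intro UN_I[of x]) auto
    next
      case False
      \<comment> \<open>The radial projection of \<open>x\<close> to the sphere of radius
        \<open>\<rho>\<close>.\<close>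
      define p where "p = a + (\<rho> / dist a x) *\<^sub>R (x - a)"
      have ax: "a \<noteq> x" using False \<open>\<rho> > 0\<close> by auto
      then have 1: "dist a p = \<rho>" using \<open>\<rho> > 0\<close> by (simp add: p_def dist_norm norm_minus_commute)
      have "x - p = (1 - \<rho> / dist a x) *\<^sub>R (x - a)" by (simp add: p_def algebra_simps)
      then have "norm (x - p) = \<bar>1 - \<rho> / dist a x\<bar> * norm (x - a)" by simp
      then have "dist p x = \<bar>1 - \<rho> / dist a x\<bar> * dist a x" by (simp add: dist_norm norm_minus_commute)
      also have "\<dots> = dist a x - \<rho>" using False ax \<open>\<rho> > 0\<close> by (simp add: abs_if field_simps)
      finally have "dist p x \<le> e" using x by simp
      with 1 show ?thesis by (intro UN_I[of p]) auto
    qed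
    then show "x \<in> U" using e(2) by blast
  qed
  \<comment> \<open>The degree formula allows no zeros on the boundary of \<open>S\<close>. Only
    finitely many radii are bad, and those of \<open>f\<close> suffice because \<open>g\<close>
    agrees with \<open>f\<close> beyond radius \<open>\<rho>\<close>.\<close>
  have "infinite {\<rho><..<\<rho> + e}" using e(1) by simp
  moreover have "finite ((\<lambda>x. dist a x) ` {x\<in>U. f x = 0})" using Z(1) by simp
  ultimately obtain R where R: "R \<in> {\<rho><..<\<rho> + e}" "R \<notin> dist a ` {x\<in>U. f x = 0}"
    by (meson finite_subset subsetI)
  define S where "S = cball a R"
  have S: "compact S" "S \<subseteq> U" "interior S = ball a R" "cball a \<rho> \<subseteq> ball a R"
    using R(1) cb by (auto simp: S_def)
  have Zf: "finite {x\<in>S. f x = 0}" "finite {x\<in>S. g x = 0}"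
    using S(2) by (auto intro: finite_subset[OF _ Z(1)] finite_subset[OF _ Z(2)])
  have If: "{x\<in>S. f x = 0} \<subseteq> interior S" "{x\<in>S. g x = 0} \<subseteq> interior S"
  proof -
    have "dist a x \<noteq> R" if "x \<in> S" "f x = 0 \<or> g x = 0" for x
    proof
      assume d: "dist a x = R"
      then have "x \<notin> cball a \<rho>" "x \<in> U" using R(1) S(2) that by auto
      then have "f x = 0" using a(2) that by metis
      then show False using d R(2) \<open>x \<in> U\<close> by blast
    qed
    then show "{x\<in>S. f x = 0} \<subseteq> interior S" "{x\<in>S. g x = 0} \<subseteq> interior S"
      unfolding S(3) unfolding S_def by (auto simp: order_less_le)
  qed
  obtain r1 where r1: "r1 > 0" "\<forall>\<omega>. continuous_on UNIV \<omega> \<longrightarrow> (\<forall>y. r1 \<le> norm y \<longrightarrow> \<omega> y = (0::real)) \<longrightarrow>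
     ((\<lambda>x. \<omega> (f x) * ?J f x) has_integral
        (\<Sum>z | z \<in> S \<and> f z = 0. sgn (?J f z)) * integral UNIV \<omega>) S"
    using local_degree_formula[OF U(1) U1(1) S(1,2) Zf(1) If(1)] nd(1) S(2) by blast
  obtain r2 where r2: "r2 > 0" "\<forall>\<omega>. continuous_on UNIV \<omega> \<longrightarrow> (\<forall>y. r2 \<le> norm y \<longrightarrow> \<omega> y = (0::real)) \<longrightarrow>
     ((\<lambda>x. \<omega> (g x) * ?J g x) has_integral
        (\<Sum>z | z \<in> S \<and> g z = 0. sgn (?J g z)) * integral UNIV \<omega>) S"
    using local_degree_formula[OF U(1) U1(2) S(1,2) Zf(2) If(2)] nd(2) S(2) by blast
  have "min r1 r2 > 0" using r1 r2 by simp
  from ex_field_with_bump_divergence[OF this, where 'n = 'n]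
  obtain V :: "real^'n::_ \<Rightarrow> real^'n::_" and \<omega> where V: "Ck_on 1 UNIV V" and c\<omega>: "continuous_on UNIV \<omega>" and \<omega>pos: "\<And>y. \<omega> y \<ge> 0" "\<omega> 0 > 0"
    and \<omega>0: "\<And>y. norm y \<ge> min r1 r2 \<Longrightarrow> \<omega> y = 0"
    and div: "\<And>y. \<exists>V'. (V has_derivative V') (at y) \<and> (\<Sum>i\<in>UNIV. V' (axis i 1) $ i) = \<omega> y"
    by (elim exE conjE) blast
  define sf sg where "sf = (\<Sum>z | z \<in> S \<and> f z = 0. sgn (?J f z))" and "sg = (\<Sum>z | z \<in> S \<and> g z = 0. sgn (?J g z))"
  have int: "((\<lambda>x. \<omega> (f x) * ?J f x) has_integral sf * integral UNIV \<omega>) S"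
     "((\<lambda>x. \<omega> (g x) * ?J g x) has_integral sg * integral UNIV \<omega>) S"
    using r1(2) r2(2) c\<omega> \<omega>0 unfolding sf_def sg_def by simp_all
  \<comment> \<open>The extension by 0 is \<open>C\<^sup>1\<close> on the whole space:
    \<open>U\<close> and the complement of \<open>cball a \<rho>\<close> are open and cover it, and
    \<open>W j\<close> vanishes on the latter.\<close>
  define W where "W = (\<lambda>j x. if x \<in> U then pullback_field V f j x - pullback_field V g j x else 0)"
  have pf: "Ck_on 1 U (pullback_field V f j)" "Ck_on 1 U (pullback_field V g j)" for j
    using Ck_on_pullback_field[OF U(1) U2(1), of V] Ck_on_pullback_field[OF U(1) U2(2), of V] V by simp_all
  have oK: "open (- cball a \<rho>)" by (simp add: open_Compl)
  have W0: "W j x = 0" if "x \<notin> cball a \<rho>" for j x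
  proof (cases "x \<in> U")
    case True
    have "frechet_derivative f (at x) = frechet_derivative g (at x)"
      by (rule frechet_derivative_transform_within_open[where X = "U - cball a \<rho>"])
         (use U1(1) U(1) True that a(2) in auto)
    then have "jacobian f (at x) = jacobian g (at x)" by (simp add: jacobian_def)
    moreover have "f x = g x" using a(2) True that by blast
    ultimately have "pullback_field V f j x = pullback_field V g j x"
      unfolding pullback_field_def cofactor_map_def by (simp only:)
    then show ?thesis by (simp add: W_def)
  qed (simp add: W_def)
  have CW: "Ck_on 1 UNIV (W j)" for j
  proof (rule Ck_on_local)
    fix x :: "real^'n::_"
    show "\<exists>T. open T \<and> x \<in> T \<and> Ck_on 1 T (W j)"
    proof (cases "x \<in> U")
      case True
      have "Ck_on 1 U (W j)"
        by (rule Ck_on_cong_open[OF U(1) _ Ck_on_diff[OF U(1) pf]]) (simp add: W_def)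
      then show ?thesis using True U(1) by blast
    next
      case False
      have "Ck_on 1 (- cball a \<rho>) (W j)"
        by (rule Ck_on_cong_open[OF oK _ Ck_on_const[where c = 0]]) (simp add: W0)
      then show ?thesis using False a(1) oK by blast
    qed
  qed
  have I0: "((\<lambda>x. \<Sum>j\<in>UNIV. frechet_derivative (W j) (at x) (axis j 1)) has_integral 0) UNIV"
    using has_integral_sum[OF finite, of UNIV "\<lambda>j x. frechet_derivative (W j) (at x) (axis j 1)" "\<lambda>_. 0" UNIV]
      integral_derivative_compact_support[OF CW compact_cball W0] by simp
  have dW: "(\<Sum>j\<in>UNIV. frechet_derivative (W j) (at x) (axis j 1)) =
      (if x \<in> S then \<omega> (f x) * ?J f x - \<omega> (g x) * ?J g x else 0)" for x
  proof (cases "x \<in> S")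
    case True
    then have x: "x \<in> U" using S(2) by blast
    have "frechet_derivative (W j) (at x) h = frechet_derivative (pullback_field V f j) (at x) h
         - frechet_derivative (pullback_field V g j) (at x) h" for j h
    proof -
      have "((\<lambda>y. pullback_field V f j y - pullback_field V g j y) has_derivative
         (\<lambda>h. frechet_derivative (pullback_field V f j) (at x) h
         - frechet_derivative (pullback_field V g j) (at x) h)) (at x)"
        using pf[of j] x by (intro has_derivative_diff Ck_on_has_derivative[of 0 U]) simp_all
      then have "(W j has_derivative (\<lambda>h. frechet_derivative (pullback_field V f j) (at x) h
         - frechet_derivative (pullback_field V g j) (at x) h)) (at x)"
        by (rule has_derivative_transform_within_open[OF _ U(1) x]) (simp add: W_def)
      from frechet_derivative_at[OF this] show ?thesis by (rule fun_cong[OF sym])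
    qed
    moreover have "(\<Sum>j\<in>UNIV. frechet_derivative (pullback_field V f j) (at x) (axis j 1)) = \<omega> (f x) * ?J f x"
    proof -
      obtain V' where V': "(V has_derivative V') (at (f x))" "(\<Sum>i\<in>UNIV. V' (axis i 1) $ i) = \<omega> (f x)"
        using div[of "f x"] by (elim exE conjE)
      show ?thesis using pullback_field_divergence[OF U(1,2) x V'(1)] unfolding V'(2) .
    qed
    moreover have "(\<Sum>j\<in>UNIV. frechet_derivative (pullback_field V g j) (at x) (axis j 1)) = \<omega> (g x) * ?J g x"
    proof -
      obtain V' where V': "(V has_derivative V') (at (g x))" "(\<Sum>i\<in>UNIV. V' (axis i 1) $ i) = \<omega> (g x)"
        using div[of "g x"] by (elim exE conjE)
      show ?thesis using pullback_field_divergence[OF U(1,3) x V'(1)] unfolding V'(2) .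
    qed
    ultimately show ?thesis using True by (simp add: sum_subtractf)
  next
    case False
    then have x: "x \<in> - cball a \<rho>" using S(3,4) interior_subset[of S] by blast
    have "W j differentiable (at x)" for j using CW[of j] by simp
    then have "frechet_derivative (W j) (at x) = frechet_derivative (\<lambda>_. 0) (at x)" for j
      by (rule frechet_derivative_transform_within_open[OF _ oK x]) (simp add: W0)
    then show ?thesis using False by simp
  qed
  have "((\<lambda>x. if x \<in> S then \<omega> (f x) * ?J f x - \<omega> (g x) * ?J g x else 0) has_integral 0) UNIV"
    using I0 unfolding dW .
  then have "((\<lambda>x. \<omega> (f x) * ?J f x - \<omega> (g x) * ?J g x) has_integral 0) S"
    unfolding has_integral_restrict_UNIV .
  from has_integral_unique[OF this has_integral_diff[OF int]]
  have "(sf - sg) * integral UNIV \<omega> = 0" by (simp add: left_diff_distrib)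
  \<comment> \<open>A continuous nonnegative function that is positive at 0 has a nonzero integral
    over a box around 0.\<close>
  moreover have "integral UNIV \<omega> \<noteq> 0"
  proof -
    obtain c :: "real^'n::_" where c: "ball 0 (min r1 r2) \<subseteq> box (- c) c"
      using bounded_subset_box_symmetric[OF bounded_ball] .
    then have c0: "0 \<in> box (- c) c" using \<open>min r1 r2 > 0\<close> by auto
    have "(\<lambda>y. if y \<in> cbox (- c) c then \<omega> y else 0) = \<omega>"
    proof
      fix y
      show "(if y \<in> cbox (- c) c then \<omega> y else 0) = \<omega> y"
        using \<omega>0[of y] subsetD[OF order_trans[OF c box_subset_cbox], of y] by (cases "norm y < min r1 r2") auto
    qed
    then have "integral UNIV \<omega> = integral (cbox (- c) c) \<omega>"
      using integral_restrict_UNIV[of "cbox (- c) c" \<omega>] by simp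
    moreover have "integral (cbox (- c) c) \<omega> \<noteq> 0"
      using integral_cbox_eq_0_iff[OF continuous_on_subset[OF c\<omega> subset_UNIV], of "- c" c] \<omega>pos c0 box_subset_cbox
      by fastforce
    ultimately show ?thesis by simp
  qed
  ultimately have ss: "sf = sg" by simp
  have "\<exists>k::int. sf = of_int (int (card {x\<in>S. f x = 0}) + 2 * k)"
    unfolding sf_def using Zf(1) nd(1) S(2) by (intro sum_signs_parity) (auto simp: sgn_if)
  then obtain k where k: "sf = of_int (int (card {x\<in>S. f x = 0}) + 2 * k)" by blast
  have "\<exists>k::int. sg = of_int (int (card {x\<in>S. g x = 0}) + 2 * k)"
    unfolding sg_def using Zf(2) nd(2) S(2) by (intro sum_signs_parity) (auto simp: sgn_if)
  then obtain l where l: "sg = of_int (int (card {x\<in>S. g x = 0}) + 2 * l)" by blast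
  have eq: "int (card {x\<in>S. f x = 0}) + 2 * k = int (card {x\<in>S. g x = 0}) + 2 * l"
    using ss unfolding k l of_int_eq_iff .
  have "cball a \<rho> \<subseteq> S" using S(3,4) interior_subset[of S] by simp
  then have "f x = g x" if "x \<in> U - S" for x using a(2) that by blast
  with S(2) have out: "{x\<in>U. f x = 0} = {x\<in>S. f x = 0} \<union> {x\<in>U - S. f x = 0}"
    "{x\<in>U. g x = 0} = {x\<in>S. g x = 0} \<union> {x\<in>U - S. f x = 0}"
    by auto
  have "card {x\<in>U. f x = 0} = card {x\<in>S. f x = 0} + card {x\<in>U - S. f x = 0}"
    unfolding out(1) by (rule card_Un_disjoint) (use Zf in \<open>auto intro: finite_subset[OF _ Z(1)]\<close>)
  moreover have "card {x\<in>U. g x = 0} = card {x\<in>S. g x = 0} + card {x\<in>U - S. f x = 0}"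
    unfolding out(2) by (rule card_Un_disjoint) (use Zf in \<open>auto intro: finite_subset[OF _ Z(1)]\<close>)
  ultimately show ?thesis using eq by presburger
qed

section \<open>Zeros of maps on a closed manifold\<close>

definition inv_chart :: "('a, 'n::finite) chart \<Rightarrow> real^'n \<Rightarrow> 'a" where
  "inv_chart c = inv_into (fst c) (snd c)"

lemma is_chart_facts:
  assumes "is_chart X c"
  shows "openin X (fst c)" "open (snd c ` fst c)" "inj_on (snd c) (fst c)"
    "homeomorphic_map (subtopology X (fst c)) (top_of_set (snd c ` fst c)) (snd c)"
    "topspace (subtopology X (fst c)) = fst c" "fst c \<subseteq> topspace X"
proof -
  show 1: "openin X (fst c)" "open (snd c ` fst c)"
    and 2: "homeomorphic_map (subtopology X (fst c)) (top_of_set (snd c ` fst c)) (snd c)"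
    using assms by (auto simp: is_chart_def case_prod_unfold)
  show 3: "fst c \<subseteq> topspace X" using 1(1) by (rule openin_subset)
  then show 4: "topspace (subtopology X (fst c)) = fst c" by (simp add: Int_absorb1)
  show "inj_on (snd c) (fst c)"
    using homeomorphic_imp_injective_map[OF 2] unfolding 4 .
qed

lemma open_local_dom_chart:
  assumes "is_chart X c" "is_chart X d" "continuous_map X X f"
  shows "open (local_dom c d f)"
proof -
  have "openin X {x \<in> topspace X. f x \<in> fst d}"
    using assms(3) is_chart_facts(1)[OF assms(2)] by (rule openin_continuous_map_preimage)
  then have "openin X (fst c \<inter> {x \<in> topspace X. f x \<in> fst d})"
    by (rule openin_Int[OF is_chart_facts(1)[OF assms(1)]])
  moreover have "fst c \<inter> {x \<in> topspace X. f x \<in> fst d} = {x \<in> fst c. f x \<in> fst d}"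
    using is_chart_facts(6)[OF assms(1)] by auto
  ultimately have "openin (subtopology X (fst c)) {x \<in> fst c. f x \<in> fst d}"
    by (simp add: openin_open_subtopology[OF is_chart_facts(1)[OF assms(1)]])
  then have "openin (top_of_set (snd c ` fst c)) (snd c ` {x \<in> fst c. f x \<in> fst d})"
    using homeomorphic_imp_open_map[OF is_chart_facts(4)[OF assms(1)]] by (simp add: open_map_def)
  then show ?thesis
    using is_chart_facts(2)[OF assms(1)] openin_open_eq unfolding local_dom_def by blast
qed

text \<open>Two derivatives are what Piola's identity consumes in a chart, and what the cubic bumps
  used for the perturbations have.\<close>

locale C2_manifold =
  fixes X :: "'a topology" and A :: "('a, 'n::finite) chart set"
  assumes chart: "c \<in> A \<Longrightarrow> is_chart X c"
    and cover: "(\<Union>c\<in>A. fst c) = topspace X"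
    and transition: "c \<in> A \<Longrightarrow> d \<in> A \<Longrightarrow> Ck_on 2 (local_dom c d id) (local_rep c d id)"
    and compact: "compact_space X" and Hausdorff: "Hausdorff_space X"
begin

definition C2_self_map :: "('a \<Rightarrow> 'a) \<Rightarrow> bool" where
  "C2_self_map g \<longleftrightarrow> continuous_map X X g \<and>
     (\<forall>c\<in>A. \<forall>d\<in>A. Ck_on 2 (local_dom c d g) (local_rep c d g))"

definition C2_map :: "('a \<Rightarrow> 'b::euclidean_space) \<Rightarrow> bool" where
  "C2_map f \<longleftrightarrow> (\<forall>c\<in>A. Ck_on 2 (snd c ` fst c) (f \<circ> inv_chart c))"

definition chart_deriv :: "('a, 'n) chart \<Rightarrow> ('a \<Rightarrow> 'b::euclidean_space) \<Rightarrow> 'a \<Rightarrow> real^'n \<Rightarrow> 'b" where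
  "chart_deriv c f x = frechet_derivative (f \<circ> inv_chart c) (at (snd c x))"

lemma inv_chart_simps:
  assumes "c \<in> A"
  shows "x \<in> fst c \<Longrightarrow> inv_chart c (snd c x) = x"
    "u \<in> snd c ` fst c \<Longrightarrow> inv_chart c u \<in> fst c"
    "u \<in> snd c ` fst c \<Longrightarrow> snd c (inv_chart c u) = u"
  using is_chart_facts(3)[OF chart[OF assms]]
  by (auto simp: inv_chart_def inv_into_into f_inv_into_f)

lemma chart_dom:
  assumes "c \<in> A"
  shows "fst c \<subseteq> topspace X" "openin X (fst c)" "open (snd c ` fst c)"
  using is_chart_facts[OF chart[OF assms]] by auto

lemma ex_chart:
  assumes "x \<in> topspace X" obtains c where "c \<in> A" "x \<in> fst c"
  using assms cover by blast

lemma open_chart_image: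
  assumes "c \<in> A" "openin X W" "W \<subseteq> fst c"
  shows "open (snd c ` W)"
proof -
  have "openin (subtopology X (fst c)) W"
    using assms(2,3) by (simp add: openin_subset_topspace_eq openin_open_subtopology chart_dom(2)[OF assms(1)])
  then have "openin (top_of_set (snd c ` fst c)) (snd c ` W)"
    using homeomorphic_imp_open_map[OF is_chart_facts(4)[OF chart[OF assms(1)]]] by (simp add: open_map_def)
  then show ?thesis using chart_dom(3)[OF assms(1)] openin_open_eq by blast
qed

lemma open_chart_preimage:
  assumes "c \<in> A" "open V"
  shows "openin X {x \<in> fst c. snd c x \<in> V}"
proof -
  have "continuous_map (subtopology X (fst c)) (top_of_set (snd c ` fst c)) (snd c)"
    using homeomorphic_imp_continuous_map[OF is_chart_facts(4)[OF chart[OF assms(1)]]] .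
  then have "openin (subtopology X (fst c)) {x \<in> topspace (subtopology X (fst c)). snd c x \<in> V \<inter> snd c ` fst c}"
    by (rule openin_continuous_map_preimage) (metis Int_commute assms(2) openin_open_Int)
  moreover have "{x \<in> topspace (subtopology X (fst c)). snd c x \<in> V \<inter> snd c ` fst c} = {x \<in> fst c. snd c x \<in> V}"
    unfolding is_chart_facts(5)[OF chart[OF assms(1)]] by auto
  ultimately show ?thesis
    using openin_open_subtopology[OF chart_dom(2)[OF assms(1)]] by simp
qed

text \<open>Compact subsets of a Hausdorff space are closed. The complement is therefore open, which
  lets functions with compact support in a chart be extended by 0.\<close>

lemma closedin_inv_chart_compact:
  assumes "c \<in> A" "compact K" "K \<subseteq> snd c ` fst c"
  shows "closedin X (inv_chart c ` K)"
proof -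
  obtain g where g: "homeomorphic_maps (subtopology X (fst c)) (top_of_set (snd c ` fst c)) (snd c) g"
    using is_chart_facts(4)[OF chart[OF assms(1)]] unfolding homeomorphic_map_maps by blast
  have "continuous_map (top_of_set (snd c ` fst c)) (subtopology X (fst c)) (inv_chart c)"
  proof (rule continuous_map_eq)
    show "continuous_map (top_of_set (snd c ` fst c)) (subtopology X (fst c)) g"
      using g by (simp add: homeomorphic_maps_def)
    fix u assume "u \<in> topspace (top_of_set (snd c ` fst c))"
    then obtain x where x: "x \<in> fst c" "u = snd c x" by auto
    then have "g u = x"
      using g unfolding homeomorphic_maps_def is_chart_facts(5)[OF chart[OF assms(1)]] by blast
    then show "g u = inv_chart c u" using inv_chart_simps(1)[OF assms(1)] x by simp
  qed
  moreover have "compactin (top_of_set (snd c ` fst c)) K"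
    using assms(2,3) by (simp add: compactin_subtopology)
  ultimately have "compactin (subtopology X (fst c)) (inv_chart c ` K)" by (rule image_compactin[rotated])
  then have "compactin X (inv_chart c ` K)" by (simp add: compactin_subtopology)
  then show ?thesis by (rule compactin_imp_closedin[OF Hausdorff])
qed

lemma mem_local_dom:
  assumes "c \<in> A"
  shows "u \<in> local_dom c d g \<longleftrightarrow> u \<in> snd c ` fst c \<and> g (inv_chart c u) \<in> fst d"
  using inv_chart_simps[OF assms] by (force simp: local_dom_def)

lemma local_rep_eq: "local_rep c d g = (\<lambda>u. snd d (g (inv_chart c u)))"
  by (auto simp: local_rep_def inv_chart_def)

lemma C2_self_map_id: "C2_self_map id"
  by (auto simp: C2_self_map_def transition)

lemma open_local_dom:
  assumes "c \<in> A" "d \<in> A" "C2_self_map g"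
  shows "open (local_dom c d g)"
  using open_local_dom_chart[OF chart chart, of c d g] assms by (simp add: C2_self_map_def)

lemma comp_chart_eq:
  assumes "c \<in> A" "d \<in> A" "u \<in> local_dom c d g"
  shows "(f \<circ> g \<circ> inv_chart c) u = (f \<circ> inv_chart d) (local_rep c d g u)"
  using assms by (simp add: mem_local_dom local_rep_eq inv_chart_simps)

lemma C2_map_on_local_dom:
  assumes "c \<in> A" "d \<in> A" "C2_self_map g" "C2_map f"
  shows "Ck_on 2 (local_dom c d g) (f \<circ> g \<circ> inv_chart c)"
proof -
  have "Ck_on 2 (local_dom c d g) (\<lambda>u. (f \<circ> inv_chart d) (local_rep c d g u))"
  proof (rule Ck_on_compose[OF open_local_dom[OF assms(1-3)] chart_dom(3)[OF assms(2)]])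
    show "Ck_on 2 (local_dom c d g) (local_rep c d g)"
      using assms by (simp add: C2_self_map_def)
    show "Ck_on 2 (snd d ` fst d) (f \<circ> inv_chart d)" using assms by (simp add: C2_map_def)
    show "local_rep c d g ` local_dom c d g \<subseteq> snd d ` fst d"
      by (intro image_subsetI) (simp add: local_rep_eq mem_local_dom[OF assms(1)])
  qed
  then show ?thesis
    by (rule Ck_on_cong_open[OF open_local_dom[OF assms(1-3)], rotated]) (simp only: comp_chart_eq[OF assms(1,2)])
qed

lemma self_map_topspace: "C2_self_map g \<Longrightarrow> x \<in> topspace X \<Longrightarrow> g x \<in> topspace X"
  using continuous_map_image_subset_topspace[of X X g] by (auto simp: C2_self_map_def)

lemma C2_map_comp_self_map:
  assumes "C2_map f" "C2_self_map g" shows "C2_map (f \<circ> g)"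
  unfolding C2_map_def
proof (intro ballI Ck_on_local)
  fix c u assume c: "c \<in> A" and u: "u \<in> snd c ` fst c"
  have "g (inv_chart c u) \<in> topspace X"
    using inv_chart_simps(2)[OF c u] chart_dom(1)[OF c] self_map_topspace[OF assms(2)] by blast
  then obtain d where d: "d \<in> A" "g (inv_chart c u) \<in> fst d" by (rule ex_chart)
  then have "u \<in> local_dom c d g" using u by (simp add: mem_local_dom[OF c])
  then show "\<exists>T. open T \<and> u \<in> T \<and> Ck_on 2 T (f \<circ> g \<circ> inv_chart c)"
    using open_local_dom[OF c d(1) assms(2)] C2_map_on_local_dom[OF c d(1) assms(2,1)] by blast
qed

lemma C2_map_on_chart: "C2_map f \<Longrightarrow> c \<in> A \<Longrightarrow> Ck_on 2 (snd c ` fst c) (f \<circ> inv_chart c)"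
  by (simp add: C2_map_def)

lemma C2_map_has_derivative:
  assumes "C2_map f" "c \<in> A" "x \<in> fst c"
  shows "((f \<circ> inv_chart c) has_derivative chart_deriv c f x) (at (snd c x))"
proof -
  have "Ck_on (Suc (Suc 0)) (snd c ` fst c) (f \<circ> inv_chart c)"
    using C2_map_on_chart[OF assms(1,2)] unfolding numeral_2_eq_2 .
  then show ?thesis
    unfolding chart_deriv_def by (rule Ck_on_has_derivative) (use assms in auto)
qed

lemma chart_deriv_comp:
  assumes "c \<in> A" "d \<in> A" "C2_self_map g" "C2_map f" "x \<in> fst c" "g x \<in> fst d"
  shows "chart_deriv c (f \<circ> g) x = chart_deriv d f (g x) \<circ> frechet_derivative (local_rep c d g) (at (snd c x))"
proof -
  let ?u = "snd c x"
  have u: "?u \<in> local_dom c d g" using assms by (simp add: mem_local_dom inv_chart_simps)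
  have "Ck_on (Suc (Suc 0)) (local_dom c d g) (local_rep c d g)"
    using assms(1-3) unfolding C2_self_map_def numeral_2_eq_2 by blast
  from Ck_on_has_derivative[OF this u]
  have 1: "(local_rep c d g has_derivative frechet_derivative (local_rep c d g) (at ?u)) (at ?u)" .
  have "local_rep c d g ?u = snd d (g x)" using assms by (simp add: local_rep_eq inv_chart_simps)
  with C2_map_has_derivative[OF assms(4,2,6)]
  have 2: "((f \<circ> inv_chart d) has_derivative chart_deriv d f (g x)) (at (local_rep c d g ?u))" by simp
  have "((\<lambda>u. (f \<circ> inv_chart d) (local_rep c d g u)) has_derivative
     (\<lambda>v. chart_deriv d f (g x) (frechet_derivative (local_rep c d g) (at ?u) v))) (at ?u)"
    by (rule has_derivative_compose[OF 1 2])
  then have "(f \<circ> g \<circ> inv_chart c has_derivative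
     (\<lambda>v. chart_deriv d f (g x) (frechet_derivative (local_rep c d g) (at ?u) v))) (at ?u)"
    by (rule has_derivative_transform_within_open[OF _ open_local_dom[OF assms(1-3)] u])
       (simp only: comp_chart_eq[OF assms(1,2)])
  from frechet_derivative_at[OF this] show ?thesis by (simp add: chart_deriv_def comp_def)
qed

text \<open>By the chain rule the two derivatives differ by the derivative of the coordinate change.
  That factor is injective, hence bijective because the dimensions agree.\<close>

lemma chart_deriv_chart_independent:
  fixes f :: "'a \<Rightarrow> real^'n"
  assumes "c \<in> A" "d \<in> A" "C2_map f" "x \<in> fst c" "x \<in> fst d" "inj (chart_deriv c f x)"
  shows "inj (chart_deriv d f x)"
proof -
  let ?L = "frechet_derivative (local_rep c d id) (at (snd c x))"
  have "chart_deriv c f x = chart_deriv d f x \<circ> ?L"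
    using chart_deriv_comp[OF assms(1,2) C2_self_map_id assms(3,4)] assms(5) by simp
  then have i: "inj (chart_deriv d f x \<circ> ?L)" using assms(6) by simp
  then have "inj ?L" by (rule inj_on_imageI2)
  have "snd c x \<in> local_dom c d id" using assms by (simp add: mem_local_dom inv_chart_simps)
  moreover have "Ck_on (Suc (Suc 0)) (local_dom c d id) (local_rep c d id)"
    using transition[OF assms(1,2)] unfolding numeral_2_eq_2 .
  ultimately have "linear ?L" by (intro has_derivative_linear[OF Ck_on_has_derivative])
  then have "surj ?L" using \<open>inj ?L\<close> linear_injective_imp_surjective by blast
  show ?thesis
  proof (rule injI)
    fix a b assume ab: "chart_deriv d f x a = chart_deriv d f x b"
    obtain a' b' where ab': "a = ?L a'" "b = ?L b'" using \<open>surj ?L\<close> by (metis surjD)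
    have "(chart_deriv d f x \<circ> ?L) a' = (chart_deriv d f x \<circ> ?L) b'"
      using ab unfolding ab' by simp
    then have "a' = b'" by (rule injD[OF i])
    then show "a = b" unfolding ab' by simp
  qed
qed

lemma C2_map_const: "C2_map (\<lambda>x. k)"
  by (simp add: C2_map_def comp_def)

lemma C2_map_add: "C2_map f \<Longrightarrow> C2_map g \<Longrightarrow> C2_map (\<lambda>x. f x + g x)"
  unfolding C2_map_def comp_def using Ck_on_add chart_dom(3) by blast

lemma C2_map_diff: "C2_map f \<Longrightarrow> C2_map g \<Longrightarrow> C2_map (\<lambda>x. f x - g x)"
  unfolding C2_map_def comp_def using Ck_on_diff chart_dom(3) by blast

lemma C2_map_scaleR: "C2_map f \<Longrightarrow> C2_map g \<Longrightarrow> C2_map (\<lambda>x. f x *\<^sub>R g x)"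
  unfolding C2_map_def comp_def using Ck_on_scaleR chart_dom(3) by blast

lemma C2_map_sum: "(\<And>i. i \<in> I \<Longrightarrow> C2_map (f i)) \<Longrightarrow> C2_map (\<lambda>x. \<Sum>i\<in>I. f i x)"
  by (induction I rule: infinite_finite_induct) (simp_all add: C2_map_const C2_map_add)

lemma C2_map_continuous:
  assumes "C2_map f" shows "continuous_map X euclidean f"
proof (rule continuous_map_openin_preimage_eq[THEN iffD2], intro conjI allI impI)
  show "f \<in> topspace X \<rightarrow> topspace euclidean" by simp
  fix V :: "'b set" assume "openin euclidean V"
  then have V: "open V" by simp
  have "{x \<in> topspace X. f x \<in> V} = (\<Union>c\<in>A. {x \<in> fst c. snd c x \<in> (f \<circ> inv_chart c) -` V \<inter> snd c ` fst c})"
  proof (intro set_eqI iffI)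
    fix x assume x: "x \<in> {x \<in> topspace X. f x \<in> V}"
    then have "x \<in> topspace X" by simp
    then obtain c where c: "c \<in> A" "x \<in> fst c" by (rule ex_chart)
    then show "x \<in> (\<Union>c\<in>A. {x \<in> fst c. snd c x \<in> (f \<circ> inv_chart c) -` V \<inter> snd c ` fst c})"
      using x by (intro UN_I[OF c(1)]) (simp add: inv_chart_simps)
  next
    fix x assume "x \<in> (\<Union>c\<in>A. {x \<in> fst c. snd c x \<in> (f \<circ> inv_chart c) -` V \<inter> snd c ` fst c})"
    then obtain c where "c \<in> A" "x \<in> fst c" "f (inv_chart c (snd c x)) \<in> V" by auto
    then show "x \<in> {x \<in> topspace X. f x \<in> V}"
      using chart_dom(1)[of c] by (auto simp: inv_chart_simps)
  qed
  moreover have "openin X {x \<in> fst c. snd c x \<in> (f \<circ> inv_chart c) -` V \<inter> snd c ` fst c}" if "c \<in> A" for c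
  proof (rule open_chart_preimage[OF that])
    have "continuous_on (snd c ` fst c) (f \<circ> inv_chart c)"
      using Ck_on_imp_continuous_on[OF C2_map_on_chart[OF assms that]] .
    from continuous_open_preimage[OF this chart_dom(3)[OF that] V]
    show "open ((f \<circ> inv_chart c) -` V \<inter> snd c ` fst c)" by (subst Int_commute)
  qed
  ultimately show "openin X (topspace X \<inter> f -` V)" by (auto simp: vimage_def Int_def intro!: openin_Union)
qed

definition zeros :: "('a \<Rightarrow> 'b::zero) \<Rightarrow> 'a set" where
  "zeros f = {x \<in> topspace X. f x = 0}"

text \<open>For \<open>C\<^sup>2\<close> maps injectivity of the derivative is the same in all
  charts around a point, so the existential over charts could equally be universal.\<close>

definition degenerate_zeros :: "('a \<Rightarrow> real^'n) \<Rightarrow> 'a set" where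
  "degenerate_zeros f = {x \<in> zeros f. \<exists>c\<in>A. x \<in> fst c \<and> \<not> inj (chart_deriv c f x)}"

lemma degenerate_zeros_iff:
  assumes "C2_map f" "c \<in> A" "x \<in> fst c"
  shows "x \<in> degenerate_zeros f \<longleftrightarrow> f x = 0 \<and> \<not> inj (chart_deriv c f x)"
proof
  assume "x \<in> degenerate_zeros f"
  then obtain d where d: "f x = 0" "d \<in> A" "x \<in> fst d" "\<not> inj (chart_deriv d f x)"
    by (auto simp: degenerate_zeros_def zeros_def)
  then show "f x = 0 \<and> \<not> inj (chart_deriv c f x)"
    using chart_deriv_chart_independent[OF assms(2) d(2) assms(1,3) d(3)] by blast
next
  assume "f x = 0 \<and> \<not> inj (chart_deriv c f x)"
  then show "x \<in> degenerate_zeros f"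
    using assms(2,3) chart_dom(1)[OF assms(2)] unfolding degenerate_zeros_def zeros_def by blast
qed

lemma C1_chart: "C2_map f \<Longrightarrow> c \<in> A \<Longrightarrow> Ck_on (Suc 0) (snd c ` fst c) (f \<circ> inv_chart c)"
  using C2_map_on_chart[of f c] Ck_on_Suc_imp unfolding numeral_2_eq_2 by blast

lemma inj_chart_deriv_iff:
  fixes f :: "'a \<Rightarrow> real^'n"
  assumes "C2_map f" "c \<in> A" "x \<in> fst c"
  shows "inj (chart_deriv c f x) \<longleftrightarrow> det (jacobian (f \<circ> inv_chart c) (at (snd c x))) \<noteq> 0"
  unfolding chart_deriv_def
  using differentiableI[OF C2_map_has_derivative[OF assms]] by (rule inj_frechet_derivative_iff)

lemma closedin_zeros: "C2_map f \<Longrightarrow> closedin X (zeros f)"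
  using closedin_continuous_map_preimage[OF C2_map_continuous, of f "{0}"] by (simp add: zeros_def)

text \<open>A point of the complement has a nonzero value, or a nonzero Jacobian determinant in some
  chart, and both conditions are open. Closedness allows the degenerate zeros to be covered by
  finitely many bumps.\<close>

lemma closedin_degenerate_zeros:
  assumes "C2_map f" shows "closedin X (degenerate_zeros f)"
proof -
  let ?J = "\<lambda>c u. det (jacobian (f \<circ> inv_chart c) (at u))"
  let ?V = "\<lambda>c. ?J c -` (- {0}) \<inter> snd c ` fst c"
  have eq: "topspace X - degenerate_zeros f = (topspace X - zeros f) \<union> (\<Union>c\<in>A. {x \<in> fst c. snd c x \<in> ?V c})"
    (is "?L = ?R")
  proof (rule set_eqI)
    fix x
    show "x \<in> ?L \<longleftrightarrow> x \<in> ?R"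
    proof (cases "x \<in> topspace X")
      case True
      then obtain c where c: "c \<in> A" "x \<in> fst c" by (rule ex_chart)
      have "x \<in> ?L \<longleftrightarrow> f x \<noteq> 0 \<or> inj (chart_deriv c f x)"
        using degenerate_zeros_iff[OF assms c] True by simp
      moreover have "(\<exists>d\<in>A. x \<in> fst d \<and> ?J d (snd d x) \<noteq> 0) \<longleftrightarrow> inj (chart_deriv c f x)"
        using chart_deriv_chart_independent[OF _ c(1) assms] inj_chart_deriv_iff[OF assms] c by blast
      ultimately show ?thesis using True by (auto simp: zeros_def)
    next
      case False
      then show ?thesis using chart_dom(1) by blast
    qed
  qed
  have "openin X {x \<in> fst c. snd c x \<in> ?V c}" if "c \<in> A" for c
  proof (rule open_chart_preimage[OF that])
    have "continuous_on (snd c ` fst c) (?J c)"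
      using Ck_on_det_jacobian[OF chart_dom(3)[OF that] C1_chart[OF assms that]] by simp
    then show "open (?V c)"
      using continuous_open_preimage[OF _ chart_dom(3)[OF that], of "?J c" "- {0}"]
      by (simp add: Int_commute open_Compl)
  qed
  moreover have "openin X (topspace X - zeros f)" using closedin_zeros[OF assms] by blast
  ultimately have "openin X (topspace X - degenerate_zeros f)"
    unfolding eq by (intro openin_Un openin_Union) auto
  then show ?thesis
    by (auto simp: closedin_def degenerate_zeros_def zeros_def)
qed

lemma finite_subcover:
  assumes "\<And>x. x \<in> S \<Longrightarrow> openin X (N x) \<and> x \<in> N x" "closedin X S"
  obtains F where "finite F" "F \<subseteq> S" "S \<subseteq> (\<Union>x\<in>F. N x)"
proof -
  have "compactin X S" using assms(2) compact closedin_compact_space by blast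
  moreover have "\<forall>U\<in>N ` S. openin X U" "S \<subseteq> \<Union>(N ` S)" using assms(1) by auto
  ultimately obtain \<F> where \<F>: "finite \<F>" "\<F> \<subseteq> N ` S" "S \<subseteq> \<Union>\<F>"
    unfolding compactin_def by meson
  then obtain F where "finite F" "F \<subseteq> S" "\<F> = N ` F" using finite_subset_image by meson
  with \<F>(3) that show ?thesis by blast
qed

text \<open>Local injectivity isolates a nondegenerate zero from all others, and the closed set of
  zeros is compact.\<close>

lemma finite_zeros:
  assumes "C2_map f" "degenerate_zeros f = {}"
  shows "finite (zeros f)"
proof -
  have "\<exists>N. openin X N \<and> x \<in> N \<and> N \<inter> zeros f = {x}" if x: "x \<in> zeros f" for x
  proof -
    have "x \<in> topspace X" "f x = 0" using x by (auto simp: zeros_def)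
    then obtain c where c: "c \<in> A" "x \<in> fst c" using ex_chart by blast
    have "inj (chart_deriv c f x)"
      using degenerate_zeros_iff[OF assms(1) c] assms(2) \<open>f x = 0\<close> by blast
    then obtain r where r: "r > 0" "ball (snd c x) r \<subseteq> snd c ` fst c" "inj_on (f \<circ> inv_chart c) (ball (snd c x) r)"
      using locally_injective[OF chart_dom(3)[OF c(1)] C1_chart[OF assms(1) c(1)], of "snd c x"] c(2)
      unfolding chart_deriv_def by blast
    let ?N = "{y \<in> fst c. snd c y \<in> ball (snd c x) r}"
    have "y = x" if "y \<in> ?N" "f y = 0" for y
    proof -
      have "(f \<circ> inv_chart c) (snd c y) = (f \<circ> inv_chart c) (snd c x)"
        using that c \<open>f x = 0\<close> by (simp add: inv_chart_simps)
      then have "snd c y = snd c x" using inj_onD[OF r(3)] that r(1) by simp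
      then show ?thesis using is_chart_facts(3)[OF chart[OF c(1)]] that c(2) by (auto dest: inj_onD)
    qed
    then have "?N \<inter> zeros f = {x}" using x c(2) r(1) by (auto simp: zeros_def)
    then show ?thesis using open_chart_preimage[OF c(1) open_ball] x c(2) r(1) by blast
  qed
  then have "\<forall>x\<in>zeros f. \<exists>N. openin X N \<and> x \<in> N \<and> N \<inter> zeros f = {x}" by blast
  from bchoice[OF this] obtain N where N: "\<forall>x\<in>zeros f. openin X (N x) \<and> x \<in> N x \<and> N x \<inter> zeros f = {x}"
    by blast
  obtain F where F: "finite F" "F \<subseteq> zeros f" "zeros f \<subseteq> (\<Union>x\<in>F. N x)"
    using finite_subcover[of "zeros f" N] N closedin_zeros[OF assms(1)] by blast
  have "zeros f \<subseteq> F"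
  proof
    fix x assume x: "x \<in> zeros f"
    then obtain y where y: "y \<in> F" "x \<in> N y" using F(3) by blast
    then have N_y: "N y \<inter> zeros f = {y}" using N F(2) by blast
    have "x \<in> N y \<inter> zeros f" using x y by simp
    then show "x \<in> F" unfolding N_y using y by simp
  qed
  then show ?thesis using F(1) finite_subset by blast
qed

lemma finite_chart_cover:
  obtains A0 where "finite A0" "A0 \<subseteq> A" "topspace X = (\<Union>c\<in>A0. fst c)"
proof -
  have "\<forall>x\<in>topspace X. \<exists>c. c \<in> A \<and> x \<in> fst c" using cover by blast
  from bchoice[OF this] obtain c where c: "\<forall>x\<in>topspace X. c x \<in> A \<and> x \<in> fst (c x)" by blast
  have N: "openin X (fst (c x)) \<and> x \<in> fst (c x)" if "x \<in> topspace X" for x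
    using c that chart_dom(2)[of "c x"] by blast
  obtain F where F: "finite F" "F \<subseteq> topspace X" "topspace X \<subseteq> (\<Union>x\<in>F. fst (c x))"
    by (rule finite_subcover[OF N closedin_topspace])
  show ?thesis
  proof (rule that)
    show "finite (c ` F)" using F(1) by simp
    have cA: "c x \<in> A" if "x \<in> F" for x using c F(2) that by blast
    then show "c ` F \<subseteq> A" by blast
    have "(\<Union>x\<in>F. fst (c x)) \<subseteq> topspace X" by (intro UN_least chart_dom(1) cA)
    with F(3) have "topspace X = (\<Union>x\<in>F. fst (c x))" by (rule equalityI)
    then show "topspace X = (\<Union>d\<in>c ` F. fst d)" by simp
  qed
qed

end

text \<open>Removing a two-element orbit preserves the parity, and in the end only fixed points
  remain.\<close>

lemma card_involution_parity:
  assumes "finite Z" "\<And>x. x \<in> Z \<Longrightarrow> t x \<in> Z" "\<And>x. x \<in> Z \<Longrightarrow> t (t x) = x"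
  shows "even (card Z + card {x\<in>Z. t x = x})"
  using assms
proof (induction "card Z" arbitrary: Z rule: less_induct)
  case less
  show ?case
  proof (cases "\<exists>x\<in>Z. t x \<noteq> x")
    case True
    then obtain x where x: "x \<in> Z" "t x \<noteq> x" by blast
    let ?Z = "Z - {x, t x}"
    have tx: "t x \<in> Z" "t (t x) = x" using less.prems x by blast+
    have c: "card Z = card ?Z + 2"
    proof -
      have "card {x, t x} = 2" using x by auto
      moreover have "card {x, t x} \<le> card Z" using x tx less.prems(1) by (intro card_mono) auto
      moreover have "card ?Z = card Z - card {x, t x}" using x tx by (intro card_Diff_subset) auto
      ultimately show ?thesis by linarith
    qed
    have "t y \<in> ?Z" if "y \<in> ?Z" for y
      using that less.prems(2)[of y] less.prems(3)[of y] tx by auto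
    moreover have "t (t y) = y" if "y \<in> ?Z" for y using that less.prems(3) by blast
    ultimately have "even (card ?Z + card {y\<in>?Z. t y = y})"
      using less.hyps[of ?Z] c less.prems(1) by simp
    moreover have "{y\<in>?Z. t y = y} = {y\<in>Z. t y = y}" using x tx by auto
    ultimately show ?thesis using c by simp
  next
    case False
    then have "{x\<in>Z. t x = x} = Z" by blast
    then show ?thesis by simp
  qed
qed

text \<open>Away from 0 the function is a power or 0 on an open half line. At 0 the difference
  quotient is itself a power of the positive part and tends to 0.\<close>

lemma DERIV_pos_part_power:
  "((\<lambda>t::real. max 0 t ^ Suc (Suc k)) has_real_derivative real (Suc (Suc k)) * max 0 t ^ Suc k) (at t)"
proof -
  consider "t > 0" | "t < 0" | "t = 0" by linarith
  then show ?thesis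
  proof cases
    case 1
    have "((\<lambda>t::real. t ^ Suc (Suc k)) has_real_derivative real (Suc (Suc k)) * t ^ Suc k) (at t)"
      using DERIV_pow[of "Suc (Suc k)" t] by simp
    then have "((\<lambda>t::real. max 0 t ^ Suc (Suc k)) has_real_derivative real (Suc (Suc k)) * t ^ Suc k) (at t)"
      by (rule has_field_derivative_transform_within_open[of _ _ _ "{0<..}"]) (use 1 in auto)
    then show ?thesis using 1 by simp
  next
    case 2
    have "((\<lambda>t::real. max 0 t ^ Suc (Suc k)) has_real_derivative 0) (at t)"
      by (rule has_field_derivative_transform_within_open[of "\<lambda>_. 0" _ _ "{..<0}"]) (use 2 in auto)
    then show ?thesis using 2 by simp
  next
    case 3
    have lim: "((\<lambda>h::real. max 0 h ^ Suc k) \<longlongrightarrow> max 0 0 ^ Suc k) (at 0)"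
      by (intro tendsto_intros)
    have "\<forall>\<^sub>F h::real in at 0. max 0 h ^ Suc k = (max 0 (0 + h) ^ Suc (Suc k) - max 0 0 ^ Suc (Suc k)) / h"
      by (rule eventually_at_topological[THEN iffD2]) (auto intro!: exI[of _ UNIV] simp: max_def)
    from Lim_transform_eventually[OF lim this]
    have "((\<lambda>h::real. (max 0 (0 + h) ^ Suc (Suc k) - max 0 0 ^ Suc (Suc k)) / h) \<longlongrightarrow> 0) (at 0)"
      by simp
    then show ?thesis using 3 by (simp add: DERIV_def)
  qed
qed

lemma Ck_on_pos_part_cube: "Ck_on 2 UNIV (\<lambda>t::real. max 0 t ^ 3)"
proof -
  have "Ck_on (Suc 0) UNIV (\<lambda>t::real. max 0 t ^ Suc (Suc 0))"
  proof (rule Ck_on_SucI)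
    show "((\<lambda>t::real. max 0 t ^ Suc (Suc 0)) has_derivative (\<lambda>h. h * (2 * max 0 t))) (at t)" for t
      using DERIV_pos_part_power[of 0 t] by (simp add: has_field_derivative_def mult_commute_abs numeral_2_eq_2)
  qed (auto intro!: continuous_intros)
  then have 1: "Ck_on (Suc 0) UNIV (\<lambda>t::real. v * (3 * max 0 t ^ Suc (Suc 0)))" for v
    by (intro Ck_on_mult Ck_on_const) auto
  have "Ck_on (Suc (Suc 0)) UNIV (\<lambda>t::real. max 0 t ^ Suc (Suc (Suc 0)))"
  proof (rule Ck_on_SucI[OF open_UNIV _ 1])
    show "((\<lambda>t::real. max 0 t ^ Suc (Suc (Suc 0))) has_derivative (\<lambda>h. h * (3 * max 0 t ^ Suc (Suc 0)))) (at t)" for t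
      using DERIV_pos_part_power[of "Suc 0" t] by (simp only: has_field_derivative_def mult_commute_abs) simp
  qed
  then show ?thesis by (simp add: numeral_2_eq_2 numeral_3_eq_3)
qed

text \<open>For \<open>\<rho> > 0\<close> this is positive exactly on the open ball; the exponent 3
  is the least one that gives a \<open>C\<^sup>2\<close> function.\<close>

definition bump :: "'a::euclidean_space \<Rightarrow> real \<Rightarrow> 'a \<Rightarrow> real" where
  "bump a \<rho> u = max 0 (\<rho>\<^sup>2 - (u - a) \<bullet> (u - a)) ^ 3"

lemma Ck_on_bump: "Ck_on 2 UNIV (bump a \<rho>)"
  unfolding bump_def[abs_def]
  by (rule Ck_on_compose[OF open_UNIV open_UNIV _ Ck_on_pos_part_cube])
     (auto intro!: Ck_on_diff Ck_on_inner)

lemma bump_simps: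
  "bump a \<rho> u \<ge> 0" "\<rho> > 0 \<Longrightarrow> bump a \<rho> u \<noteq> 0 \<longleftrightarrow> u \<in> ball a \<rho>" "\<rho> > 0 \<Longrightarrow> bump a \<rho> a > 0"
proof -
  show "bump a \<rho> u \<ge> 0" by (simp add: bump_def)
  show "\<rho> > 0 \<Longrightarrow> bump a \<rho> a > 0" by (simp add: bump_def)
  have "(u - a) \<bullet> (u - a) = (dist u a)\<^sup>2" by (simp add: dist_norm power2_norm_eq_inner)
  moreover assume "\<rho> > 0"
  ultimately have "(u - a) \<bullet> (u - a) < \<rho>\<^sup>2 \<longleftrightarrow> dist a u < \<rho>"
    using power_less_imp_less_base[of "dist u a" 2 \<rho>] power_strict_mono[of "dist u a" \<rho> 2]
    by (auto simp: dist_commute)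
  then show "bump a \<rho> u \<noteq> 0 \<longleftrightarrow> u \<in> ball a \<rho>" by (auto simp: bump_def max_def)
qed

section \<open>Functions supported in one chart and flat perturbations\<close>

context C2_manifold
begin

definition chart_extend :: "('a, 'n) chart \<Rightarrow> (real^'n \<Rightarrow> 'b::euclidean_space) \<Rightarrow> 'a \<Rightarrow> 'b" where
  "chart_extend c h x = (if x \<in> fst c then h (snd c x) else 0)"

lemma chart_extend_support:
  assumes "c \<in> A" "K \<subseteq> snd c ` fst c" "\<And>u. u \<notin> K \<Longrightarrow> h u = 0" "x \<notin> inv_chart c ` K"
  shows "chart_extend c h x = 0"
  using assms(3,4) inv_chart_simps(1)[OF assms(1)] unfolding chart_extend_def by (metis image_eqI)

text \<open>Seen from another chart, points in the domain of \<open>c\<close> are handled by the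
  coordinate change. Every other point has a neighbourhood that misses the closed image of
  \<open>K\<close>, and there the function is 0.\<close>

lemma C2_map_chart_extend:
  assumes c: "c \<in> A" and h: "Ck_on 2 UNIV h" and K: "compact K" "K \<subseteq> snd c ` fst c" "\<And>u. u \<notin> K \<Longrightarrow> h u = 0"
  shows "C2_map (chart_extend c h)"
  unfolding C2_map_def
proof (intro ballI Ck_on_local)
  fix d u assume d: "d \<in> A" and u: "u \<in> snd d ` fst d"
  show "\<exists>T. open T \<and> u \<in> T \<and> Ck_on 2 T (chart_extend c h \<circ> inv_chart d)"
  proof (cases "inv_chart d u \<in> fst c")
    case True
    let ?T = "local_dom d c id"
    have "Ck_on 2 ?T (\<lambda>u. h (local_rep d c id u))"
      by (rule Ck_on_compose[OF open_local_dom[OF d c C2_self_map_id] open_UNIV transition[OF d c] h]) simp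
    then have "Ck_on 2 ?T (chart_extend c h \<circ> inv_chart d)"
      by (rule Ck_on_cong_open[OF open_local_dom[OF d c C2_self_map_id], rotated])
         (simp add: mem_local_dom[OF d] local_rep_eq chart_extend_def)
    moreover have "u \<in> ?T" using True u by (simp add: mem_local_dom[OF d])
    ultimately show ?thesis using open_local_dom[OF d c C2_self_map_id] by blast
  next
    case False
    let ?W = "fst d \<inter> (topspace X - inv_chart c ` K)"
    have "openin X ?W" using chart_dom(2)[OF d] closedin_inv_chart_compact[OF c K(1,2)] by blast
    then have o: "open (snd d ` ?W)" by (rule open_chart_image[OF d]) simp
    have "inv_chart c ` K \<subseteq> fst c" using K(2) inv_chart_simps(2)[OF c] by (intro image_subsetI) auto
    then have "inv_chart d u \<notin> inv_chart c ` K" using False by blast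
    then have "inv_chart d u \<in> ?W" using inv_chart_simps(2)[OF d u] chart_dom(1)[OF d] by blast
    then have "u \<in> snd d ` ?W" using inv_chart_simps(3)[OF d u] by (metis image_eqI)
    moreover have "Ck_on 2 (snd d ` ?W) (chart_extend c h \<circ> inv_chart d)"
    proof (rule Ck_on_cong_open[OF o _ Ck_on_const[where c = 0]])
      fix v assume "v \<in> snd d ` ?W"
      then obtain y where "y \<in> ?W" "v = snd d y" by blast
      then show "0 = (chart_extend c h \<circ> inv_chart d) v"
        using chart_extend_support[OF c K(2,3), where x = y] by (simp add: inv_chart_simps(1)[OF d])
    qed
    ultimately show ?thesis using o by blast
  qed
qed

definition chart_bump :: "('a, 'n) chart \<Rightarrow> real^'n \<Rightarrow> real \<Rightarrow> 'a \<Rightarrow> real" where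
  "chart_bump c a \<rho> = chart_extend c (bump a \<rho>)"

lemma bump_outside: "\<rho> > 0 \<Longrightarrow> u \<notin> cball a \<rho> \<Longrightarrow> bump a \<rho> u = 0"
  using bump_simps(2)[of \<rho> a u] by auto

lemma C2_map_chart_bump:
  assumes "c \<in> A" "\<rho> > 0" "cball a \<rho> \<subseteq> snd c ` fst c"
  shows "C2_map (chart_bump c a \<rho>)"
  unfolding chart_bump_def
  by (rule C2_map_chart_extend[OF assms(1) Ck_on_bump compact_cball assms(3) bump_outside[OF assms(2)]])

lemma chart_bump_nonneg: "chart_bump c a \<rho> x \<ge> 0"
  by (simp add: chart_bump_def chart_extend_def bump_simps)

lemma chart_bump_support:
  assumes "c \<in> A" "\<rho> > 0" "cball a \<rho> \<subseteq> snd c ` fst c" "x \<notin> inv_chart c ` cball a \<rho>"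
  shows "chart_bump c a \<rho> x = 0"
  unfolding chart_bump_def
  by (rule chart_extend_support[OF assms(1,3) bump_outside[OF assms(2)] assms(4)])

lemma chart_bump_center: "\<rho> > 0 \<Longrightarrow> x \<in> fst c \<Longrightarrow> chart_bump c (snd c x) \<rho> x > 0"
  by (simp add: chart_bump_def chart_extend_def bump_simps)

text \<open>At a zero of \<open>\<beta>\<close> the maps \<open>f\<close> and
  \<open>f + \<beta> s\<close> then share value and derivative, so the perturbation neither creates
  nor removes degeneracy there.\<close>

definition flat_zeros :: "('a \<Rightarrow> real) \<Rightarrow> bool" where
  "flat_zeros \<beta> \<longleftrightarrow> (\<forall>c\<in>A. \<forall>x\<in>fst c. \<beta> x = 0 \<longrightarrow> chart_deriv c \<beta> x = (\<lambda>_. 0))"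

text \<open>Every zero is a minimum, where the derivative vanishes.\<close>

lemma flat_zeros_nonneg:
  assumes "C2_map \<beta>" "\<And>x. x \<in> topspace X \<Longrightarrow> \<beta> x \<ge> 0"
  shows "flat_zeros \<beta>"
  unfolding flat_zeros_def
proof (intro ballI impI)
  fix c x assume c: "c \<in> A" "x \<in> fst c" "\<beta> x = 0"
  show "chart_deriv c \<beta> x = (\<lambda>_. 0)"
  proof (rule has_derivative_local_min[OF C2_map_has_derivative[OF assms(1) c(1,2)]])
    have "\<forall>\<^sub>F u in at (snd c x). u \<in> snd c ` fst c"
      using chart_dom(3)[OF c(1)] c(2) by (intro eventually_at_in_open') auto
    then show "\<forall>\<^sub>F u in at (snd c x). (\<beta> \<circ> inv_chart c) (snd c x) \<le> (\<beta> \<circ> inv_chart c) u"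
    proof eventually_elim
      case (elim u)
      have "inv_chart c u \<in> topspace X" using inv_chart_simps(2)[OF c(1) elim] chart_dom(1)[OF c(1)] by blast
      then show ?case using assms(2) c by (simp add: inv_chart_simps)
    qed
  qed
qed

lemma chart_deriv_add_scaleR:
  assumes "C2_map f" "C2_map \<beta>" "c \<in> A" "x \<in> fst c"
  shows "chart_deriv c (\<lambda>x. f x + \<beta> x *\<^sub>R s) x = (\<lambda>v. chart_deriv c f x v + chart_deriv c \<beta> x v *\<^sub>R s)"
proof -
  have "((\<lambda>u. (f \<circ> inv_chart c) u + (\<beta> \<circ> inv_chart c) u *\<^sub>R s) has_derivative
      (\<lambda>v. chart_deriv c f x v + chart_deriv c \<beta> x v *\<^sub>R s)) (at (snd c x))"
    using C2_map_has_derivative[OF assms(1,3,4)] C2_map_has_derivative[OF assms(2,3,4)]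
    by (intro has_derivative_add has_derivative_scaleR_left)
  from frechet_derivative_at[OF this] show ?thesis by (simp add: chart_deriv_def comp_def)
qed

end

text \<open>A degenerate zero of \<open>f + \<beta> s\<close> where \<open>\<beta>\<close> does not vanish makes \<open>s\<close> a critical value of
  \<open>- f / \<beta>\<close>, so Sard's theorem excludes it for almost every \<open>s\<close>.\<close>

lemma negligible_degenerate_perturbations:
  fixes X :: "'a topology" and A :: "('a, 'n::{finite,wellorder}) chart set" and f :: "'a \<Rightarrow> real^'n::_"
  assumes "C2_manifold X A"
    and f: "C2_manifold.C2_map A f" and \<beta>: "C2_manifold.C2_map A \<beta>" "C2_manifold.flat_zeros A \<beta>"
  shows "negligible {s. \<not> C2_manifold.degenerate_zeros X A (\<lambda>x. f x + \<beta> x *\<^sub>R s)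
       \<subseteq> C2_manifold.degenerate_zeros X A f \<inter> {x. \<beta> x = 0}}"
proof -
  interpret C2_manifold X A by fact
  obtain A0 where A0: "finite A0" "A0 \<subseteq> A" "topspace X = (\<Union>c\<in>A0. fst c)" by (rule finite_chart_cover)
  define q where "q = (\<lambda>(c :: ('a, 'n) chart) u. (- 1 / (\<beta> \<circ> inv_chart c) u) *\<^sub>R (f \<circ> inv_chart c) u)"
  define q' where "q' = (\<lambda>c u v. (- 1 / (\<beta> \<circ> inv_chart c) u) *\<^sub>R chart_deriv c f (inv_chart c u) v
      + (chart_deriv c \<beta> (inv_chart c u) v / ((\<beta> \<circ> inv_chart c) u)\<^sup>2) *\<^sub>R (f \<circ> inv_chart c) u)"
  define V where "V = (\<lambda>c. {u \<in> snd c ` fst c. (\<beta> \<circ> inv_chart c) u \<noteq> 0 \<and> \<not> inj (q' c u)})"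
  have dq: "(q c has_derivative q' c u) (at u)" if c: "c \<in> A" and u: "u \<in> snd c ` fst c" "(\<beta> \<circ> inv_chart c) u \<noteq> 0" for c u
  proof -
    have x: "inv_chart c u \<in> fst c" "snd c (inv_chart c u) = u" using inv_chart_simps[OF c] u(1) by auto
    note df = C2_map_has_derivative[OF f c x(1), unfolded x(2)]
    note db = C2_map_has_derivative[OF \<beta>(1) c x(1), unfolded x(2)]
    have "((\<lambda>u. inverse ((\<beta> \<circ> inv_chart c) u)) has_derivative
        (\<lambda>v. - (inverse ((\<beta> \<circ> inv_chart c) u) * chart_deriv c \<beta> (inv_chart c u) v * inverse ((\<beta> \<circ> inv_chart c) u)))) (at u)"
      using Deriv.has_derivative_inverse[OF u(2) db] .
    from has_derivative_minus[OF has_derivative_scaleR[OF this df]]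
    have "((\<lambda>u. - (inverse ((\<beta> \<circ> inv_chart c) u) *\<^sub>R (f \<circ> inv_chart c) u)) has_derivative q' c u) (at u)"
      by (rule has_derivative_eq_rhs)
         (simp add: q'_def fun_eq_iff divide_inverse power2_eq_square algebra_simps)
    moreover have "(\<lambda>u. - (inverse ((\<beta> \<circ> inv_chart c) u) *\<^sub>R (f \<circ> inv_chart c) u)) = q c"
      by (simp add: q_def fun_eq_iff divide_inverse)
    ultimately show ?thesis by simp
  qed
  have neg: "negligible (q c ` V c)" if "c \<in> A0" for c
  proof (rule baby_Sard[where f' = "q' c"])
    fix u assume u: "u \<in> V c"
    then have d: "(q c has_derivative q' c u) (at u)" using dq[of c u] A0(2) that by (auto simp: V_def)
    then show "(q c has_derivative q' c u) (at u within V c)" by (rule has_derivative_at_withinI)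
    have "det (matrix (q' c u)) = 0"
      using u det_nz_iff_inj[OF has_derivative_linear[OF d]] by (simp add: V_def)
    then show "rank (matrix (q' c u)) < CARD('n)" by (simp add: det_eq_0_rank)
  qed simp
  have "s \<in> (\<Union>c\<in>A0. q c ` V c)"
    if s: "\<not> degenerate_zeros (\<lambda>x. f x + \<beta> x *\<^sub>R s) \<subseteq> degenerate_zeros f \<inter> {x. \<beta> x = 0}" for s
  proof -
    let ?g = "\<lambda>x. f x + \<beta> x *\<^sub>R s"
    obtain x where x: "x \<in> degenerate_zeros ?g" "x \<notin> degenerate_zeros f \<or> \<beta> x \<noteq> 0" using s by blast
    have "x \<in> topspace X" using x(1) by (simp add: degenerate_zeros_def zeros_def)
    then obtain c where c0: "c \<in> A0" and xc: "x \<in> fst c" using A0(3) by blast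
    then have c: "c \<in> A" using A0(2) by blast
    have g: "C2_map ?g" by (intro C2_map_add C2_map_scaleR f \<beta>(1) C2_map_const)
    have gx: "f x + \<beta> x *\<^sub>R s = 0" "\<not> inj (chart_deriv c ?g x)"
      using x(1) degenerate_zeros_iff[OF g c xc] by auto
    have dg: "chart_deriv c ?g x = (\<lambda>v. chart_deriv c f x v + chart_deriv c \<beta> x v *\<^sub>R s)"
      by (rule chart_deriv_add_scaleR[OF f \<beta>(1) c xc])
    \<comment> \<open>Where \<open>\<beta>\<close> vanishes, flatness gives \<open>?g\<close> and
      \<open>f\<close> the same derivative, so \<open>x\<close> would already be a degenerate zero
      of \<open>f\<close>.\<close>
    have bx: "\<beta> x \<noteq> 0"
    proof
      assume b: "\<beta> x = 0"
      then have "chart_deriv c \<beta> x = (\<lambda>_. 0)" using \<beta>(2) c xc by (auto simp: flat_zeros_def)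
      then have "x \<in> degenerate_zeros f" using gx dg b degenerate_zeros_iff[OF f c xc] by simp
      then show False using x(2) b by simp
    qed
    have s_eq: "s = q c (snd c x)"
    proof -
      have "\<beta> x *\<^sub>R s = - f x" using gx(1) by (simp add: eq_neg_iff_add_eq_0 add.commute)
      then have "(1 / \<beta> x) *\<^sub>R (\<beta> x *\<^sub>R s) = (1 / \<beta> x) *\<^sub>R (- f x)" by simp
      then show ?thesis using bx by (simp add: q_def inv_chart_simps[OF c] xc)
    qed
    have lin: "linear (chart_deriv c ?g x)"
      using has_derivative_linear[OF C2_map_has_derivative[OF g c xc]] .
    obtain v where v: "v \<noteq> 0" "chart_deriv c ?g x v = 0"
      using gx(2) linear_injective_0[OF lin] by blast
    have fx: "f x = - (\<beta> x *\<^sub>R s)" using gx(1) by (simp add: eq_neg_iff_add_eq_0)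
    have fv: "chart_deriv c f x v = - (chart_deriv c \<beta> x v *\<^sub>R s)"
      using v(2) unfolding dg by (simp add: eq_neg_iff_add_eq_0)
    have ux: "inv_chart c (snd c x) = x" using inv_chart_simps(1)[OF c xc] .
    \<comment> \<open>Since \<open>f x = - (\<beta> x *\<^sub>R s)\<close>, the derivative
      \<open>q'\<close> is \<open>- 1 / \<beta> x\<close> times the derivative of \<open>?g\<close>,
      so both have the same kernel.\<close>
    have "q' c (snd c x) v = 0"
      unfolding q'_def comp_def ux fv fx using bx by (simp add: power2_eq_square)
    moreover have "q' c (snd c x) 0 = 0"
      using has_derivative_linear[OF dq[OF c]] xc bx ux by (intro linear_0) (auto simp: comp_def)
    ultimately have "\<not> inj (q' c (snd c x))" using v(1) by (metis injD)
    then have "snd c x \<in> V c" using xc bx ux by (simp add: V_def)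
    then show ?thesis using s_eq c0 by blast
  qed
  moreover have "negligible (\<Union>c\<in>A0. q c ` V c)"
    using A0(1) neg by (intro negligible_Union) auto
  ultimately show ?thesis by (elim negligible_subset) blast
qed

text \<open>The chart carries the zeros in its domain to zeros of maps on a Euclidean open set,
  where \<open>zeros_parity_local\<close> applies; outside the domain the zeros of the two maps
  coincide.\<close>

lemma zeros_parity_chart:
  fixes X :: "'a topology" and A :: "('a, 'n::{finite,wellorder}) chart set" and f g :: "'a \<Rightarrow> real^'n::_"
  assumes "C2_manifold X A"
    and f: "C2_manifold.C2_map A f" "C2_manifold.degenerate_zeros X A f = {}"
    and g: "C2_manifold.C2_map A g" "C2_manifold.degenerate_zeros X A g = {}"
    and c: "c \<in> A" "\<rho> > 0" "cball a \<rho> \<subseteq> snd c ` fst c"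
    and eq: "\<And>x. x \<in> topspace X \<Longrightarrow> x \<notin> inv_chart c ` cball a \<rho> \<Longrightarrow> f x = g x"
  shows "even (card (C2_manifold.zeros X f) + card (C2_manifold.zeros X g))"
proof -
  interpret C2_manifold X A by fact
  let ?U = "snd c ` fst c" and ?F = "f \<circ> inv_chart c" and ?G = "g \<circ> inv_chart c"
  have bij: "card (zeros h \<inter> fst c) = card {u \<in> ?U. (h \<circ> inv_chart c) u = 0}"
     "finite (zeros h) \<Longrightarrow> finite {u \<in> ?U. (h \<circ> inv_chart c) u = 0}" for h :: "'a \<Rightarrow> real^'n::_"
  proof -
    have im: "snd c ` (zeros h \<inter> fst c) = {u \<in> ?U. (h \<circ> inv_chart c) u = 0}"
      using chart_dom(1)[OF c(1)] inv_chart_simps(1)[OF c(1)] by (fastforce simp: zeros_def)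
    have "inj_on (snd c) (zeros h \<inter> fst c)"
      using is_chart_facts(3)[OF chart[OF c(1)]] by (rule inj_on_subset) simp
    then show "card (zeros h \<inter> fst c) = card {u \<in> ?U. (h \<circ> inv_chart c) u = 0}"
      unfolding im[symmetric] by (rule card_image[symmetric])
    show "finite (zeros h) \<Longrightarrow> finite {u \<in> ?U. (h \<circ> inv_chart c) u = 0}"
      unfolding im[symmetric] by simp
  qed
  have fin: "finite (zeros f)" "finite (zeros g)" using finite_zeros f g by blast+
  have nd: "det (jacobian (h \<circ> inv_chart c) (at u)) \<noteq> 0"
    if h: "C2_map h" "degenerate_zeros h = {}" and u: "u \<in> ?U" "(h \<circ> inv_chart c) u = 0" for h u
  proof -
    have x: "inv_chart c u \<in> fst c" "snd c (inv_chart c u) = u" using inv_chart_simps[OF c(1)] u(1) by auto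
    have "inj (chart_deriv c h (inv_chart c u))"
      using degenerate_zeros_iff[OF h(1) c(1) x(1)] h(2) u(2) by simp
    then show ?thesis using inj_chart_deriv_iff[OF h(1) c(1) x(1)] x(2) by simp
  qed
  have "even (card {u \<in> ?U. ?F u = 0} + card {u \<in> ?U. ?G u = 0})"
  proof (rule zeros_parity_local[OF chart_dom(3)[OF c(1)] C2_map_on_chart[OF f(1) c(1)] C2_map_on_chart[OF g(1) c(1)] c(3)])
    fix u assume u: "u \<in> ?U" "u \<notin> cball a \<rho>"
    have x: "inv_chart c u \<in> fst c" "snd c (inv_chart c u) = u" using inv_chart_simps[OF c(1)] u(1) by auto
    have "inv_chart c u \<notin> inv_chart c ` cball a \<rho>"
    proof
      assume "inv_chart c u \<in> inv_chart c ` cball a \<rho>"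
      then obtain w where w: "w \<in> cball a \<rho>" "inv_chart c u = inv_chart c w" by blast
      have "snd c (inv_chart c w) = w" using inv_chart_simps(3)[OF c(1)] subsetD[OF c(3) w(1)] .
      have "u = snd c (inv_chart c u)" by (rule x(2)[symmetric])
      also have "\<dots> = w" unfolding w(2) by fact
      finally show False using w(1) u(2) by blast
    qed
    then show "?F u = ?G u" using eq x(1) chart_dom(1)[OF c(1)] by auto
  qed (use bij(2) fin nd[OF f] nd[OF g] c(2) in auto)
  then have 1: "even (card (zeros f \<inter> fst c) + card (zeros g \<inter> fst c))" by (simp only: bij(1))
  have "inv_chart c ` cball a \<rho> \<subseteq> fst c"
    using inv_chart_simps(2)[OF c(1) subsetD[OF c(3)]] by (rule image_subsetI)
  then have "f x = g x" if "x \<in> topspace X" "x \<notin> fst c" for x using eq that by blast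
  then have out: "zeros f - fst c = zeros g - fst c" by (auto simp: zeros_def)
  have "card (zeros h) = card (zeros h \<inter> fst c) + card (zeros h - fst c)" if "finite (zeros h)" for h :: "'a \<Rightarrow> real^'n::_"
    using card_Un_disjoint[of "zeros h \<inter> fst c" "zeros h - fst c"] that by (simp add: Int_Diff_Un Int_Diff_disjoint)
  then have "card (zeros f) = card (zeros f \<inter> fst c) + card (zeros f - fst c)"
     "card (zeros g) = card (zeros g \<inter> fst c) + card (zeros f - fst c)"
    using fin out by simp_all
  then show ?thesis using 1 by presburger
qed

section \<open>From one chart to the whole manifold\<close>

lemma (in C2_manifold) flat_zeros_sum_nonneg:
  assumes "\<And>i. i \<in> I \<Longrightarrow> C2_map (b i)" "\<And>i x. i \<in> I \<Longrightarrow> b i x \<ge> 0"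
  shows "flat_zeros (\<lambda>x. \<Sum>i\<in>I. b i x)"
  by (intro flat_zeros_nonneg C2_map_sum assms(1) sum_nonneg assms(2))

lemma (in C2_manifold) openin_C2_preimage:
  assumes "C2_map f" "open V" shows "openin X {x \<in> topspace X. f x \<in> V}"
  using openin_continuous_map_preimage[OF C2_map_continuous[OF assms(1)]] assms(2) by simp

lemma (in C2_manifold) compact_C2_image:
  assumes "C2_map f" shows "compact (f ` topspace X)"
  using image_compactin[OF _ C2_map_continuous[OF assms], of "topspace X"] compact
  by (simp add: compact_space_def)

text \<open>The exterior of a ball is open and nonempty, hence not negligible. A vector can thus be
  generic and as long as desired.\<close>

lemma not_negligible_outside:
  assumes "negligible (N :: 'a::euclidean_space set)"
  obtains s where "s \<notin> N" "norm s > R"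
proof -
  have "open {s :: 'a. norm s > R}" by (intro open_Collect_less continuous_intros)
  moreover obtain b :: 'a where "b \<in> Basis" using nonempty_Basis by blast
  then have "norm ((\<bar>R\<bar> + 1) *\<^sub>R b) > R" by simp
  ultimately have "\<not> negligible {s :: 'a. norm s > R}" by (intro open_not_negligible) blast+
  then have "\<not> {s :: 'a. norm s > R} \<subseteq> N" using assms negligible_subset by blast
  then show ?thesis using that by blast
qed

text \<open>Subtracting a large constant vector from \<open>f\<close>, one chart at a time, removes all the zeros.\<close>

lemma even_card_zeros:
  fixes X :: "'a topology" and A :: "('a, 'n::{finite,wellorder}) chart set" and f :: "'a \<Rightarrow> real^'n::_"
  assumes "C2_manifold X A"
    and f: "C2_manifold.C2_map A f" "C2_manifold.degenerate_zeros X A f = {}"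
  shows "even (card (C2_manifold.zeros X f))"
proof (cases "topspace X = {}")
  case True
  interpret C2_manifold X A by fact
  have "zeros f = {}" unfolding zeros_def using True by blast
  then show ?thesis by simp
next
  case False
  interpret C2_manifold X A by fact
  have "\<forall>x\<in>topspace X. \<exists>p. fst p \<in> A \<and> x \<in> fst (fst p) \<and> snd p > 0 \<and>
      cball (snd (fst p) x) (snd p) \<subseteq> snd (fst p) ` fst (fst p)"
  proof
    fix x assume "x \<in> topspace X"
    then obtain c where c: "c \<in> A" "x \<in> fst c" by (rule ex_chart)
    then obtain \<rho> where "\<rho> > 0" "cball (snd c x) \<rho> \<subseteq> snd c ` fst c"
      using chart_dom(3)[OF c(1)] unfolding open_contains_cball by blast
    then show "\<exists>p. fst p \<in> A \<and> x \<in> fst (fst p) \<and> snd p > 0 \<and>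
      cball (snd (fst p) x) (snd p) \<subseteq> snd (fst p) ` fst (fst p)" using c by (intro exI[of _ "(c, \<rho>)"]) simp
  qed
  from bchoice[OF this] obtain P where P: "\<forall>x\<in>topspace X. fst (P x) \<in> A \<and> x \<in> fst (fst (P x)) \<and> snd (P x) > 0 \<and>
      cball (snd (fst (P x)) x) (snd (P x)) \<subseteq> snd (fst (P x)) ` fst (fst (P x))"
    by blast
  define c where "c = (\<lambda>x. fst (P x))"
  define \<rho> where "\<rho> = (\<lambda>x. snd (P x))"
  have c: "c x \<in> A" "x \<in> fst (c x)" "\<rho> x > 0" "cball (snd (c x) x) (\<rho> x) \<subseteq> snd (c x) ` fst (c x)"
    if "x \<in> topspace X" for x
    using bspec[OF P that] unfolding c_def \<rho>_def by auto
  define b where "b = (\<lambda>x. chart_bump (c x) (snd (c x) x) (\<rho> x))"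
  have b: "C2_map (b x)" "b x x > 0" if "x \<in> topspace X" for x
    unfolding b_def using c[OF that] by (auto intro: C2_map_chart_bump chart_bump_center)
  have b_nn: "b x y \<ge> 0" for x y by (simp add: b_def chart_bump_nonneg)
  have N: "openin X {y \<in> topspace X. b x y \<in> {0<..}} \<and> x \<in> {y \<in> topspace X. b x y \<in> {0<..}}" if "x \<in> topspace X" for x
    using openin_C2_preimage[OF b(1)[OF that], of "{0<..}"] b(2)[OF that] that by simp
  obtain F where F: "finite F" "F \<subseteq> topspace X" "topspace X \<subseteq> (\<Union>x\<in>F. {y \<in> topspace X. b x y \<in> {0<..}})"
    by (rule finite_subcover[OF N closedin_topspace])
  \<comment> \<open>Partial sums of the bumps: passing from \<open>S\<close> to
    \<open>insert x S\<close> changes the map only inside the chart \<open>c x\<close>.\<close>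
  define \<Psi> where "\<Psi> = (\<lambda>S y. \<Sum>x\<in>S. b x y)"
  have \<Psi>: "C2_map (\<Psi> S)" "flat_zeros (\<Psi> S)" if "S \<subseteq> F" for S
    unfolding \<Psi>_def using that F(2) b(1) b_nn by (auto intro!: C2_map_sum flat_zeros_sum_nonneg)
  have \<Psi>pos: "\<Psi> F y > 0" if y: "y \<in> topspace X" for y
  proof -
    obtain x where "x \<in> F" "b x y > 0" using subsetD[OF F(3) y] by auto
    then show ?thesis unfolding \<Psi>_def by (intro sum_pos2[OF F(1)]) (auto simp: b_nn)
  qed
  obtain y0 where y0: "y0 \<in> topspace X" "\<And>y. y \<in> topspace X \<Longrightarrow> \<Psi> F y0 \<le> \<Psi> F y"
    using compact_attains_inf[OF compact_C2_image[OF \<Psi>(1)[OF order_refl]]] False by auto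
  obtain B where B: "\<And>y. y \<in> topspace X \<Longrightarrow> norm (f y) \<le> B"
    using compact_imp_bounded[OF compact_C2_image[OF f(1)]] unfolding bounded_iff by auto
  \<comment> \<open>One vector must be generic for all partial sums at once, so that no intermediate
    map has degenerate zeros. Its length is chosen so that \<open>\<Psi> F y *\<^sub>R s\<close>
    exceeds the bound \<open>B\<close> of \<open>f\<close> at every point.\<close>
  define Ns where "Ns = (\<lambda>S. {s. \<not> degenerate_zeros (\<lambda>x. f x + \<Psi> S x *\<^sub>R s) \<subseteq> degenerate_zeros f \<inter> {x. \<Psi> S x = 0}})"
  have "negligible (\<Union>S\<in>Pow F. Ns S)"
    using F(1) negligible_degenerate_perturbations[OF assms(1) f(1) \<Psi>(1) \<Psi>(2)]
    unfolding Ns_def by (intro negligible_Union) auto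
  then obtain s where s: "s \<notin> (\<Union>S\<in>Pow F. Ns S)" "norm s > B / \<Psi> F y0"
    by (rule not_negligible_outside)
  let ?g = "\<lambda>S x. f x + \<Psi> S x *\<^sub>R s"
  have g: "C2_map (?g S)" "degenerate_zeros (?g S) = {}" if "S \<subseteq> F" for S
  proof -
    show "C2_map (?g S)" by (intro C2_map_add C2_map_scaleR f(1) \<Psi>(1)[OF that] C2_map_const)
    have "s \<notin> Ns S" using s(1) that by blast
    then show "degenerate_zeros (?g S) = {}" unfolding Ns_def using f(2) by blast
  qed
  have par: "even (card (zeros f) + card (zeros (?g S)))" if "S \<subseteq> F" for S
  proof -
    have "finite S" using that F(1) finite_subset by blast
    then show ?thesis using that
    proof (induction S)
      case empty
      show ?case by (simp add: \<Psi>_def)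
    next
      case (insert x S)
      have x: "x \<in> topspace X" and S: "S \<subseteq> F" using insert.prems F(2) by auto
      have "even (card (zeros (?g S)) + card (zeros (?g (insert x S))))"
      proof (rule zeros_parity_chart[OF assms(1) g[OF S] g[OF insert.prems] c(1,3,4)[OF x]])
        fix y assume "y \<notin> inv_chart (c x) ` cball (snd (c x) x) (\<rho> x)"
        then have "b x y = 0" unfolding b_def by (rule chart_bump_support[OF c(1,3,4)[OF x]])
        then show "?g S y = ?g (insert x S) y" using insert.hyps by (simp add: \<Psi>_def)
      qed
      then show ?case using insert.IH[OF S] by presburger
    qed
  qed
  have "zeros (?g F) = {}"
  proof (rule ccontr)
    assume "zeros (?g F) \<noteq> {}"
    then obtain y where y: "y \<in> topspace X" "f y + \<Psi> F y *\<^sub>R s = 0" by (auto simp: zeros_def)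
    have "norm (f y) = norm (\<Psi> F y *\<^sub>R s)" using y(2) by (metis add_eq_0_iff2 norm_minus_cancel)
    also have "\<dots> = \<Psi> F y * norm s" using \<Psi>pos[OF y(1)] by simp
    also have "\<dots> \<ge> \<Psi> F y0 * norm s" using y0(2)[OF y(1)] by (intro mult_right_mono) auto
    finally have "\<Psi> F y0 * norm s \<le> B" using B[OF y(1)] by linarith
    then show False using s(2) \<Psi>pos[OF y0(1)] by (simp add: field_simps)
  qed
  then show ?thesis using par[OF order_refl] by simp
qed

section \<open>Involutions with isolated fixed points\<close>

context C2_manifold
begin

lemma chart_deriv_unique:
  assumes "(f \<circ> inv_chart c has_derivative f') (at (snd c x))"
  shows "chart_deriv c f x = f'"
  unfolding chart_deriv_def using frechet_derivative_at[OF assms] by simp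

lemma chart_deriv_diff:
  assumes "C2_map f" "C2_map g" "c \<in> A" "x \<in> fst c"
  shows "chart_deriv c (\<lambda>x. f x - g x) x = (\<lambda>v. chart_deriv c f x v - chart_deriv c g x v)"
proof (rule chart_deriv_unique)
  have "((\<lambda>u. (f \<circ> inv_chart c) u - (g \<circ> inv_chart c) u) has_derivative
      (\<lambda>v. chart_deriv c f x v - chart_deriv c g x v)) (at (snd c x))"
    using assms by (intro has_derivative_diff C2_map_has_derivative)
  then show "((\<lambda>x. f x - g x) \<circ> inv_chart c has_derivative
      (\<lambda>v. chart_deriv c f x v - chart_deriv c g x v)) (at (snd c x))" by (simp add: comp_def)
qed

lemma chart_deriv_sum:
  assumes "\<And>i. i \<in> I \<Longrightarrow> C2_map (f i)" "c \<in> A" "x \<in> fst c"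
  shows "chart_deriv c (\<lambda>x. \<Sum>i\<in>I. f i x) x = (\<lambda>v. \<Sum>i\<in>I. chart_deriv c (f i) x v)"
proof (rule chart_deriv_unique)
  have "((\<lambda>u. \<Sum>i\<in>I. (f i \<circ> inv_chart c) u) has_derivative
      (\<lambda>v. \<Sum>i\<in>I. chart_deriv c (f i) x v)) (at (snd c x))"
    using assms by (intro has_derivative_sum C2_map_has_derivative)
  then show "((\<lambda>x. \<Sum>i\<in>I. f i x) \<circ> inv_chart c has_derivative
      (\<lambda>v. \<Sum>i\<in>I. chart_deriv c (f i) x v)) (at (snd c x))" by (simp add: comp_def)
qed

lemma chart_deriv_zero_outside:
  assumes c: "c \<in> A" and K: "compact K" "K \<subseteq> snd c ` fst c" "\<And>u. u \<notin> K \<Longrightarrow> h u = 0"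
    and d: "d \<in> A" "x \<in> fst d" "x \<notin> inv_chart c ` K"
  shows "chart_deriv d (chart_extend c h) x = (\<lambda>_. 0)"
proof (rule chart_deriv_unique)
  let ?W = "fst d \<inter> (topspace X - inv_chart c ` K)"
  have "openin X ?W" using chart_dom(2)[OF d(1)] closedin_inv_chart_compact[OF c K(1,2)] by blast
  then have o: "open (snd d ` ?W)" by (rule open_chart_image[OF d(1)]) simp
  have x: "snd d x \<in> snd d ` ?W" using d(2,3) chart_dom(1)[OF d(1)] by blast
  show "(chart_extend c h \<circ> inv_chart d has_derivative (\<lambda>_. 0)) (at (snd d x))"
  proof (rule has_derivative_transform_within_open[OF has_derivative_const[of 0] o x])
    fix v assume "v \<in> snd d ` ?W"
    then obtain y where "y \<in> ?W" "v = snd d y" by blast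
    then show "0 = (chart_extend c h \<circ> inv_chart d) v"
      using chart_extend_support[OF c K(2,3), where x = y] by (simp add: inv_chart_simps(1)[OF d(1)])
  qed
qed

lemma chart_deriv_chart_extend:
  assumes "c \<in> A" "x \<in> fst c" "(h has_derivative h') (at (snd c x))"
  shows "chart_deriv c (chart_extend c h) x = h'"
proof (rule chart_deriv_unique)
  show "(chart_extend c h \<circ> inv_chart c has_derivative h') (at (snd c x))"
    by (rule has_derivative_transform_within_open[OF assms(3) chart_dom(3)[OF assms(1)]])
       (use assms(2) in \<open>auto simp: chart_extend_def inv_chart_simps[OF assms(1)]\<close>)
qed

text \<open>The factor \<open>u - a\<close> vanishes at \<open>a\<close>, so the derivative of the
  bump drops out.\<close>

lemma has_derivative_bump_times_id:
  fixes a :: "real^'n"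
  shows "((\<lambda>u. bump a \<rho> u *\<^sub>R (u - a)) has_derivative (\<lambda>v. bump a \<rho> a *\<^sub>R v)) (at a)"
proof -
  have "Ck_on (Suc (Suc 0)) UNIV (bump a \<rho>)" using Ck_on_bump[of a \<rho>] unfolding numeral_2_eq_2 .
  from Ck_on_has_derivative[OF this UNIV_I]
  have b: "(bump a \<rho> has_derivative frechet_derivative (bump a \<rho>) (at a)) (at a)" .
  have i: "((\<lambda>u. u - a) has_derivative (\<lambda>v. v)) (at a)"
    by (auto intro!: derivative_eq_intros)
  have "((\<lambda>u. bump a \<rho> u *\<^sub>R (u - a)) has_derivative
      (\<lambda>v. bump a \<rho> a *\<^sub>R v + frechet_derivative (bump a \<rho>) (at a) v *\<^sub>R (a - a))) (at a)"
    by (rule has_derivative_scaleR[OF b i])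
  then show ?thesis by simp
qed

text \<open>Near each fixed point the odd map \<open>g - g \<circ> t\<close> has derivative \<open>2 D g\<close>.\<close>

lemma ex_odd_map_nondegenerate_on_fixed_points:
  assumes t: "C2_self_map t" "\<And>x. x \<in> topspace X \<Longrightarrow> t (t x) = x"
    and fin: "finite {x \<in> topspace X. t x = x}"
    and D: "\<And>x. x \<in> topspace X \<Longrightarrow> t x = x \<Longrightarrow>
      \<exists>c\<in>A. x \<in> fst c \<and> frechet_derivative (local_rep c c t) (at (snd c x)) = (\<lambda>v. - v)"
  shows "\<exists>f :: 'a \<Rightarrow> real^'n. C2_map f \<and> (\<forall>x\<in>topspace X. f (t x) = - f x) \<and>
     (\<forall>x\<in>topspace X. t x = x \<longrightarrow> x \<notin> degenerate_zeros f)"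
proof -
  let ?P = "{x \<in> topspace X. t x = x}"
  \<comment> \<open>The ball avoids the other fixed points, so the map localized at \<open>p\<close>
    has zero derivative at each of them.\<close>
  have "\<exists>q. fst q \<in> A \<and> p \<in> fst (fst q) \<and> frechet_derivative (local_rep (fst q) (fst q) t) (at (snd (fst q) p)) = (\<lambda>v. - v)
     \<and> snd q > 0 \<and> cball (snd (fst q) p) (snd q) \<subseteq> snd (fst q) ` (fst (fst q) - (?P - {p}))" if p: "p \<in> ?P" for p
  proof -
    obtain c where c: "c \<in> A" "p \<in> fst c" "frechet_derivative (local_rep c c t) (at (snd c p)) = (\<lambda>v. - v)"
      using D[of p] p by blast
    have "closedin X (?P - {p})"
      using fin Hausdorff by (intro closedin_Hausdorff_finite) auto
    then have "openin X (fst c - (?P - {p}))" by (rule openin_diff[OF chart_dom(2)[OF c(1)]])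
    then have "open (snd c ` (fst c - (?P - {p})))" by (rule open_chart_image[OF c(1)]) simp
    moreover have "snd c p \<in> snd c ` (fst c - (?P - {p}))" using c(2) by blast
    ultimately obtain \<rho> where "\<rho> > 0" "cball (snd c p) \<rho> \<subseteq> snd c ` (fst c - (?P - {p}))"
      unfolding open_contains_cball by blast
    with c show ?thesis by (intro exI[of _ "(c, \<rho>)"]) simp
  qed
  then have "\<forall>p\<in>?P. \<exists>q. fst q \<in> A \<and> p \<in> fst (fst q) \<and> frechet_derivative (local_rep (fst q) (fst q) t) (at (snd (fst q) p)) = (\<lambda>v. - v)
     \<and> snd q > 0 \<and> cball (snd (fst q) p) (snd q) \<subseteq> snd (fst q) ` (fst (fst q) - (?P - {p}))" by (intro ballI)
  from bchoice[OF this] obtain Q where Q: "\<forall>p\<in>?P. fst (Q p) \<in> A \<and> p \<in> fst (fst (Q p)) \<and>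
     frechet_derivative (local_rep (fst (Q p)) (fst (Q p)) t) (at (snd (fst (Q p)) p)) = (\<lambda>v. - v)
     \<and> snd (Q p) > 0 \<and> cball (snd (fst (Q p)) p) (snd (Q p)) \<subseteq> snd (fst (Q p)) ` (fst (fst (Q p)) - (?P - {p}))"
    by (elim exE)
  define c where "c = (\<lambda>x. fst (Q x))"
  define \<rho> where "\<rho> = (\<lambda>x. snd (Q x))"
  have c: "c p \<in> A" "p \<in> fst (c p)" "frechet_derivative (local_rep (c p) (c p) t) (at (snd (c p) p)) = (\<lambda>v. - v)"
     "\<rho> p > 0" "cball (snd (c p) p) (\<rho> p) \<subseteq> snd (c p) ` (fst (c p) - (?P - {p}))" if "p \<in> ?P" for p
    using bspec[OF Q that] unfolding c_def \<rho>_def by blast+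
  have cb: "cball (snd (c p) p) (\<rho> p) \<subseteq> snd (c p) ` fst (c p)" if "p \<in> ?P" for p
    using c(5)[OF that] by (rule order_trans) (rule image_mono, rule Diff_subset)
  define h where "h = (\<lambda>p u. bump (snd (c p) p) (\<rho> p) u *\<^sub>R (u - snd (c p) p))"
  define g where "g = (\<lambda>p. chart_extend (c p) (h p))"
  have h0: "h p u = 0" if "p \<in> ?P" "u \<notin> cball (snd (c p) p) (\<rho> p)" for p u
    using bump_outside[OF c(4)[OF that(1)] that(2)] by (simp add: h_def)
  have "Ck_on 2 UNIV (h p)" for p
    unfolding h_def by (intro Ck_on_scaleR Ck_on_diff Ck_on_bump Ck_on_ident Ck_on_const open_UNIV)
  then have g: "C2_map (g p)" if "p \<in> ?P" for p
    unfolding g_def by (rule C2_map_chart_extend[OF c(1)[OF that] _ compact_cball cb[OF that] h0[OF that]])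
  have gt: "C2_map (\<lambda>x. g p (t x))" if "p \<in> ?P" for p
    using C2_map_comp_self_map[OF g[OF that] t(1)] by (simp add: comp_def)
  define f where "f = (\<lambda>x. \<Sum>p\<in>?P. g p x - g p (t x))"
  have f: "C2_map f" unfolding f_def by (intro C2_map_sum C2_map_diff g gt)
  have odd: "f (t x) = - f x" if "x \<in> topspace X" for x
    unfolding f_def by (simp add: t(2)[OF that] sum_negf[symmetric])
  have "inj (chart_deriv (c p) f p)" if p: "p \<in> ?P" for p
  proof -
    have tp: "t p = p" using p by simp
    have self: "chart_deriv (c p) (g p) p = (\<lambda>v. bump (snd (c p) p) (\<rho> p) (snd (c p) p) *\<^sub>R v)"
      unfolding g_def h_def by (rule chart_deriv_chart_extend[OF c(1,2)[OF p] has_derivative_bump_times_id])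
    have other: "chart_deriv (c p) (g q) p = (\<lambda>_. 0)" if q: "q \<in> ?P" "q \<noteq> p" for q
      unfolding g_def
    proof (rule chart_deriv_zero_outside[OF c(1)[OF q(1)] compact_cball cb[OF q(1)] h0[OF q(1)] c(1,2)[OF p]])
      show "p \<notin> inv_chart (c q) ` cball (snd (c q) q) (\<rho> q)"
      proof
        assume "p \<in> inv_chart (c q) ` cball (snd (c q) q) (\<rho> q)"
        then obtain u where u: "u \<in> cball (snd (c q) q) (\<rho> q)" "p = inv_chart (c q) u" by blast
        obtain y where "y \<in> fst (c q) - (?P - {q})" "u = snd (c q) y"
          using subsetD[OF c(5)[OF q(1)] u(1)] by blast
        then show False using u(2) p q(2) inv_chart_simps(1)[OF c(1)[OF q(1)], of y] by auto
      qed
    qed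
    have refl: "chart_deriv (c p) (\<lambda>x. g q (t x)) p = (\<lambda>v. chart_deriv (c p) (g q) p (- v))" if q: "q \<in> ?P" for q
      using chart_deriv_comp[OF c(1)[OF p] c(1)[OF p] t(1) g[OF q] c(2)[OF p], unfolded tp, OF c(2)[OF p]]
      unfolding c(3)[OF p] comp_def .
    have "chart_deriv (c p) f p v = (\<Sum>q\<in>?P. chart_deriv (c p) (g q) p v - chart_deriv (c p) (g q) p (- v))" for v
      unfolding f_def
      using chart_deriv_sum[OF C2_map_diff[OF g gt] c(1,2)[OF p], of ?P]
        chart_deriv_diff[OF g gt c(1,2)[OF p]] refl by simp
    also have "\<dots> v = (\<Sum>q\<in>?P. if q = p then (2 * bump (snd (c p) p) (\<rho> p) (snd (c p) p)) *\<^sub>R v else 0)" for v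
      by (intro sum.cong refl) (auto simp: self other scaleR_2 simp flip: scaleR_scaleR)
    also have "\<dots> v = (2 * bump (snd (c p) p) (\<rho> p) (snd (c p) p)) *\<^sub>R v" for v
      using fin p by simp
    finally have "chart_deriv (c p) f p v = (2 * bump (snd (c p) p) (\<rho> p) (snd (c p) p)) *\<^sub>R v" for v .
    then show ?thesis using bump_simps(3)[OF c(4)[OF p], of "snd (c p) p"] by (auto intro!: injI)
  qed
  then have "x \<notin> degenerate_zeros f" if "x \<in> ?P" for x
    using degenerate_zeros_iff[OF f c(1,2)[OF that]] that by blast
  then show ?thesis using f odd by (intro exI[of _ f]) blast
qed

text \<open>The support of the bump \<open>b\<close> around \<open>x\<close> is so small that
  \<open>b\<close> and \<open>b \<circ> t\<close> are never both nonzero. Zeros of the odd function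
  \<open>b - b \<circ> t\<close> are then common zeros of two nonnegative functions, hence flat
  although the difference changes sign.\<close>

lemma ex_odd_bump:
  assumes t: "C2_self_map t" "\<And>x. x \<in> topspace X \<Longrightarrow> t (t x) = x"
    and x: "x \<in> topspace X" "t x \<noteq> x"
  shows "\<exists>\<beta>. C2_map \<beta> \<and> flat_zeros \<beta> \<and> (\<forall>y\<in>topspace X. \<beta> (t y) = - \<beta> y) \<and> \<beta> x \<noteq> 0"
proof -
  obtain V V' where V: "openin X V" "openin X V'" "x \<in> V" "t x \<in> V'" "disjnt V V'"
    using Hausdorff x self_map_topspace[OF t(1) x(1)] unfolding Hausdorff_space_def by metis
  obtain c where c: "c \<in> A" "x \<in> fst c" using x(1) by (rule ex_chart)
  let ?W = "fst c \<inter> (V \<inter> {y \<in> topspace X. t y \<in> V'})"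
  have "openin X {y \<in> topspace X. t y \<in> V'}"
    using t(1) V(2) by (auto simp: C2_self_map_def intro: openin_continuous_map_preimage)
  then have "openin X ?W" using chart_dom(2)[OF c(1)] V(1) by (intro openin_Int)
  then have "open (snd c ` ?W)" by (rule open_chart_image[OF c(1)]) simp
  moreover have "snd c x \<in> snd c ` ?W" using c(2) V x(1) by blast
  ultimately obtain \<rho> where \<rho>: "\<rho> > 0" "cball (snd c x) \<rho> \<subseteq> snd c ` ?W"
    unfolding open_contains_cball by blast
  have cb: "cball (snd c x) \<rho> \<subseteq> snd c ` fst c"
    using \<rho>(2) by (rule order_trans) (rule image_mono, rule Int_lower1)
  let ?b = "chart_bump c (snd c x) \<rho>"
  have b: "C2_map ?b" by (rule C2_map_chart_bump[OF c(1) \<rho>(1) cb])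
  have bt: "C2_map (\<lambda>y. ?b (t y))" using C2_map_comp_self_map[OF b t(1)] by (simp add: comp_def)
  have disj: "?b y = 0 \<or> ?b (t y) = 0" if "y \<in> topspace X" for y
  proof (rule ccontr)
    assume "\<not> ?thesis"
    then have "y \<in> inv_chart c ` cball (snd c x) \<rho>" "t y \<in> inv_chart c ` cball (snd c x) \<rho>"
      using chart_bump_support[OF c(1) \<rho>(1) cb] by blast+
    moreover have "inv_chart c ` cball (snd c x) \<rho> \<subseteq> ?W"
    proof (rule image_subsetI)
      fix u assume "u \<in> cball (snd c x) \<rho>"
      then obtain z where "z \<in> ?W" "u = snd c z" using \<rho>(2) by blast
      then show "inv_chart c u \<in> ?W" using inv_chart_simps(1)[OF c(1), of z] by simp
    qed
    ultimately have "y \<in> ?W" "t y \<in> ?W" by blast+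
    then show False using V(5) unfolding disjnt_def by blast
  qed
  let ?\<beta> = "\<lambda>y. ?b y - ?b (t y)"
  have "flat_zeros ?\<beta>"
    unfolding flat_zeros_def
  proof (intro ballI impI)
    fix d y assume d: "d \<in> A" "y \<in> fst d" "?\<beta> y = 0"
    have "y \<in> topspace X" using d chart_dom(1) by blast
    then have "?b y = 0" "?b (t y) = 0" using disj[of y] d(3) by auto
    moreover have "flat_zeros ?b" "flat_zeros (\<lambda>y. ?b (t y))"
      using flat_zeros_nonneg[OF b] flat_zeros_nonneg[OF bt] chart_bump_nonneg by blast+
    ultimately have "chart_deriv d ?b y = (\<lambda>_. 0)" "chart_deriv d (\<lambda>y. ?b (t y)) y = (\<lambda>_. 0)"
      using d(1,2) unfolding flat_zeros_def by blast+
    then show "chart_deriv d ?\<beta> y = (\<lambda>_. 0)" using chart_deriv_diff[OF b bt d(1,2)] by simp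
  qed
  moreover have "?\<beta> x \<noteq> 0"
    using chart_bump_center[OF \<rho>(1) c(2)] disj[OF x(1)] by auto
  moreover have "?\<beta> (t y) = - ?\<beta> y" if "y \<in> topspace X" for y using t(2)[OF that] by simp
  ultimately show ?thesis using C2_map_diff[OF b bt] by (intro exI[of _ ?\<beta>]) blast
qed

end

text \<open>Odd bumps vanish at the fixed points, where \<open>f0\<close> is already nondegenerate,
  so adding them preserves both oddness and what has been achieved. Each addition confines the
  degenerate zeros to the zeros of one more bump, and the finitely many bumps have no common zero on
  the original degenerate set.\<close>

theorem even_card_fixed_points:
  fixes X :: "'a topology" and A :: "('a, 'n::{finite,wellorder}) chart set"
  assumes "C2_manifold X A"
    and t: "C2_manifold.C2_self_map X A t" "\<And>x. x \<in> topspace X \<Longrightarrow> t (t x) = x"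
    and fin: "finite {x \<in> topspace X. t x = x}"
    and D: "\<And>x. x \<in> topspace X \<Longrightarrow> t x = x \<Longrightarrow>
      \<exists>c\<in>A. x \<in> fst c \<and> frechet_derivative (local_rep c c t) (at (snd c x)) = (\<lambda>v. - v)"
  shows "even (card {x \<in> topspace X. t x = x})"
proof -
  interpret C2_manifold X A by fact
  obtain f0 :: "'a \<Rightarrow> real^'n::_" where f0: "C2_map f0" "\<forall>x\<in>topspace X. f0 (t x) = - f0 x"
    "\<forall>x\<in>topspace X. t x = x \<longrightarrow> x \<notin> degenerate_zeros f0"
    using ex_odd_map_nondegenerate_on_fixed_points[OF t fin D] by blast
  let ?Z = "degenerate_zeros f0"
  have Z: "x \<in> topspace X" "t x \<noteq> x" if "x \<in> ?Z" for x
    using that f0(3) by (auto simp: degenerate_zeros_def zeros_def)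
  have "\<forall>x\<in>?Z. \<exists>\<beta>. C2_map \<beta> \<and> flat_zeros \<beta> \<and> (\<forall>y\<in>topspace X. \<beta> (t y) = - \<beta> y) \<and> \<beta> x \<noteq> 0"
    using ex_odd_bump[OF t Z] by (intro ballI)
  from bchoice[OF this] obtain \<beta> where \<beta>: "\<forall>x\<in>?Z. C2_map (\<beta> x) \<and> flat_zeros (\<beta> x) \<and>
     (\<forall>y\<in>topspace X. \<beta> x (t y) = - \<beta> x y) \<and> \<beta> x x \<noteq> 0" by (elim exE)
  have N: "openin X {y \<in> topspace X. \<beta> x y \<in> - {0}} \<and> x \<in> {y \<in> topspace X. \<beta> x y \<in> - {0}}" if "x \<in> ?Z" for x
    using openin_C2_preimage[of "\<beta> x" "- {0}"] bspec[OF \<beta> that] Z(1)[OF that] by (simp add: open_Compl)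
  obtain F where F: "finite F" "F \<subseteq> ?Z" "?Z \<subseteq> (\<Union>x\<in>F. {y \<in> topspace X. \<beta> x y \<in> - {0}})"
    by (rule finite_subcover[OF N closedin_degenerate_zeros[OF f0(1)]])
  have "\<exists>f :: 'a \<Rightarrow> real^'n::_. C2_map f \<and> (\<forall>x\<in>topspace X. f (t x) = - f x) \<and>
      degenerate_zeros f \<subseteq> ?Z \<inter> {y. \<forall>x\<in>S. \<beta> x y = 0}" if "S \<subseteq> F" for S
  proof -
    have "finite S" using that F(1) finite_subset by blast
    then show ?thesis using that
    proof (induction S)
      case empty
      show ?case using f0 by (intro exI[of _ f0]) simp
    next
      case (insert x S)
      then obtain f :: "'a \<Rightarrow> real^'n::_" where f: "C2_map f" "\<forall>x\<in>topspace X. f (t x) = - f x"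
        "degenerate_zeros f \<subseteq> ?Z \<inter> {y. \<forall>x\<in>S. \<beta> x y = 0}" by blast
      have "x \<in> ?Z" using insert.prems F(2) by blast
      then have bx: "C2_map (\<beta> x)" "flat_zeros (\<beta> x)" "\<forall>y\<in>topspace X. \<beta> x (t y) = - \<beta> x y"
        using bspec[OF \<beta>] by auto
      obtain s where s: "s \<notin> {s. \<not> degenerate_zeros (\<lambda>y. f y + \<beta> x y *\<^sub>R s) \<subseteq> degenerate_zeros f \<inter> {y. \<beta> x y = 0}}"
        using not_negligible_outside[OF negligible_degenerate_perturbations[OF assms(1) f(1) bx(1,2)]] by blast
      let ?g = "\<lambda>y. f y + \<beta> x y *\<^sub>R s"
      have "C2_map ?g" by (intro C2_map_add C2_map_scaleR f(1) bx(1) C2_map_const)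
      moreover have "\<forall>y\<in>topspace X. ?g (t y) = - ?g y" using f(2) bx(3) by simp
      moreover have "degenerate_zeros ?g \<subseteq> ?Z \<inter> {y. \<forall>z\<in>insert x S. \<beta> z y = 0}" using s f(3) by blast
      ultimately show ?case by (intro exI[of _ ?g]) blast
    qed
  qed
  from this[OF order_refl] obtain f :: "'a \<Rightarrow> real^'n::_" where f: "C2_map f" "\<forall>x\<in>topspace X. f (t x) = - f x"
    "degenerate_zeros f \<subseteq> ?Z \<inter> {y. \<forall>x\<in>F. \<beta> x y = 0}" by blast
  have "degenerate_zeros f = {}"
  proof (rule ccontr)
    assume "degenerate_zeros f \<noteq> {}"
    then obtain y where y: "y \<in> ?Z" "\<forall>x\<in>F. \<beta> x y = 0" using f(3) by blast
    then show False using subsetD[OF F(3) y(1)] by auto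
  qed
  then have even: "even (card (zeros f))" and finz: "finite (zeros f)"
    using even_card_zeros[OF assms(1) f(1)] finite_zeros[OF f(1)] by blast+
  have "t x \<in> zeros f" "t (t x) = x" if "x \<in> zeros f" for x
    using that f(2) t(2) self_map_topspace[OF t(1)] by (auto simp: zeros_def)
  then have "even (card (zeros f) + card {x \<in> zeros f. t x = x})"
    by (intro card_involution_parity finz)
  moreover have "{x \<in> zeros f. t x = x} = {x \<in> topspace X. t x = x}"
  proof -
    have "f x = 0" if "x \<in> topspace X" "t x = x" for x
    proof -
      have "f x = - f x" using bspec[OF f(2) that(1)] that(2) by simp
      then have "2 *\<^sub>R f x = 0" by (simp add: scaleR_2 eq_neg_iff_add_eq_0)
      then show ?thesis by simp
    qed
    then show ?thesis by (auto simp: zeros_def)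
  qed
  ultimately show ?thesis using even by simp
qed

section \<open>From actions to even graphs\<close>

text \<open>The library states Sard's theorem and the change of variables formula for vectors indexed by
  a well-ordered finite type only, so the atlas is reindexed by a well-ordered copy of the index type.\<close>

typedef 'n wo = "UNIV :: 'n set" by simp

instance wo :: (finite) finite
proof
  have "(UNIV :: 'a wo set) = Abs_wo ` UNIV" by (metis Rep_wo_inverse surj_def)
  then show "finite (UNIV :: 'a wo set)" by (metis finite finite_imageI)
qed

instantiation wo :: (finite) wellorder
begin

definition "x \<le> y \<longleftrightarrow> to_nat_on (UNIV :: 'a set) (Rep_wo x) \<le> to_nat_on (UNIV :: 'a set) (Rep_wo y)"
definition "x < y \<longleftrightarrow> to_nat_on (UNIV :: 'a set) (Rep_wo x) < to_nat_on (UNIV :: 'a set) (Rep_wo y)"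

instance
proof
  fix x y z :: "'a wo" and P :: "'a wo \<Rightarrow> bool" and a :: "'a wo"
  have inj: "inj (to_nat_on (UNIV :: 'a set))" by (simp add: countable_finite inj_on_to_nat_on)
  show "(x < y) = (x \<le> y \<and> \<not> y \<le> x)" by (auto simp: less_eq_wo_def less_wo_def)
  show "x \<le> x" by (simp add: less_eq_wo_def)
  show "x \<le> y \<Longrightarrow> y \<le> z \<Longrightarrow> x \<le> z" by (simp add: less_eq_wo_def)
  show "x \<le> y \<Longrightarrow> y \<le> x \<Longrightarrow> x = y"
    using injD[OF inj, of "Rep_wo x" "Rep_wo y"] by (simp add: less_eq_wo_def Rep_wo_inject)
  show "x \<le> y \<or> y \<le> x" by (auto simp: less_eq_wo_def)
  show "(\<And>x. (\<And>y. y < x \<Longrightarrow> P y) \<Longrightarrow> P x) \<Longrightarrow> P a"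
    by (rule measure_induct_rule[of "\<lambda>x. to_nat_on (UNIV :: 'a set) (Rep_wo x)"]) (simp add: less_wo_def)
qed

end

section \<open>Atlases with reindexed coordinates\<close>

definition wo_vec :: "real^'n \<Rightarrow> real^'n::finite wo" where
  "wo_vec v = (\<chi> i. v $ Rep_wo i)"

definition of_wo_vec :: "real^'n::finite wo \<Rightarrow> real^'n" where
  "of_wo_vec v = (\<chi> i. v $ Abs_wo i)"

lemma wo_vec_inverse [simp]: "of_wo_vec (wo_vec v) = v" "wo_vec (of_wo_vec w) = w"
  by (simp_all add: wo_vec_def of_wo_vec_def vec_eq_iff Rep_wo_inverse Abs_wo_inverse)

lemma bounded_linear_wo_vec: "bounded_linear (wo_vec :: real^'n \<Rightarrow> real^'n::finite wo)" "bounded_linear (of_wo_vec :: real^'n::finite wo \<Rightarrow> real^'n)"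
  by (auto intro!: linear_conv_bounded_linear[THEN iffD1] linearI simp: wo_vec_def of_wo_vec_def vec_eq_iff)

lemma wo_vec_image_eq: "wo_vec ` S = of_wo_vec -` S"
proof (rule set_eqI)
  fix w
  show "w \<in> wo_vec ` S \<longleftrightarrow> w \<in> of_wo_vec -` S"
    using image_eqI[of w wo_vec "of_wo_vec w" S] by auto
qed

lemma open_wo_vec_image: "open S \<Longrightarrow> open (wo_vec ` S)"
  unfolding wo_vec_image_eq
  by (intro open_vimage linear_continuous_on bounded_linear_wo_vec)

lemma Ck_on_wo_vec_conjugate:
  assumes "open S" "Ck_on k S f"
  shows "Ck_on k (wo_vec ` S) (\<lambda>u. wo_vec (f (of_wo_vec u)))"
  using assms open_wo_vec_image[OF assms(1)]
  by (intro Ck_on_linear_comp[OF _ bounded_linear_wo_vec(1)] Ck_on_compose[OF _ assms(1) Ck_on_bounded_linear[OF bounded_linear_wo_vec(2)]])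
     auto

definition wo_chart :: "('a, 'n::finite) chart \<Rightarrow> ('a, 'n wo) chart" where
  "wo_chart c = (fst c, wo_vec \<circ> snd c)"

lemma wo_chart_simps [simp]: "fst (wo_chart c) = fst c" "snd (wo_chart c) x = wo_vec (snd c x)"
  by (simp_all add: wo_chart_def)

text \<open>Both sides choose from the same predicate, even for \<open>u\<close> outside the image
  of the chart. Local representatives therefore correspond as functions and not only on their
  domains.\<close>

lemma inv_into_wo_chart: "inv_into (fst (wo_chart c)) (snd (wo_chart c)) u = inv_into (fst c) (snd c) (of_wo_vec u)"
proof -
  have "wo_vec y = u \<longleftrightarrow> y = of_wo_vec u" for y by auto
  then show ?thesis by (simp add: inv_into_def)
qed

lemma local_rep_wo_chart:
  "local_rep (wo_chart c) (wo_chart d) f = (\<lambda>u. wo_vec (local_rep c d f (of_wo_vec u)))"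
  unfolding local_rep_def fun_eq_iff comp_def inv_into_wo_chart by simp

lemma local_dom_wo_chart: "local_dom (wo_chart c) (wo_chart d) f = wo_vec ` local_dom c d f"
  unfolding local_dom_def by (auto simp: image_image)

lemma is_chart_wo_chart:
  assumes "is_chart X c" shows "is_chart X (wo_chart c)"
proof -
  let ?D = "snd c ` fst c"
  have im: "snd (wo_chart c) ` fst c = wo_vec ` ?D" by (auto simp: image_image)
  have "homeomorphic_maps (top_of_set ?D) (top_of_set (wo_vec ` ?D)) wo_vec of_wo_vec"
    unfolding homeomorphic_maps_def
    by (auto intro!: continuous_map_into_subtopology continuous_map_from_subtopology
        simp: linear_continuous_on[OF bounded_linear_wo_vec(1)] linear_continuous_on[OF bounded_linear_wo_vec(2)])
  then have "homeomorphic_map (top_of_set ?D) (top_of_set (wo_vec ` ?D)) wo_vec"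
    unfolding homeomorphic_map_maps by blast
  then have "homeomorphic_map (subtopology X (fst c)) (top_of_set (wo_vec ` ?D)) (wo_vec \<circ> snd c)"
    by (rule homeomorphic_map_compose[OF is_chart_facts(4)[OF assms]])
  then show ?thesis
    using is_chart_facts(1,2)[OF assms] open_wo_vec_image[of ?D]
    unfolding is_chart_def case_prod_unfold wo_chart_simps(1) im by (simp add: wo_chart_def)
qed

lemma C2_manifold_wo_atlas:
  fixes A :: "('a, 'n::finite) chart set"
  assumes "closed_connected_manifold X A"
  shows "C2_manifold X (wo_chart ` A)"
proof -
  have A: "\<forall>c\<in>A. is_chart X c" "(\<Union>c\<in>A. fst c) = topspace X" "Hausdorff_space X" "compact_space X"
    "\<forall>c\<in>A. \<forall>d\<in>A. smooth_on (local_dom c d id) (local_rep c d id)"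
    using assms by (auto simp: closed_connected_manifold_def smooth_manifold_def)
  show ?thesis
  proof
    show "is_chart X c" if "c \<in> wo_chart ` A" for c using that A(1) is_chart_wo_chart by blast
    show "(\<Union>c\<in>wo_chart ` A. fst c) = topspace X" using A(2) by simp
    show "Ck_on 2 (local_dom c d id) (local_rep c d id)" if cd: "c \<in> wo_chart ` A" "d \<in> wo_chart ` A" for c d
    proof -
      obtain c0 d0 where "c0 \<in> A" "c = wo_chart c0" "d0 \<in> A" "d = wo_chart d0" using cd by blast
      then have "Ck_on 2 (local_dom c0 d0 id) (local_rep c0 d0 id)"
        using A(5) by (intro smooth_on_imp_Ck_on) blast
      moreover have "open (local_dom c0 d0 id)"
        using A(1) \<open>c0 \<in> A\<close> \<open>d0 \<in> A\<close> by (intro open_local_dom_chart[of X]) auto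
      ultimately show ?thesis
        unfolding \<open>c = _\<close> \<open>d = _\<close> local_rep_wo_chart local_dom_wo_chart by (intro Ck_on_wo_vec_conjugate)
    qed
  qed (use A in auto)
qed

lemma fixed_points_bit:
  fixes \<Phi> :: "bit \<Rightarrow> 'a \<Rightarrow> 'a"
  assumes "\<And>x. x \<in> topspace X \<Longrightarrow> \<Phi> 0 x = x"
  shows "fixed_points X \<Phi> = {x \<in> topspace X. \<Phi> 1 x = x}"
proof -
  have "(\<forall>g. \<Phi> g x = x) \<longleftrightarrow> \<Phi> 1 x = x" if "x \<in> topspace X" for x
    using assms[OF that] by (metis bit_not_zero_iff)
  then show ?thesis by (auto simp: fixed_points_def)
qed

text \<open>A homomorphism on \<open>bit\<close> is determined by its value at 1.\<close>

lemma HomZ2_bit_nonzero: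
  fixes \<rho> :: "bit \<Rightarrow> bit"
  assumes "\<rho> \<in> HomZ2 - {0}" shows "\<rho> 1 = 1"
proof (rule ccontr)
  assume "\<rho> 1 \<noteq> 1"
  then have "\<rho> 1 = 0" by simp
  moreover have "\<rho> 0 = 0" using assms additive.zero[of \<rho>] by (simp add: HomZ2_def)
  ultimately have "\<rho> g = 0" for g by (cases g) auto
  then have "\<rho> = 0" by (simp add: fun_eq_iff)
  then show False using assms by simp
qed

text \<open>Every color is nontrivial, so the differential of \<open>\<Phi> 1\<close> at a fixed
  point negates a spanning set and hence is \<open>-1\<close>. The parity of the number of fixed
  points then follows in the reindexed atlas.\<close>

lemma even_card_vertices:
  fixes \<Gamma> :: "('v, 'e) multigraph" and \<alpha> :: "'e \<Rightarrow> bit \<Rightarrow> bit"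
  assumes "is_colored_graph_of_G_action TYPE('n::finite) \<Gamma> \<alpha>"
  shows "even (card (verts \<Gamma>))"
proof -
  obtain X :: "(nat \<Rightarrow> real) topology" and A :: "(nat \<Rightarrow> real, 'n) chart set" and \<Phi>
    where act: "G_action X A \<Phi>" and col: "colored_graph_of \<Gamma> \<alpha> X A \<Phi>"
    using assms unfolding is_colored_graph_of_G_action_def by blast
  have man: "closed_connected_manifold X A" and sm: "\<forall>g. smooth_self_map X A (\<Phi> g)"
    and P0: "\<And>x. x \<in> topspace X \<Longrightarrow> \<Phi> 0 x = x"
    and Padd: "\<And>x g h. x \<in> topspace X \<Longrightarrow> \<Phi> (g + h) x = \<Phi> g (\<Phi> h x)"
    and fin: "finite (fixed_points X \<Phi>)"
    using act by (auto simp: G_action_def)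
  have charts: "\<forall>c\<in>A. is_chart X c" using man by (simp add: closed_connected_manifold_def smooth_manifold_def)
  have sm1: "continuous_map X X (\<Phi> 1)" "\<forall>c\<in>A. \<forall>d\<in>A. smooth_on (local_dom c d (\<Phi> 1)) (local_rep c d (\<Phi> 1))"
    using sm by (auto simp: smooth_self_map_def)
  have od: "open (local_dom c d (\<Phi> 1))" if "c \<in> A" "d \<in> A" for c d
    using that charts sm1(1) by (intro open_local_dom_chart[of X]) auto
  obtain \<iota> where \<iota>: "bij_betw \<iota> (verts \<Gamma>) (fixed_points X \<Phi>)"
    "\<forall>p\<in>verts \<Gamma>. tangent_rep_given_by A \<Phi> (\<iota> p) (edges_at \<Gamma> p) \<alpha>"
    and sk: "abstract_1_skeleton CARD('n) \<Gamma> \<alpha>"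
    using col by (auto simp: colored_graph_of_def)
  have fp: "fixed_points X \<Phi> = {x \<in> topspace X. \<Phi> 1 x = x}"
    by (rule fixed_points_bit) (rule P0)
  interpret C2_manifold X "wo_chart ` A" by (rule C2_manifold_wo_atlas[OF man])
  have "even (card {x \<in> topspace X. \<Phi> 1 x = x})"
  proof (rule even_card_fixed_points[OF C2_manifold_axioms])
    show "C2_self_map (\<Phi> 1)"
      unfolding C2_self_map_def
      using sm1 od by (auto simp: local_rep_wo_chart local_dom_wo_chart smooth_on_imp_Ck_on
            intro!: Ck_on_wo_vec_conjugate)
    show "\<Phi> 1 (\<Phi> 1 x) = x" if "x \<in> topspace X" for x
      using Padd[OF that, of 1 1] P0[OF that] by simp
    show "finite {x \<in> topspace X. \<Phi> 1 x = x}" using fin unfolding fp .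
    fix x assume x: "x \<in> topspace X" "\<Phi> 1 x = x"
    then have "x \<in> fixed_points X \<Phi>" unfolding fp by simp
    then obtain p where p: "p \<in> verts \<Gamma>" "x = \<iota> p" using \<iota>(1) by (auto simp: bij_betw_def)
    let ?S = "edges_at \<Gamma> p"
    obtain c b where c: "c \<in> A" "x \<in> fst c" and b: "span (b ` ?S) = UNIV"
      and eig: "\<forall>g. \<forall>e\<in>?S. frechet_derivative (local_rep c c (\<Phi> g)) (at (snd c x)) (b e) =
            (if \<alpha> e g = 0 then b e else - b e)"
      using bspec[OF \<iota>(2) p(1)] unfolding tangent_rep_given_by_def p(2) by blast
    let ?L = "frechet_derivative (local_rep c c (\<Phi> 1)) (at (snd c x))"
    have "snd c x \<in> local_dom c c (\<Phi> 1)" using c x by (auto simp: local_dom_def)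
    moreover have "Ck_on (Suc 0) (local_dom c c (\<Phi> 1)) (local_rep c c (\<Phi> 1))"
      using sm1(2) c by (intro smooth_on_imp_Ck_on) auto
    ultimately have dL: "(local_rep c c (\<Phi> 1) has_derivative ?L) (at (snd c x))"
      by (intro Ck_on_has_derivative)
    have "?L v = - v" for v
    proof (rule linear_eq_on_span[OF has_derivative_linear[OF dL], of uminus "b ` ?S"])
      show "linear (uminus :: real^'n \<Rightarrow> real^'n)" by (intro linearI) auto
      fix w assume "w \<in> b ` ?S"
      then obtain e where e: "e \<in> ?S" "w = b e" by blast
      have "\<alpha> e 1 = 1"
        using sk e(1) by (intro HomZ2_bit_nonzero) (auto simp: abstract_1_skeleton_def edges_at_def)
      then show "?L w = - w" using eig e by simp
    qed (simp add: b)
    then have L: "?L = (\<lambda>v. - v)" by (simp add: fun_eq_iff)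
    have "(of_wo_vec has_derivative of_wo_vec) (at (wo_vec (snd c x)))"
      by (rule bounded_linear_imp_has_derivative[OF bounded_linear_wo_vec(2)])
    moreover have "(local_rep c c (\<Phi> 1) has_derivative ?L) (at (of_wo_vec (wo_vec (snd c x))))"
      using dL by simp
    ultimately have "((\<lambda>u. local_rep c c (\<Phi> 1) (of_wo_vec u)) has_derivative (\<lambda>v. ?L (of_wo_vec v))) (at (wo_vec (snd c x)))"
      by (rule has_derivative_compose)
    from bounded_linear.has_derivative[OF bounded_linear_wo_vec(1) this]
    have "(local_rep (wo_chart c) (wo_chart c) (\<Phi> 1) has_derivative (\<lambda>v. wo_vec (?L (of_wo_vec v)))) (at (wo_vec (snd c x)))"
      unfolding local_rep_wo_chart .
    from frechet_derivative_at[OF this]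
    have "frechet_derivative (local_rep (wo_chart c) (wo_chart c) (\<Phi> 1)) (at (snd (wo_chart c) x)) = (\<lambda>v. wo_vec (?L (of_wo_vec v)))"
      by simp
    also have "\<dots> = (\<lambda>v. - v)"
      unfolding L by (simp add: linear_neg[OF bounded_linear.linear[OF bounded_linear_wo_vec(1)]])
    finally show "\<exists>c\<in>wo_chart ` A. x \<in> fst c \<and>
        frechet_derivative (local_rep c c (\<Phi> 1)) (at (snd c x)) = (\<lambda>v. - v)"
      using c by (intro bexI[of _ "wo_chart c"]) auto
  qed
  then show ?thesis using bij_betw_same_card[OF \<iota>(1)] unfolding fp by simp
qed

section \<open>Actions on hypersurfaces\<close>

text \<open>The implicit function theorem: \<open>x \<mapsto> (F x, L x)\<close> is a local diffeomorphism when \<open>L\<close> is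
  injective on the orthogonal complement of the gradient.\<close>

lemma implicit_chart:
  fixes F :: "real \<times> (real^'n::finite) \<Rightarrow> real"
  assumes sm: "\<And>k. Ck_on k UNIV F" and Fp: "F p = 0" and reg: "frechet_derivative F (at p) \<noteq> (\<lambda>_. 0)"
  shows "\<exists>V (L :: real \<times> (real^'n) \<Rightarrow> real^'n) \<psi> R. open V \<and> p \<in> V \<and> bounded_linear L \<and>
     open (L ` {x\<in>V. F x = 0}) \<and> (\<forall>x\<in>V. F x = 0 \<longrightarrow> \<psi> (L x) = x) \<and>
     (\<forall>k. Ck_on k (L ` {x\<in>V. F x = 0}) \<psi>) \<and> (\<psi> has_derivative R) (at (L p)) \<and>
     (\<forall>v. L (R v) = v \<and> frechet_derivative F (at p) (R v) = 0)"
proof -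
  let ?E = "UNIV :: (real \<times> (real^'n)) set"
  define DF where "DF = (\<lambda>x. frechet_derivative F (at x))"
  have dF: "(F has_derivative DF x) (at x)" for x
    unfolding DF_def using Ck_on_has_derivative[OF sm[of "Suc 0"]] by simp
  have linD: "linear (DF x)" for x using has_derivative_linear[OF dF] .
  have CD: "Ck_on k UNIV (\<lambda>x. DF x v)" for k v unfolding DF_def using sm[of "Suc k"] unfolding Ck_on.simps by blast
  \<comment> \<open>The gradient of \<open>F\<close> at \<open>p\<close>.\<close>
  define b where "b = (\<Sum>i\<in>Basis. DF p i *\<^sub>R i)"
  have Db: "DF p v = b \<bullet> v" for v
  proof -
    have "DF p v = DF p (\<Sum>i\<in>Basis. (v \<bullet> i) *\<^sub>R i)" by (simp add: euclidean_representation)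
    also have "\<dots> = (\<Sum>i\<in>Basis. (v \<bullet> i) * DF p i)" by (simp add: linear_sum[OF linD] linear_cmul[OF linD])
    also have "\<dots> = b \<bullet> v" unfolding b_def inner_sum_left
      by (intro sum.cong refl) (simp add: inner_commute mult.commute)
    finally show ?thesis .
  qed
  have b0: "b \<noteq> 0" using reg Db unfolding DF_def by (auto simp: fun_eq_iff)
  let ?S = "{x. b \<bullet> x = 0}"
  have "dim ?S = dim (UNIV :: (real^'n) set)" using dim_hyperplane[OF b0] by simp
  then obtain f g where fg0: "linear f" "linear g" "f ` ?S = (UNIV :: (real^'n) set)" "g ` UNIV = ?S"
      "\<And>x. x \<in> ?S \<Longrightarrow> norm (f x) = norm x" "\<And>y. y \<in> UNIV \<Longrightarrow> norm (g y) = norm y"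
      "\<And>x. x \<in> ?S \<Longrightarrow> g (f x) = x" "\<And>y. y \<in> UNIV \<Longrightarrow> f (g y) = y"
    by (rule isometries_subspaces[OF subspace_hyperplane[of b] subspace_UNIV]) (rule that)
  note fg = fg0(1-4) fg0(7) fg0(8)[OF UNIV_I]
  \<comment> \<open>The orthogonal projection along the gradient, followed by an isometry of the
    hyperplane \<open>?S\<close> onto \<open>real^'n\<close>.\<close>
  define L where "L = (\<lambda>x. f (x - ((x \<bullet> b) / (b \<bullet> b)) *\<^sub>R b))"
  have bb: "b \<bullet> b \<noteq> 0" using b0 by simp
  have linL: "linear L"
    unfolding L_def
    by (rule linear_compose[OF _ fg(1), unfolded comp_def]) (intro linearI, simp_all add: inner_add_left add_divide_distrib algebra_simps)
  have gb: "b \<bullet> g u = 0" for u using fg(4) by blast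
  have Lg: "L (g u) = u" for u using gb[of u] by (simp add: L_def inner_commute fg(6))
  have Lb: "L b = 0" using bb by (simp add: L_def linear_0[OF fg(1)])
  have dec: "x = g (L x) + ((x \<bullet> b) / (b \<bullet> b)) *\<^sub>R b" for x
  proof -
    have "x - ((x \<bullet> b) / (b \<bullet> b)) *\<^sub>R b \<in> ?S" using bb by (simp add: inner_diff_right inner_commute)
    from fg(5)[OF this] show ?thesis by (simp add: L_def)
  qed
  define H where "H = (\<lambda>x. (F x, L x))"
  have bL: "bounded_linear L" using linL linear_conv_bounded_linear by blast
  have dH: "(H has_derivative (\<lambda>v. (DF x v, L v))) (at x)" for x
    unfolding H_def by (intro has_derivative_Pair dF bounded_linear_imp_has_derivative[OF bL])
  have CH: "Ck_on (Suc 0) UNIV H"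
  proof (rule Ck_on_SucI[OF open_UNIV dH])
    show "Ck_on 0 UNIV (\<lambda>x. (DF x v, L v))" for v
      using Ck_on_imp_continuous_on[OF CD[of 0 v]] by (simp add: continuous_on_Pair)
  qed
  have injH: "inj (frechet_derivative H (at p))"
  proof -
    have "frechet_derivative H (at p) = (\<lambda>v. (DF p v, L v))" using frechet_derivative_at[OF dH] by simp
    moreover have "v = w" if "DF p v = DF p w" "L v = L w" for v w
      using dec[of v] dec[of w] that by (simp add: Db inner_commute)
    ultimately show ?thesis by (auto intro!: injI)
  qed
  obtain r1 where r1: "r1 > 0" "inj_on H (ball p r1)"
    using locally_injective[OF open_UNIV CH UNIV_I injH] by blast
  have "isCont (\<lambda>x. DF x b) p"
    using Ck_on_imp_continuous_on[OF CD[of 0 b]] continuous_on_eq_continuous_at[OF open_UNIV] by blast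
  moreover have "DF p b \<noteq> 0" using bb by (simp add: Db)
  ultimately obtain r2 where r2: "r2 > 0" "\<And>x. dist p x < r2 \<Longrightarrow> DF x b \<noteq> 0"
    using continuous_at_avoid[of p "\<lambda>x. DF x b" 0] by blast
  define V where "V = ball p (min r1 r2)"
  have V: "open V" "p \<in> V" "inj_on H V" "\<And>x. x \<in> V \<Longrightarrow> DF x b \<noteq> 0"
    using r1 r2 by (auto simp: V_def intro: inj_on_subset)
  have cH: "continuous_on V H" using Ck_on_imp_continuous_on[OF CH] continuous_on_subset by blast
  have oH: "open (H ` V)" by (rule invariance_of_domain[OF cH V(1,3)])
  define G where "G = inv_into V H"
  have GH: "G (H x) = x" if "x \<in> V" for x unfolding G_def using V(3) that by simp
  \<comment> \<open>Inverts \<open>v \<mapsto> (DF x v, L v)\<close>: since \<open>L b = 0\<close>,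
    the coefficient of \<open>b\<close> is free to match the first component. This divides by
    \<open>DF x b\<close>, whence the radius \<open>r2\<close>.\<close>
  define G' where "G' = (\<lambda>x w. g (snd w) + ((fst w - DF x (g (snd w))) / DF x b) *\<^sub>R b)"
  have dG: "(G has_derivative G' x) (at (H x))" if "x \<in> V" for x
  proof (rule has_derivative_inverse_strong[OF V(1) that cH GH dH])
    show "(\<lambda>v. (DF x v, L v)) \<circ> G' x = id"
      using V(4)[OF that]
      by (auto simp: fun_eq_iff G'_def linear_add[OF linD] linear_cmul[OF linD] linear_add[OF linL] linear_cmul[OF linL] Lg Lb)
  qed
  have GV: "G y \<in> V" "H (G y) = y" if "y \<in> H ` V" for y
    using that unfolding G_def by (auto simp: inv_into_into f_inv_into_f)
  \<comment> \<open>A bootstrap: the derivative of \<open>G\<close> is a smooth expression in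
    \<open>G\<close> itself, so each order of differentiability yields the next.\<close>
  have CG: "Ck_on k (H ` V) G" for k
  proof (induction k)
    case 0
    have "isCont G y" if "y \<in> H ` V" for y
      using has_derivative_continuous[OF dG[OF GV(1)[OF that]]] GV(2)[OF that] by simp
    then show ?case by (simp add: continuous_at_imp_continuous_on)
  next
    case (Suc k)
    show ?case
    proof (rule Ck_on_SucI[OF oH])
      show "(G has_derivative G' (G y)) (at y)" if "y \<in> H ` V" for y
        using dG[OF GV(1)[OF that]] GV(2)[OF that] by simp
      fix w
      have "Ck_on k (H ` V) (\<lambda>y. DF (G y) v)" for v
        using Ck_on_compose[OF oH open_UNIV Suc CD[of k v]] by simp
      then show "Ck_on k (H ` V) (\<lambda>y. G' (G y) w)"
        unfolding G'_def using V(4) GV(1)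
        by (intro Ck_on_add Ck_on_scaleR Ck_on_divide Ck_on_diff Ck_on_const oH) auto
    qed
  qed
  define \<psi> where "\<psi> = (\<lambda>u. G (0, u))"
  let ?O = "L ` {x\<in>V. F x = 0}"
  have O: "?O = (\<lambda>u. (0, u)) -` (H ` V)" by (auto simp: H_def image_iff)
  have bl0: "bounded_linear (\<lambda>u :: real^'n. (0 :: real, u))" by (intro bounded_linear_Pair bounded_linear_zero bounded_linear_ident)
  have oO: "open ?O" unfolding O by (intro open_vimage oH linear_continuous_on bl0)
  have "Ck_on k ?O \<psi>" for k
    unfolding \<psi>_def
    by (rule Ck_on_compose[OF oO oH Ck_on_bounded_linear[OF bl0] CG]) (use O in auto)
  moreover have "\<psi> (L x) = x" if "x \<in> V" "F x = 0" for x
    using GH[OF that(1)] that(2) by (simp add: \<psi>_def H_def)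
  moreover have "(\<psi> has_derivative (\<lambda>v. G' p (0, v))) (at (L p))"
  proof -
    have "(G has_derivative G' p) (at (0, L p))" using dG[OF V(2)] Fp by (simp add: H_def)
    then show ?thesis unfolding \<psi>_def
      by (rule has_derivative_compose[OF bounded_linear_imp_has_derivative[OF bl0]])
  qed
  moreover have "G' p (0, v) = g v" for v by (simp add: G'_def Db gb)
  moreover have "L (g v) = v \<and> frechet_derivative F (at p) (g v) = 0" for v
    using Lg Db[of "g v"] gb by (simp add: DF_def)
  ultimately show ?thesis using V(1,2) bL oO
    by (intro exI[of _ V] exI[of _ L] exI[of _ \<psi>] exI[of _ g]) (simp only: simp_thms, blast)
qed

section \<open>Zero sets as closed manifolds\<close>

lemma Hausdorff_second_countable_euclidean_subspace:
  fixes M :: "'a::euclidean_space set"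
  shows "Hausdorff_space (top_of_set M)" "second_countable (top_of_set M)"
proof -
  show "Hausdorff_space (top_of_set M)" by (rule Hausdorff_space_subtopology) simp
  have "second_countable (euclidean :: 'a topology)"
  proof -
    obtain B :: "'a set set" where B: "countable B" "topological_basis B" using ex_countable_basis by blast
    have "\<forall>U\<in>B. open U" using B(2) topological_basis_open by blast
    moreover have "\<exists>V\<in>B. x \<in> V \<and> V \<subseteq> U" if "open U" "x \<in> U" for U x
      using topological_basisE[OF B(2) that] by metis
    ultimately show ?thesis using B(1) unfolding second_countable_def by (intro exI[of _ B]) simp
  qed
  then show "second_countable (top_of_set M)" by (rule second_countable_subtopology)
qed

lemma ex_injection_into_sequences: "\<exists>f :: 'a::euclidean_space \<Rightarrow> nat \<Rightarrow> real. inj f"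
proof (intro exI injI)
  fix x y :: 'a
  \<comment> \<open>Past the dimension \<open>from_nat_into\<close> falls back to a default basis
    vector; only the positions \<open>to_nat_on Basis b\<close> are read below.\<close>
  assume eq: "(\<lambda>n. x \<bullet> from_nat_into Basis n) = (\<lambda>n. y \<bullet> from_nat_into Basis n)"
  show "x = y"
  proof (rule euclidean_eqI)
    fix b :: 'a assume "b \<in> Basis"
    then have "from_nat_into Basis (to_nat_on Basis b) = b" by (simp add: countable_finite)
    then show "x \<bullet> b = y \<bullet> b" using fun_cong[OF eq, of "to_nat_on Basis b"] by simp
  qed
qed

lemma smooth_on_cong_open:
  "open S \<Longrightarrow> (\<And>x. x \<in> S \<Longrightarrow> f x = g x) \<Longrightarrow> smooth_on S f \<Longrightarrow> smooth_on S g"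
  unfolding smooth_on_def using Ck_on_cong_open by blast

text \<open>The zero set of \<open>F\<close>, copied into the type of real sequences by \<open>enc\<close>.\<close>

locale hypersurface =
  fixes F :: "real \<times> (real^'n::finite) \<Rightarrow> real" and enc :: "real \<times> (real^'n) \<Rightarrow> nat \<Rightarrow> real"
  assumes smooth: "Ck_on k UNIV F"
    and regular: "F x = 0 \<Longrightarrow> frechet_derivative F (at x) \<noteq> (\<lambda>_. 0)"
    and compact: "compact {x. F x = 0}" and connected: "connected {x. F x = 0}"
    and enc: "inj enc"
begin

abbreviation M where "M \<equiv> {x. F x = 0}"

definition dec where "dec = inv enc"

lemma dec_enc [simp]: "dec (enc x) = x"
  unfolding dec_def using enc by simp

text \<open>The topology is transported from \<open>M\<close>, not inherited from the space of
  sequences, so that any injection \<open>enc\<close> is a homeomorphism onto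
  \<open>X\<close>.\<close>

definition X :: "(nat \<Rightarrow> real) topology" where
  "X = pullback_topology (enc ` M) dec (top_of_set M)"

lemma topspace_X: "topspace X = enc ` M"
  by (auto simp: X_def topspace_pullback_topology)

lemma homeomorphic_maps_X: "homeomorphic_maps X (top_of_set M) dec enc"
proof -
  have "continuous_map X (top_of_set M) (id \<circ> dec)"
    unfolding X_def by (rule continuous_map_pullback) simp
  moreover have "continuous_map (top_of_set M) X enc"
    unfolding X_def by (rule continuous_map_pullback') (auto simp: comp_def)
  ultimately show ?thesis
    by (auto simp: homeomorphic_maps_def topspace_X)
qed

lemma X_properties: "Hausdorff_space X" "second_countable X" "compact_space X" "connected_space X"
proof -
  have h: "X homeomorphic_space top_of_set M"
    using homeomorphic_maps_X unfolding homeomorphic_space_def by blast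
  show "Hausdorff_space X"
    using homeomorphic_Hausdorff_space[OF h] Hausdorff_second_countable_euclidean_subspace(1) by blast
  show "second_countable X"
    using homeomorphic_space_second_countability[OF h] Hausdorff_second_countable_euclidean_subspace(2) by blast
  show "compact_space X"
    using homeomorphic_compact_space[OF h] compact by (simp add: compact_space_subtopology)
  show "connected_space X"
    using homeomorphic_connected_space[OF h] connected by (simp add: connected_space_subtopology)
qed

text \<open>Names the conclusion of \<open>implicit_chart\<close>: \<open>\<psi>\<close>
  parametrizes the zero set inside \<open>V\<close>, and its derivative \<open>R\<close> at
  \<open>L p\<close> takes values in the tangent space, the kernel of the derivative of
  \<open>F\<close>.\<close>

definition slice_chart where
  "slice_chart p V (L :: real \<times> (real^'n) \<Rightarrow> real^'n) \<psi> R \<longleftrightarrow> open V \<and> p \<in> V \<and> bounded_linear L \<and>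
     open (L ` {x\<in>V. F x = 0}) \<and> (\<forall>x\<in>V. F x = 0 \<longrightarrow> \<psi> (L x) = x) \<and>
     (\<forall>k. Ck_on k (L ` {x\<in>V. F x = 0}) \<psi>) \<and> (\<psi> has_derivative R) (at (L p)) \<and>
     (\<forall>v. L (R v) = v \<and> frechet_derivative F (at p) (R v) = 0)"

definition transported_chart :: "(real \<times> (real^'n)) set \<Rightarrow> (real \<times> (real^'n) \<Rightarrow> real^'n) \<Rightarrow> (nat \<Rightarrow> real, 'n) chart" where
  "transported_chart V L = (enc ` {x\<in>V. F x = 0}, L \<circ> dec)"

definition atlas :: "(nat \<Rightarrow> real, 'n) chart set" where
  "atlas = {transported_chart V L | V L. \<exists>p \<psi> R. slice_chart p V L \<psi> R}"

lemma ex_slice_chart: "F p = 0 \<Longrightarrow> \<exists>V L \<psi> R. slice_chart p V L \<psi> R"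
  unfolding slice_chart_def by (rule implicit_chart[OF smooth _ regular])

lemma transported_chart_image:
  "fst (transported_chart V L) = enc ` {x\<in>V. F x = 0}"
  "snd (transported_chart V L) ` fst (transported_chart V L) = L ` {x\<in>V. F x = 0}"
  by (auto simp: transported_chart_def image_image)

lemma inv_transported_chart:
  assumes "slice_chart p V L \<psi> R" "u \<in> L ` {x\<in>V. F x = 0}"
  shows "inv_into (fst (transported_chart V L)) (snd (transported_chart V L)) u = enc (\<psi> u)"
    "\<psi> u \<in> V" "F (\<psi> u) = 0" "L (\<psi> u) = u"
proof -
  obtain x where x: "x \<in> V" "F x = 0" "u = L x" using assms(2) by blast
  have px: "\<psi> (L y) = y" if "y \<in> V" "F y = 0" for y using assms(1) that unfolding slice_chart_def by blast
  show "\<psi> u \<in> V" "F (\<psi> u) = 0" "L (\<psi> u) = u" using px[OF x(1,2)] x by auto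
  show "inv_into (fst (transported_chart V L)) (snd (transported_chart V L)) u = enc (\<psi> u)"
  proof (rule inv_into_f_eq)
    show "inj_on (snd (transported_chart V L)) (fst (transported_chart V L))"
      using px by (intro inj_on_inverseI[of _ "\<lambda>u. enc (\<psi> u)"]) (auto simp: transported_chart_def)
    show "enc (\<psi> u) \<in> fst (transported_chart V L)" "snd (transported_chart V L) (enc (\<psi> u)) = u"
      using px[OF x(1,2)] x by (auto simp: transported_chart_def)
  qed
qed

lemma is_chart_transported:
  assumes "slice_chart p V L \<psi> R" shows "is_chart X (transported_chart V L)"
proof -
  let ?U = "enc ` {x\<in>V. F x = 0}" and ?D = "L ` {x\<in>V. F x = 0}"
  have sc: "open V" "bounded_linear L" "open ?D" "\<And>x. x \<in> V \<Longrightarrow> F x = 0 \<Longrightarrow> \<psi> (L x) = x" "Ck_on 0 ?D \<psi>"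
    using assms unfolding slice_chart_def by blast+
  have "?U = dec -` (M \<inter> V) \<inter> enc ` M" by auto
  then have "openin X ?U"
    unfolding X_def openin_pullback_topology using openin_open_Int[OF sc(1), of M] by blast
  moreover have "homeomorphic_maps (subtopology X ?U) (top_of_set ?D) (L \<circ> dec) (enc \<circ> \<psi>)"
    unfolding homeomorphic_maps_def
  proof (intro conjI ballI)
    have "continuous_map X euclidean dec"
      using homeomorphic_maps_X continuous_map_into_fulltopology unfolding homeomorphic_maps_def by blast
    then have "continuous_map X euclidean (L \<circ> dec)"
      by (rule continuous_map_compose) (simp add: linear_continuous_on[OF sc(2)])
    then show "continuous_map (subtopology X ?U) (top_of_set ?D) (L \<circ> dec)"
      by (intro continuous_map_into_subtopology continuous_map_from_subtopology) auto
    have "continuous_map (top_of_set ?D) (top_of_set M) \<psi>"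
      using sc(4,5) by (auto simp: continuous_map_in_subtopology)
    then have "continuous_map (top_of_set ?D) X (enc \<circ> \<psi>)"
      by (rule continuous_map_compose) (use homeomorphic_maps_X in \<open>simp add: homeomorphic_maps_def\<close>)
    then show "continuous_map (top_of_set ?D) (subtopology X ?U) (enc \<circ> \<psi>)"
      using sc(4) by (intro continuous_map_into_subtopology) auto
  qed (use sc(4) in auto)
  then have "homeomorphic_map (subtopology X ?U) (top_of_set ?D) (L \<circ> dec)"
    unfolding homeomorphic_map_maps by blast
  ultimately show ?thesis
    unfolding is_chart_def case_prod_unfold transported_chart_image
    using sc(3) by (simp add: transported_chart_def image_image)
qed

lemma atlas_cover: "(\<Union>c\<in>atlas. fst c) = topspace X"
proof
  show "(\<Union>c\<in>atlas. fst c) \<subseteq> topspace X"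
    unfolding atlas_def topspace_X by (auto simp: transported_chart_def)
  show "topspace X \<subseteq> (\<Union>c\<in>atlas. fst c)"
  proof
    fix y assume "y \<in> topspace X"
    then obtain p where p: "F p = 0" "y = enc p" unfolding topspace_X by blast
    then obtain V L \<psi> R where sc: "slice_chart p V L \<psi> R" using ex_slice_chart by blast
    then have "transported_chart V L \<in> atlas" unfolding atlas_def by blast
    moreover have "y \<in> fst (transported_chart V L)"
      using sc p unfolding slice_chart_def transported_chart_def by simp
    ultimately show "y \<in> (\<Union>c\<in>atlas. fst c)" by blast
  qed
qed

text \<open>In coordinates \<open>T\<close> is \<open>L' \<circ> G \<circ> \<psi>\<close> with
  \<open>G\<close> smooth on the ambient space. The identity for \<open>G\<close> gives the
  coordinate changes, and an involution of the ambient space gives the action.\<close>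

lemma smooth_local_rep:
  assumes c: "slice_chart p V L \<psi> R" and d: "slice_chart q V' L' \<psi>' R'"
    and G: "\<And>k. Ck_on k UNIV G" "\<And>x. F x = 0 \<Longrightarrow> F (G x) = 0"
    and T: "\<And>x. F x = 0 \<Longrightarrow> T (enc x) = enc (G x)"
  shows "smooth_on (local_dom (transported_chart V L) (transported_chart V' L') T)
     (local_rep (transported_chart V L) (transported_chart V' L') T)"
proof -
  let ?D = "L ` {x\<in>V. F x = 0}"
  let ?W = "local_dom (transported_chart V L) (transported_chart V' L') T"
  have sc: "open V'" "bounded_linear L'" "open ?D" "\<And>k. Ck_on k ?D \<psi>" "\<And>x. x \<in> V \<Longrightarrow> F x = 0 \<Longrightarrow> \<psi> (L x) = x"
    using c d unfolding slice_chart_def by blast+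
  note inv = inv_transported_chart[OF c]
  have CG: "Ck_on k ?D (\<lambda>u. G (\<psi> u))" for k
    using Ck_on_compose[OF sc(3) open_UNIV sc(4) G(1)] by simp
  have mem: "T (enc x) \<in> fst (transported_chart V' L') \<longleftrightarrow> G x \<in> V'" if "F x = 0" for x
    using that T[OF that] G(2)[OF that] inj_image_mem_iff[OF enc] by (simp add: transported_chart_image)
  have W: "?W = ?D \<inter> (\<lambda>u. G (\<psi> u)) -` V'"
  proof -
    let ?S = "{x\<in>V. F x = 0 \<and> G x \<in> V'}"
    have "{y \<in> fst (transported_chart V L). T y \<in> fst (transported_chart V' L')} = enc ` ?S"
      unfolding transported_chart_image(1)[of V L] using mem by blast
    then have "?W = L ` ?S"
      unfolding local_dom_def by (simp add: transported_chart_def image_image)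
    also have "\<dots> = ?D \<inter> (\<lambda>u. G (\<psi> u)) -` V'"
    proof (intro set_eqI iffI)
      fix u assume "u \<in> L ` ?S"
      then obtain x where "x \<in> V" "F x = 0" "G x \<in> V'" "u = L x" by blast
      then show "u \<in> ?D \<inter> (\<lambda>u. G (\<psi> u)) -` V'" using sc(5)[of x] by simp
    next
      fix u assume u: "u \<in> ?D \<inter> (\<lambda>u. G (\<psi> u)) -` V'"
      then obtain x where "x \<in> V" "F x = 0" "u = L x" by blast
      then show "u \<in> L ` ?S" using u sc(5)[of x] by simp
    qed
    finally show ?thesis .
  qed
  have oW: "open ?W"
    unfolding W using continuous_open_preimage[OF Ck_on_imp_continuous_on[OF CG[of 0]] sc(3,1)] .
  have eq: "local_rep (transported_chart V L) (transported_chart V' L') T u = L' (G (\<psi> u))" if "u \<in> ?D" for u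
    unfolding local_rep_def comp_def inv(1)[OF that] T[OF inv(3)[OF that]]
    by (simp add: transported_chart_def)
  have "Ck_on k ?W (\<lambda>u. L' (G (\<psi> u)))" for k
    using Ck_on_subset[OF Ck_on_linear_comp[OF sc(3,2) CG]] W by blast
  then have "smooth_on ?W (\<lambda>u. L' (G (\<psi> u)))" by (simp add: smooth_on_def)
  then show ?thesis by (rule smooth_on_cong_open[OF oW, rotated]) (simp add: W eq)
qed

lemma closed_connected_manifold_X: "closed_connected_manifold X atlas"
proof -
  have "smooth_on (local_dom c d id) (local_rep c d id)" if cd: "c \<in> atlas" "d \<in> atlas" for c d
  proof -
    obtain V L p \<psi> R V' L' p' \<psi>' R' where "c = transported_chart V L" "slice_chart p V L \<psi> R"
      "d = transported_chart V' L'" "slice_chart p' V' L' \<psi>' R'" using cd unfolding atlas_def by blast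
    then show ?thesis by (auto intro!: smooth_local_rep[where G = "\<lambda>x. x"])
  qed
  then show ?thesis
    unfolding closed_connected_manifold_def smooth_manifold_def
    using X_properties atlas_cover is_chart_transported by (auto simp: atlas_def)
qed

lemma smooth_self_map_X:
  assumes G: "\<And>k. Ck_on k UNIV G" "\<And>x. F x = 0 \<Longrightarrow> F (G x) = 0"
    and T: "\<And>x. F x = 0 \<Longrightarrow> T (enc x) = enc (G x)"
  shows "smooth_self_map X atlas T"
  unfolding smooth_self_map_def
proof (intro conjI ballI)
  have "continuous_map (top_of_set M) (top_of_set M) G"
    using continuous_on_subset[OF Ck_on_imp_continuous_on[OF G(1)[of 0]] subset_UNIV] G(2)
    by (auto simp: continuous_map_in_subtopology)
  then have "continuous_map X X (enc \<circ> (G \<circ> dec))"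
    using homeomorphic_maps_X unfolding homeomorphic_maps_def by (blast intro: continuous_map_compose)
  then show "continuous_map X X T"
    by (rule continuous_map_eq) (auto simp: topspace_X T)
  fix c d assume cd: "c \<in> atlas" "d \<in> atlas"
  obtain V L p \<psi> R V' L' p' \<psi>' R' where "c = transported_chart V L" "slice_chart p V L \<psi> R"
      "d = transported_chart V' L'" "slice_chart p' V' L' \<psi>' R'" using cd unfolding atlas_def by blast
  then show "smooth_on (local_dom c d T) (local_rep c d T)" using smooth_local_rep[OF _ _ G T] by blast
qed

text \<open>For linear \<open>G\<close> the chain rule yields \<open>G\<close> on the tangent space,
  read in coordinates through \<open>R\<close> and its left inverse \<open>L\<close>.\<close>

lemma local_rep_derivative:
  assumes c: "slice_chart p V L \<psi> R" and p: "F p = 0"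
    and G: "bounded_linear G" "\<And>x. F x = 0 \<Longrightarrow> F (G x) = 0"
    and T: "\<And>x. F x = 0 \<Longrightarrow> T (enc x) = enc (G x)"
  shows "frechet_derivative (local_rep (transported_chart V L) (transported_chart V L) T)
     (at (snd (transported_chart V L) (enc p))) = (\<lambda>v. L (G (R v)))"
proof -
  let ?D = "L ` {x\<in>V. F x = 0}"
  have sc: "open ?D" "bounded_linear L" "(\<psi> has_derivative R) (at (L p))" "p \<in> V"
    using c unfolding slice_chart_def by blast+
  have eq: "local_rep (transported_chart V L) (transported_chart V L) T u = L (G (\<psi> u))" if "u \<in> ?D" for u
    unfolding local_rep_def comp_def inv_transported_chart(1)[OF c that] T[OF inv_transported_chart(3)[OF c that]]
    by (simp add: transported_chart_def)
  have "L p \<in> ?D" using sc(4) p by blast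
  have "((\<lambda>u. L (G (\<psi> u))) has_derivative (\<lambda>v. L (G (R v)))) (at (L p))"
    using bounded_linear.has_derivative[OF sc(2) bounded_linear.has_derivative[OF G(1) sc(3)]] .
  then have "(local_rep (transported_chart V L) (transported_chart V L) T has_derivative (\<lambda>v. L (G (R v)))) (at (L p))"
    by (rule has_derivative_transform_within_open[OF _ sc(1) \<open>L p \<in> ?D\<close>]) (simp add: eq)
  from frechet_derivative_at[OF this, symmetric]
  show ?thesis by (simp add: transported_chart_def)
qed

end

text \<open>The standard basis, relabelled by the edges. Any basis consists of eigenvectors here,
  since the differentials at a fixed point will be \<open>1\<close> and \<open>-1\<close>.\<close>

lemma ex_eigenbasis:
  assumes "finite S" "card S = CARD('n::finite)"
  obtains b :: "'e \<Rightarrow> real^'n" where "inj_on b S" "independent (b ` S)" "span (b ` S) = UNIV"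
proof -
  have "card (Basis :: (real^'n) set) = card S" using assms(2) by simp
  then obtain b where b: "bij_betw b S (Basis :: (real^'n) set)"
    using finite_same_card_bij[OF assms(1) finite_Basis] by metis
  then have "b ` S = Basis" "inj_on b S" by (auto simp: bij_betw_def)
  then show ?thesis using that independent_Basis span_Basis by metis
qed

text \<open>All fixed points carry the same tangent representation, so any bijection from the
  vertices onto them serves as the labelling. By \<open>tan\<close> the involution is
  \<open>-1\<close> on the kernel of the derivative of \<open>F\<close>, which is where
  \<open>R\<close> takes its values; its differential in the chart is therefore \<open>-1\<close>
  too.\<close>

lemma (in hypersurface) colored_graph_of_involution:
  fixes \<Gamma> :: "('v, 'e) multigraph" and \<alpha> :: "'e \<Rightarrow> bit \<Rightarrow> bit"
  assumes g: "bounded_linear g" "\<And>x. g (g x) = x" "\<And>x. F (g x) = F x"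
    and fin: "finite {x. F x = 0 \<and> g x = x}" and eff: "F x0 = 0" "g x0 \<noteq> x0"
    and tan: "\<And>p v. F p = 0 \<Longrightarrow> g p = p \<Longrightarrow> frechet_derivative F (at p) v = 0 \<Longrightarrow> g v = - v"
    and sk: "abstract_1_skeleton CARD('n) \<Gamma> \<alpha>"
    and card: "card (verts \<Gamma>) = card {x. F x = 0 \<and> g x = x}"
  shows "is_colored_graph_of_G_action TYPE('n) \<Gamma> \<alpha>"
proof -
  define \<Phi> where "\<Phi> = (\<lambda>a :: bit. if a = 0 then (\<lambda>y. y) else enc \<circ> g \<circ> dec)"
  have \<Phi>0: "\<Phi> 0 (enc x) = enc x" for x by (simp add: \<Phi>_def)
  have \<Phi>1: "\<Phi> 1 (enc x) = enc (g x)" for x by (simp add: \<Phi>_def)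
  let ?P = "{x. F x = 0 \<and> g x = x}"
  have bits: "(\<forall>a :: bit. Q a) \<longleftrightarrow> Q 0 \<and> Q 1" for Q by (metis bit_not_zero_iff)
  have fp: "fixed_points X \<Phi> = enc ` ?P"
    unfolding fixed_points_def topspace_X bits
  proof (intro set_eqI iffI)
    fix y assume "y \<in> {y \<in> enc ` M. \<Phi> 0 y = y \<and> \<Phi> 1 y = y}"
    then obtain x where x: "F x = 0" "y = enc x" "\<Phi> 1 (enc x) = enc x" by blast
    then have "g x = x" by (simp add: \<Phi>1 inj_eq[OF enc])
    then show "y \<in> enc ` ?P" using x by blast
  next
    fix y assume "y \<in> enc ` ?P"
    then obtain x where "F x = 0" "g x = x" "y = enc x" by blast
    then show "y \<in> {y \<in> enc ` M. \<Phi> 0 y = y \<and> \<Phi> 1 y = y}" by (simp add: \<Phi>0 \<Phi>1)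
  qed
  have act: "G_action X atlas \<Phi>"
    unfolding G_action_def
  proof (intro conjI)
    show "closed_connected_manifold X atlas" by (rule closed_connected_manifold_X)
    have "smooth_self_map X atlas (\<Phi> 0)"
      by (rule smooth_self_map_X[where G = "\<lambda>x. x"]) (simp_all add: \<Phi>0)
    moreover have "smooth_self_map X atlas (\<Phi> 1)"
      by (rule smooth_self_map_X[where G = g]) (simp_all add: \<Phi>1 Ck_on_bounded_linear[OF g(1)] g(3))
    ultimately show "\<forall>a. smooth_self_map X atlas (\<Phi> a)" unfolding bits by blast
    show "\<forall>x\<in>topspace X. \<Phi> 0 x = x" by (simp add: \<Phi>_def)
    show "\<forall>a h. \<forall>x\<in>topspace X. \<Phi> (a + h) x = \<Phi> a (\<Phi> h x)"
      unfolding bits topspace_X by (auto simp: \<Phi>0 \<Phi>1 g(2))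
    have "\<Phi> 1 (enc x0) \<noteq> enc x0" using eff(2) enc by (auto simp: \<Phi>1 dest: injD)
    then show "\<forall>a. (\<forall>x\<in>topspace X. \<Phi> a x = x) \<longrightarrow> a = 0"
      unfolding bits topspace_X using eff(1) by blast
    show "finite (fixed_points X \<Phi>)" unfolding fp using fin by simp
  qed
  have "card (verts \<Gamma>) = card (fixed_points X \<Phi>)"
    unfolding fp using card card_image[OF inj_on_subset[OF enc subset_UNIV], of ?P] by simp
  moreover have "finite (verts \<Gamma>)" using sk by (simp add: abstract_1_skeleton_def loopless_finite_graph_def)
  moreover have "finite (fixed_points X \<Phi>)" unfolding fp using fin by simp
  ultimately obtain \<iota> where \<iota>: "bij_betw \<iota> (verts \<Gamma>) (fixed_points X \<Phi>)"
    using finite_same_card_bij by blast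
  have "tangent_rep_given_by atlas \<Phi> (\<iota> q) (edges_at \<Gamma> q) \<alpha>" if q: "q \<in> verts \<Gamma>" for q
  proof -
    have "\<iota> q \<in> enc ` ?P" using bij_betwE[OF \<iota>] q unfolding fp by blast
    then obtain p where p: "F p = 0" "g p = p" "\<iota> q = enc p" by blast
    obtain V L \<psi> R where sc: "slice_chart p V L \<psi> R" using ex_slice_chart[OF p(1)] by blast
    have LR: "L (R v) = v" "frechet_derivative F (at p) (R v) = 0" for v
      using sc unfolding slice_chart_def by blast+
    have linL: "linear L" using sc linear_conv_bounded_linear unfolding slice_chart_def by blast
    let ?c = "transported_chart V L"
    have "p \<in> V" using sc unfolding slice_chart_def by blast
    then have c: "\<iota> q \<in> fst ?c" using p(1) by (simp add: p(3) transported_chart_image)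
    have c': "?c \<in> atlas" using sc unfolding atlas_def by blast
    have "finite (edges_at \<Gamma> q)" "card (edges_at \<Gamma> q) = CARD('n)"
      using sk q by (auto simp: abstract_1_skeleton_def loopless_finite_graph_def regular_graph_def edges_at_def)
    then obtain b :: "'e \<Rightarrow> real^'n" where b: "inj_on b (edges_at \<Gamma> q)" "independent (b ` edges_at \<Gamma> q)"
      "span (b ` edges_at \<Gamma> q) = UNIV" by (rule ex_eigenbasis)
    have D0: "frechet_derivative (local_rep ?c ?c (\<Phi> 0)) (at (snd ?c (\<iota> q))) v = v" for v
      unfolding p(3) using local_rep_derivative[OF sc p(1) bounded_linear_ident, of "\<Phi> 0"] by (simp add: \<Phi>0 LR)
    have D1: "frechet_derivative (local_rep ?c ?c (\<Phi> 1)) (at (snd ?c (\<iota> q))) v = - v" for v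
      unfolding p(3) using local_rep_derivative[OF sc p(1) g(1), of "\<Phi> 1"]
      by (simp add: \<Phi>1 g(3) tan[OF p(1,2) LR(2)] linear_neg[OF linL] LR(1))
    have \<alpha>: "\<alpha> e 0 = 0" "\<alpha> e 1 = 1" if "e \<in> edges_at \<Gamma> q" for e
    proof -
      have *: "\<alpha> e \<in> HomZ2 - {0}" using sk that by (simp add: abstract_1_skeleton_def edges_at_def)
      then show "\<alpha> e 1 = 1" by (rule HomZ2_bit_nonzero)
      show "\<alpha> e 0 = 0" using * additive.zero[of "\<alpha> e"] by (simp add: HomZ2_def)
    qed
    show ?thesis
      unfolding tangent_rep_given_by_def
      using c b by (intro bexI[OF _ c'] conjI exI[of _ b]) (auto simp: bits D0 D1 \<alpha>)
  qed
  then have "colored_graph_of \<Gamma> \<alpha> X atlas \<Phi>" unfolding colored_graph_of_def using sk \<iota> by blast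
  then show ?thesis unfolding is_colored_graph_of_G_action_def using act by blast
qed

section \<open>The double of a ball with holes\<close>

text \<open>The domain \<open>dom\<close> is a large ball with \<open>m\<close> small balls removed along the \<open>j\<close>-th axis;
  the hypersurface \<open>z\<^sup>2 = poly w\<close> is its double.\<close>

locale holed_ball =
  fixes j :: "'n::finite" and m :: nat
begin

abbreviation e :: "real^'n" where "e \<equiv> axis j 1"
text \<open>Index 0 belongs to the outer ball around the origin, indices 1 to \<open>m\<close> to
  unit holes whose neighbouring centers are 4 apart. The last hole ends at \<open>4 m + 1\<close>,
  within the outer radius, and the first begins at 3, so the origin stays in the domain.\<close>

definition radius :: "nat \<Rightarrow> real" where "radius i = (if i = 0 then 4 * real m + 4 else 1)"
definition center :: "nat \<Rightarrow> real^'n" where "center i = (4 * real i) *\<^sub>R e"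
text \<open>The sign makes the value positive on the side of the sphere that belongs to the
  domain.\<close>

definition sphere_eq :: "nat \<Rightarrow> real^'n \<Rightarrow> real" where
  "sphere_eq i w = (if i = 0 then -1 else 1) * ((w - center i) \<bullet> (w - center i) - (radius i)\<^sup>2)"
definition poly where "poly w = (\<Prod>i\<le>m. sphere_eq i w)"
definition F :: "real \<times> (real^'n) \<Rightarrow> real" where "F x = (fst x)\<^sup>2 - poly (snd x)"
definition dom where "dom = {w. \<forall>i\<le>m. sphere_eq i w \<ge> 0}"

lemma radius_pos: "radius i > 0" by (simp add: radius_def add_nonneg_pos)

lemma center_0 [simp]: "center 0 = 0" by (simp add: center_def)

lemma sphere_eq_norm:
  "sphere_eq i w = (if i = 0 then -1 else 1) * ((norm (w - center i))\<^sup>2 - (radius i)\<^sup>2)"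
  by (simp add: sphere_eq_def power2_norm_eq_inner)

lemma sphere_eq_0_nonneg_iff: "sphere_eq 0 w \<ge> 0 \<longleftrightarrow> norm w \<le> radius 0"
  "sphere_eq 0 w > 0 \<longleftrightarrow> norm w < radius 0"
proof -
  have 1: "(norm w)\<^sup>2 \<le> (radius 0)\<^sup>2 \<longleftrightarrow> norm w \<le> radius 0" "(radius 0)\<^sup>2 \<le> (norm w)\<^sup>2 \<longleftrightarrow> radius 0 \<le> norm w"
    using radius_pos[of 0] by (simp_all add: power_mono_iff)
  have "sphere_eq 0 w \<ge> 0 \<longleftrightarrow> (norm w)\<^sup>2 \<le> (radius 0)\<^sup>2" "sphere_eq 0 w > 0 \<longleftrightarrow> \<not> (radius 0)\<^sup>2 \<le> (norm w)\<^sup>2"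
    by (simp_all add: sphere_eq_norm not_le)
  then show "sphere_eq 0 w \<ge> 0 \<longleftrightarrow> norm w \<le> radius 0" "sphere_eq 0 w > 0 \<longleftrightarrow> norm w < radius 0"
    unfolding 1 by (simp_all add: not_le)
qed

lemma sphere_eq_pos_iff:
  assumes "i \<noteq> 0"
  shows "sphere_eq i w \<ge> 0 \<longleftrightarrow> norm (w - center i) \<ge> 1" "sphere_eq i w > 0 \<longleftrightarrow> norm (w - center i) > 1"
proof -
  let ?d = "norm (w - center i)"
  have 1: "1\<^sup>2 \<le> ?d\<^sup>2 \<longleftrightarrow> 1 \<le> ?d" "?d\<^sup>2 \<le> 1\<^sup>2 \<longleftrightarrow> ?d \<le> 1"
    by (rule power_mono_iff; simp)+
  have "sphere_eq i w \<ge> 0 \<longleftrightarrow> 1\<^sup>2 \<le> ?d\<^sup>2" "sphere_eq i w > 0 \<longleftrightarrow> \<not> ?d\<^sup>2 \<le> 1\<^sup>2"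
    using assms by (simp_all add: sphere_eq_norm radius_def not_le)
  then show "sphere_eq i w \<ge> 0 \<longleftrightarrow> ?d \<ge> 1" "sphere_eq i w > 0 \<longleftrightarrow> ?d > 1"
    unfolding 1 by (simp_all add: not_le)
qed

lemma norm_center: "norm (center i) = 4 * real i" by (simp add: center_def)

lemma norm_center_diff: "norm (center i - center k) = 4 * \<bar>real i - real k\<bar>"
proof -
  have "center i - center k = (4 * (real i - real k)) *\<^sub>R e"
    by (simp add: center_def algebra_simps)
  then show ?thesis unfolding norm_scaleR abs_mult by (simp only: norm_scaleR abs_mult) simp
qed

text \<open>By the triangle inequality and the spacing of the centers, a point on or beyond one
  boundary sphere lies strictly on the domain side of all the others.\<close>

lemma sphere_eq_separated:
  assumes "i \<le> m" "k \<le> m" "i \<noteq> k" "sphere_eq i w \<le> 0"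
  shows "sphere_eq k w > 0"
proof (cases "i = 0")
  case True
  have "norm w \<ge> radius 0" using assms(4) sphere_eq_0_nonneg_iff(2)[of w] unfolding True by linarith
  moreover have "norm w \<le> norm (w - center k) + norm (center k)"
    using norm_triangle_ineq[of "w - center k" "center k"] by simp
  ultimately have "norm (w - center k) > 1"
    using assms(2) by (simp add: radius_def norm_center)
  then show ?thesis using assms(3) True sphere_eq_pos_iff(2)[of k w] by simp
next
  case False
  have d: "norm (w - center i) \<le> 1" using assms(4) sphere_eq_pos_iff(2)[OF False, of w] by linarith
  show ?thesis
  proof (cases "k = 0")
    case True
    have "norm w \<le> norm (w - center i) + norm (center i)"
      using norm_triangle_ineq[of "w - center i" "center i"] by simp
    then have "norm w < radius 0" using d assms(1) by (simp add: radius_def norm_center)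
    then show ?thesis using True sphere_eq_0_nonneg_iff(2) by simp
  next
    case k: False
    have "norm (center i - center k) \<le> norm (w - center k) + norm (w - center i)"
      using norm_triangle_ineq4[of "w - center k" "w - center i"] by simp
    moreover have "norm (center i - center k) \<ge> 4"
    proof -
      have "\<bar>real i - real k\<bar> \<ge> 1" using assms(3) by (cases i k rule: linorder_cases) auto
      then show ?thesis unfolding norm_center_diff using mult_left_mono[of 1 "\<bar>real i - real k\<bar>" 4] by simp
    qed
    ultimately have "norm (w - center k) > 1" using d by linarith
    then show ?thesis using sphere_eq_pos_iff(2)[OF k, of w] by simp
  qed
qed

lemma poly_split:
  assumes "i \<le> m" shows "poly w = sphere_eq i w * (\<Prod>k\<in>{..m} - {i}. sphere_eq k w)"
  unfolding poly_def by (rule prod.remove) (use assms in auto)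

lemma rest_pos:
  assumes "i \<le> m" "sphere_eq i w \<le> 0" shows "(\<Prod>k\<in>{..m} - {i}. sphere_eq k w) > 0"
  using sphere_eq_separated[OF assms(1) _ _ assms(2)] by (intro prod_pos) auto

text \<open>Two negative factors could also make the product nonnegative; by separation at most one
  factor fails to be positive.\<close>

lemma poly_nonneg_iff: "poly w \<ge> 0 \<longleftrightarrow> w \<in> dom"
proof
  assume P: "poly w \<ge> 0"
  show "w \<in> dom"
  proof (rule ccontr)
    assume "w \<notin> dom"
    then obtain i where i: "i \<le> m" "sphere_eq i w < 0" unfolding dom_def by (auto simp: not_le)
    then have "poly w < 0"
      using rest_pos[OF i(1), of w] unfolding poly_split[OF i(1)] by (intro mult_neg_pos) auto
    then show False using P by simp
  qed
qed (auto simp: dom_def poly_def intro: prod_nonneg)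

lemma poly_zero: "poly w = 0 \<longleftrightarrow> (\<exists>i\<le>m. sphere_eq i w = 0)"
  unfolding poly_def by auto

section \<open>Smoothness and regularity of the defining function\<close>

lemma Ck_on_sphere_eq: "Ck_on k UNIV (sphere_eq i)"
  unfolding sphere_eq_def[abs_def]
  by (intro Ck_on_mult Ck_on_diff Ck_on_inner Ck_on_const Ck_on_ident open_UNIV)

lemma Ck_on_poly: "Ck_on k UNIV poly"
  unfolding poly_def[abs_def] by (intro Ck_on_prod Ck_on_sphere_eq open_UNIV)

lemma Ck_on_F: "Ck_on k UNIV F"
proof -
  have "Ck_on k UNIV (\<lambda>x :: real \<times> (real^'n). fst x)" "Ck_on k UNIV (\<lambda>x :: real \<times> (real^'n). snd x)"
    by (auto intro!: Ck_on_bounded_linear bounded_linear_fst bounded_linear_snd)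
  then show ?thesis
    unfolding F_def[abs_def]
    by (intro Ck_on_diff Ck_on_power Ck_on_compose[OF open_UNIV open_UNIV _ Ck_on_poly] open_UNIV) auto
qed

lemma poly_has_derivative: "(poly has_derivative frechet_derivative poly (at w)) (at w)"
  using Ck_on_has_derivative[OF Ck_on_poly[of "Suc 0"]] by simp

lemma F_derivative:
  "frechet_derivative F (at x) v = 2 * fst x * fst v - frechet_derivative poly (at (snd x)) (snd v)"
proof -
  have s: "((\<lambda>x :: real \<times> (real^'n). poly (snd x)) has_derivative (\<lambda>v. frechet_derivative poly (at (snd x)) (snd v))) (at x)"
    by (rule has_derivative_compose[OF bounded_linear_imp_has_derivative[OF bounded_linear_snd] poly_has_derivative])
  have "((\<lambda>x :: real \<times> (real^'n). (fst x)\<^sup>2) has_derivative (\<lambda>v. 2 * fst x * fst v)) (at x)"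
    by (auto intro!: derivative_eq_intros)
  from has_derivative_diff[OF this s]
  have "(F has_derivative (\<lambda>v. 2 * fst x * fst v - frechet_derivative poly (at (snd x)) (snd v))) (at x)"
    by (simp add: F_def[abs_def])
  from frechet_derivative_at[OF this, symmetric] show ?thesis by simp
qed

text \<open>Where one factor vanishes, the product rule leaves its derivative times the other
  factors, which are positive there. The gradient is thus a nonzero multiple of
  \<open>w - center i\<close>.\<close>

lemma poly_derivative_at_zero:
  assumes i: "i \<le> m" "sphere_eq i w = 0"
  obtains c where "c \<noteq> 0" "\<And>v. frechet_derivative poly (at w) v = c * ((w - center i) \<bullet> v)"
proof -
  let ?rest = "\<lambda>w. \<Prod>k\<in>{..m} - {i}. sphere_eq k w"
  let ?s = "if i = 0 then -1 else 1 :: real"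
  have "Ck_on (Suc 0) UNIV ?rest" by (intro Ck_on_prod Ck_on_sphere_eq open_UNIV)
  from Ck_on_has_derivative[OF this]
  have r: "(?rest has_derivative frechet_derivative ?rest (at w)) (at w)" by simp
  have q: "(sphere_eq i has_derivative (\<lambda>v. ?s * (2 * ((w - center i) \<bullet> v)))) (at w)"
    unfolding sphere_eq_def[abs_def]
    by (rule has_derivative_mult_right) (auto intro!: derivative_eq_intros simp: inner_commute)
  have "(poly has_derivative (\<lambda>v. sphere_eq i w * frechet_derivative ?rest (at w) v + ?s * (2 * ((w - center i) \<bullet> v)) * ?rest w)) (at w)"
  proof -
    have p: "poly = (\<lambda>w. sphere_eq i w * ?rest w)" using poly_split[OF i(1)] by (intro ext)
    show ?thesis unfolding p by (rule has_derivative_mult[OF q r])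
  qed
  from frechet_derivative_at[OF this, symmetric]
  have D: "frechet_derivative poly (at w) v = (?s * 2 * ?rest w) * ((w - center i) \<bullet> v)" for v
    by (simp add: i(2))
  have "?rest w > 0" using rest_pos[OF i(1)] i(2) by simp
  moreover have "?s * 2 * y \<noteq> 0" if "y > 0" for y :: real using that by simp
  ultimately have "?s * 2 * ?rest w \<noteq> 0" by blast
  then show ?thesis using D by (rule that)
qed

lemma center_distance:
  assumes "sphere_eq i w = 0" shows "(w - center i) \<bullet> (w - center i) = (radius i)\<^sup>2"
  using assms by (simp add: sphere_eq_def split: if_splits)

text \<open>Off \<open>fst x = 0\<close> the derivative in the first coordinate is nonzero. On it,
  the derivative is nonzero in the radial direction of the boundary sphere through
  \<open>snd x\<close>.\<close>

lemma F_regular: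
  assumes "F x = 0" shows "frechet_derivative F (at x) \<noteq> (\<lambda>_. 0)"
proof (cases "fst x = 0")
  case False
  have "frechet_derivative poly (at (snd x)) 0 = 0"
    using has_derivative_linear[OF poly_has_derivative] by (rule linear_0)
  then have "frechet_derivative F (at x) (1, 0) = 2 * fst x" by (simp add: F_derivative)
  then show ?thesis using False by auto
next
  case True
  then have "poly (snd x) = 0" using assms by (simp add: F_def)
  then obtain i where i: "i \<le> m" "sphere_eq i (snd x) = 0" using poly_zero by blast
  obtain c where c: "c \<noteq> 0" "\<And>v. frechet_derivative poly (at (snd x)) v = c * ((snd x - center i) \<bullet> v)"
    by (rule poly_derivative_at_zero[OF i]) blast
  have "frechet_derivative F (at x) (0, snd x - center i) = - (c * (radius i)\<^sup>2)"
    by (simp add: F_derivative c(2) center_distance[OF i(2)])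
  then show ?thesis using c(1) radius_pos[of i] by auto
qed

section \<open>Compactness and connectedness of the double\<close>

lemma dom_bounded: "w \<in> dom \<Longrightarrow> norm w \<le> radius 0"
  using sphere_eq_0_nonneg_iff(1)[of w] by (auto simp: dom_def)

lemma compact_dom: "compact dom"
proof -
  have "dom = poly -` {0..}" using poly_nonneg_iff by auto
  moreover have "closed (poly -` {0..})"
    using Ck_on_imp_continuous_on[OF Ck_on_poly[of 0]] by (intro continuous_closed_vimage) (auto simp: continuous_on_eq_continuous_at)
  moreover have "bounded dom" using dom_bounded by (auto simp: bounded_iff)
  ultimately show ?thesis by (simp add: compact_eq_bounded_closed)
qed

lemma sphere_subset_dom: "sphere 0 (radius 0) \<subseteq> dom"
proof
  fix w :: "real^'n" assume "w \<in> sphere 0 (radius 0)"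
  then have "sphere_eq 0 w = 0" by (simp add: sphere_eq_norm)
  then have "sphere_eq k w \<ge> 0" if "k \<le> m" for k
    using sphere_eq_separated[of 0 k w] that by (cases "k = 0") auto
  then show "w \<in> dom" by (simp add: dom_def)
qed

text \<open>Moving away from the axis never enters a hole, so every point is joined to the outer sphere.\<close>

lemma connected_dom:
  assumes "m = 0 \<or> CARD('n) \<ge> 2" shows "connected dom"
proof (cases "m = 0")
  case True
  have Q: "(\<forall>i\<le>m. Q i) \<longleftrightarrow> Q 0" for Q using True by simp
  have "dom = {w. sphere_eq 0 w \<ge> 0}" unfolding dom_def by (simp only: Q)
  also have "\<dots> = cball 0 (radius 0)" unfolding sphere_eq_0_nonneg_iff(1) by auto
  finally show ?thesis by (simp only: connected_cball)
next
  case False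
  then have "CARD('n) \<ge> 2" using assms by blast
  have "\<exists>j'. j' \<noteq> j"
  proof (rule ccontr)
    assume "\<not> ?thesis"
    then have "UNIV = {j}" by auto
    then have "CARD('n) = card {j}" by simp
    then show False using \<open>CARD('n) \<ge> 2\<close> by simp
  qed
  then obtain j' where "j' \<noteq> j" by blast
  define e' :: "real^'n" where "e' = axis j' 1"
  have e': "norm e' = 1" "e \<bullet> e' = 0" using \<open>j' \<noteq> j\<close> by (auto simp: e'_def inner_axis_axis)
  let ?S = "sphere (0 :: real^'n) (radius 0)"
  have cS: "connected ?S" using \<open>CARD('n) \<ge> 2\<close> by (intro connected_sphere) simp
  have "\<exists>C. connected C \<and> C \<subseteq> dom \<and> w \<in> C \<and> ?S \<subseteq> C" if w: "w \<in> dom" for w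
  proof -
    \<comment> \<open>A unit vector orthogonal to the axis. With this sign, moving along it does not
      decrease the distance to any center, since all centers lie on the axis.\<close>
    define u where "u = (if w \<bullet> e' \<ge> 0 then e' else - e')"
    have u: "norm u = 1" "e \<bullet> u = 0" "w \<bullet> u \<ge> 0" using e' by (auto simp: u_def)
    have "norm (w + 0 *\<^sub>R u) \<le> radius 0" using dom_bounded[OF w] by simp
    \<comment> \<open>A step of twice the radius reaches or passes the outer sphere, because
      \<open>norm w\<close> is at most the radius.\<close>
    moreover have "radius 0 \<le> norm (w + (2 * radius 0) *\<^sub>R u)"
    proof -
      have "norm ((2 * radius 0) *\<^sub>R u) \<le> norm (w + (2 * radius 0) *\<^sub>R u) + norm w"
        using norm_triangle_ineq4[of "w + (2 * radius 0) *\<^sub>R u" w] by simp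
      then show ?thesis using dom_bounded[OF w] u(1) radius_pos[of 0] by simp
    qed
    moreover have "continuous_on {0..2 * radius 0} (\<lambda>t. norm (w + t *\<^sub>R u))" by (intro continuous_intros)
    ultimately have "\<exists>t\<ge>0. t \<le> 2 * radius 0 \<and> norm (w + t *\<^sub>R u) = radius 0"
      using radius_pos[of 0] by (intro IVT') auto
    then obtain t where t: "t \<ge> 0" "norm (w + t *\<^sub>R u) = radius 0" by blast
    let ?seg = "closed_segment w (w + t *\<^sub>R u)"
    have "?seg \<subseteq> dom"
    proof
      fix x assume x: "x \<in> ?seg"
      then obtain s where s: "0 \<le> s" "s \<le> 1" "x = (1 - s) *\<^sub>R w + s *\<^sub>R (w + t *\<^sub>R u)"
        by (auto simp: in_segment)
      then have xw: "x = w + (s * t) *\<^sub>R u" by (simp add: algebra_simps)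
      have "?seg \<subseteq> cball 0 (radius 0)"
        using t(2) dom_bounded[OF w] by (intro closed_segment_subset) auto
      then have s0: "sphere_eq 0 x \<ge> 0" using x sphere_eq_0_nonneg_iff(1) by auto
      have sk: "sphere_eq k x \<ge> 0" if "k \<le> m" "k \<noteq> 0" for k
      proof -
        have "center k \<bullet> u = 0" using u(2) by (simp add: center_def)
        then have "(x - center k) \<bullet> (x - center k) = (w - center k) \<bullet> (w - center k) + 2 * (s * t) * (w \<bullet> u) + (s * t)\<^sup>2 * (u \<bullet> u)"
          by (simp add: xw inner_add_left inner_add_right inner_diff_left inner_diff_right inner_commute algebra_simps power2_eq_square)
        then have "(x - center k) \<bullet> (x - center k) \<ge> (w - center k) \<bullet> (w - center k)"
          using s(1) t(1) u(3) by simp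
        moreover have "sphere_eq k w \<ge> 0" using w that(1) by (simp add: dom_def)
        ultimately show ?thesis using that(2) by (simp add: sphere_eq_def)
      qed
      have "sphere_eq k x \<ge> 0" if "k \<le> m" for k
        using s0 sk[OF that] by (cases "k = 0") simp_all
      then show "x \<in> dom" by (simp add: dom_def)
    qed
    moreover have "connected (?seg \<union> ?S)"
      using t(2) by (intro connected_Un cS connected_segment) (auto simp: disjoint_iff intro!: exI[of _ "w + t *\<^sub>R u"])
    ultimately show ?thesis using sphere_subset_dom by (intro exI[of _ "?seg \<union> ?S"]) auto
  qed
  then have "\<forall>w\<in>dom. \<exists>C. connected C \<and> C \<subseteq> dom \<and> w \<in> C \<and> ?S \<subseteq> C" by blast
  from bchoice[OF this] obtain C where C: "\<forall>w\<in>dom. connected (C w) \<and> C w \<subseteq> dom \<and> w \<in> C w \<and> ?S \<subseteq> C w" by blast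
  have "radius 0 *\<^sub>R e \<in> ?S" using radius_pos[of 0] by simp
  then have "\<Inter>(C ` dom) \<noteq> {}" using C by blast
  then have "connected (\<Union>(C ` dom))" using C by (intro connected_Union) auto
  moreover have "\<Union>(C ` dom) = dom" using C by blast
  ultimately show ?thesis by simp
qed

text \<open>The two sheets of the double are graphs over \<open>dom\<close>. Their continuity is all
  that compactness and connectedness require, so the square root may be singular at the
  boundary.\<close>

lemma zero_set_eq: "{x. F x = 0} = (\<lambda>w. (sqrt (poly w), w)) ` dom \<union> (\<lambda>w. (- sqrt (poly w), w)) ` dom"
proof (intro set_eqI iffI)
  fix x assume "x \<in> {x. F x = 0}"
  then have x: "(fst x)\<^sup>2 = poly (snd x)" by (simp add: F_def)
  then have "poly (snd x) \<ge> 0" by (metis zero_le_power2)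
  then have d: "snd x \<in> dom" using poly_nonneg_iff by blast
  have "sqrt (poly (snd x)) = \<bar>fst x\<bar>" using x by (metis real_sqrt_abs)
  then have "x = (sqrt (poly (snd x)), snd x) \<or> x = (- sqrt (poly (snd x)), snd x)"
    by (cases x) auto
  then show "x \<in> (\<lambda>w. (sqrt (poly w), w)) ` dom \<union> (\<lambda>w. (- sqrt (poly w), w)) ` dom" using d by blast
next
  fix x assume "x \<in> (\<lambda>w. (sqrt (poly w), w)) ` dom \<union> (\<lambda>w. (- sqrt (poly w), w)) ` dom"
  then obtain w where w: "w \<in> dom" "x = (sqrt (poly w), w) \<or> x = (- sqrt (poly w), w)" by blast
  then have "poly w \<ge> 0" using poly_nonneg_iff by blast
  then show "x \<in> {x. F x = 0}" using w(2) by (auto simp: F_def)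
qed

text \<open>Both sheets are continuous images of \<open>dom\<close>, and they meet over the outer
  sphere, where \<open>poly\<close> vanishes.\<close>

lemma compact_connected_zero_set:
  shows "compact {x. F x = 0}" and "m = 0 \<or> CARD('n) \<ge> 2 \<Longrightarrow> connected {x. F x = 0}"
proof -
  have cp: "continuous_on dom poly"
    using Ck_on_imp_continuous_on[OF Ck_on_poly[of 0]] continuous_on_subset by blast
  have c1: "continuous_on dom (\<lambda>w. (sqrt (poly w), w))" "continuous_on dom (\<lambda>w. (- sqrt (poly w), w))"
    by (intro continuous_intros cp)+
  show "compact {x. F x = 0}"
    unfolding zero_set_eq by (intro compact_Un compact_continuous_image c1 compact_dom)
  assume "m = 0 \<or> CARD('n) \<ge> 2"
  then have d: "connected dom" by (rule connected_dom)
  have p: "radius 0 *\<^sub>R e \<in> dom" using sphere_subset_dom radius_pos[of 0] by auto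
  have "sphere_eq 0 (radius 0 *\<^sub>R e) = 0" using radius_pos[of 0] by (simp add: sphere_eq_norm)
  then have "poly (radius 0 *\<^sub>R e) = 0" using poly_zero by blast
  then have "(0, radius 0 *\<^sub>R e) \<in> (\<lambda>w. (sqrt (poly w), w)) ` dom \<inter> (\<lambda>w. (- sqrt (poly w), w)) ` dom"
    using p by (auto simp: image_iff intro!: bexI[OF _ p])
  then show "connected {x. F x = 0}"
    unfolding zero_set_eq by (intro connected_Un connected_continuous_image c1 d) blast
qed

lemma hypersurface_F:
  assumes "m = 0 \<or> CARD('n) \<ge> 2" "inj enc" shows "hypersurface F enc"
  by unfold_locales (use assms Ck_on_F F_regular compact_connected_zero_set in auto)

section \<open>The half turn about the axis and its fixed points\<close>

definition flip :: "real \<times> (real^'n) \<Rightarrow> real \<times> (real^'n)" where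
  "flip x = (- fst x, (2 * (snd x \<bullet> e)) *\<^sub>R e - snd x)"

text \<open>On the second component this is the reflection in the line of the axis, an isometry that
  fixes every center, so each \<open>sphere_eq i\<close> is invariant.\<close>

lemma flip_facts: "bounded_linear flip" "flip (flip x) = x" "F (flip x) = F x"
proof -
  have "linear flip"
    by (rule linearI) (simp_all add: flip_def inner_add_left algebra_simps)
  then show "bounded_linear flip" using linear_conv_bounded_linear by blast
  show "flip (flip x) = x" by (simp add: flip_def inner_diff_left inner_axis_axis algebra_simps)
  have "sphere_eq i ((2 * (w \<bullet> e)) *\<^sub>R e - w) = sphere_eq i w" for i w
    by (simp add: sphere_eq_def center_def inner_diff_left inner_diff_right inner_axis_axis inner_commute algebra_simps)
  then show "F (flip x) = F x" by (simp add: F_def flip_def poly_def)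
qed

text \<open>The axis crosses the boundary of hole \<open>i\<close> at \<open>4 i - 1\<close> and
  \<open>4 i + 1\<close>. For \<open>i\<close> from 1 to \<open>m\<close> these are the odd numbers
  from 3 to \<open>4 m + 1\<close>, that is \<open>2 k + 1\<close> with \<open>k\<close> from 1 to
  \<open>2 m\<close>. The outer sphere contributes the other two.\<close>

definition fixed_coords :: "real set" where
  "fixed_coords = {- radius 0, radius 0} \<union> (\<lambda>k. 2 * real k + 1) ` {1..2 * m}"

lemma sphere_eq_axis_zero: "sphere_eq i (t *\<^sub>R e) = 0 \<longleftrightarrow> \<bar>t - 4 * real i\<bar> = radius i"
proof -
  have "t *\<^sub>R e - center i = (t - 4 * real i) *\<^sub>R e" by (simp add: center_def algebra_simps)
  then have "sphere_eq i (t *\<^sub>R e) = 0 \<longleftrightarrow> \<bar>t - 4 * real i\<bar>\<^sup>2 = (radius i)\<^sup>2"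
    by (simp add: sphere_eq_norm)
  also have "\<dots> \<longleftrightarrow> \<bar>t - 4 * real i\<bar> = radius i"
    using radius_pos[of i] by (intro power2_eq_iff_nonneg) auto
  finally show ?thesis .
qed

lemma fixed_coords_eq: "fixed_coords = {t. poly (t *\<^sub>R e) = 0}"
proof (intro set_eqI iffI)
  fix t assume "t \<in> fixed_coords"
  then consider "\<bar>t\<bar> = radius 0" | k where "1 \<le> k" "k \<le> 2 * m" "t = 2 * real k + 1"
    using radius_pos[of 0] unfolding fixed_coords_def by auto
  then have "\<exists>i\<le>m. \<bar>t - 4 * real i\<bar> = radius i"
  proof cases
    case 1
    then show ?thesis by (intro exI[of _ 0]) simp
  next
    case 2
    show ?thesis
    proof (cases "even k")
      case True
      then obtain i where "k = 2 * i" by blast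
      then show ?thesis using 2 by (intro exI[of _ i]) (simp add: radius_def)
    next
      case False
      then obtain i where "k = 2 * i + 1" by (rule oddE)
      then show ?thesis using 2 by (intro exI[of _ "Suc i"]) (simp add: radius_def)
    qed
  qed
  then show "t \<in> {t. poly (t *\<^sub>R e) = 0}" by (simp add: poly_zero sphere_eq_axis_zero)
next
  fix t assume "t \<in> {t. poly (t *\<^sub>R e) = 0}"
  then obtain i where i: "i \<le> m" "\<bar>t - 4 * real i\<bar> = radius i" by (auto simp: poly_zero sphere_eq_axis_zero)
  show "t \<in> fixed_coords"
  proof (cases "i = 0")
    case True
    then show ?thesis using i by (auto simp: fixed_coords_def abs_if split: if_splits)
  next
    case False
    then consider "t = 2 * real (2 * i) + 1" | "t = 2 * real (2 * i - 1) + 1"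
      using i(2) by (auto simp: radius_def abs_if of_nat_diff split: if_splits)
    then show ?thesis
    proof cases
      case 1
      then show ?thesis unfolding fixed_coords_def using i(1) False by (intro UnI2 image_eqI[of _ _ "2 * i"]) auto
    next
      case 2
      then show ?thesis unfolding fixed_coords_def using i(1) False by (intro UnI2 image_eqI[of _ _ "2 * i - 1"]) auto
    qed
  qed
qed

lemma card_fixed_coords: "finite fixed_coords" "card fixed_coords = 2 * m + 2"
proof -
  let ?O = "(\<lambda>k. 2 * real k + 1) ` {1..2 * m}"
  show "finite fixed_coords" by (simp add: fixed_coords_def)
  have "card ?O = 2 * m" by (subst card_image) (auto intro: inj_onI)
  moreover have "- radius 0 \<notin> ?O" "radius 0 \<notin> ?O" by (auto simp: radius_def)
  moreover have "- radius 0 \<noteq> radius 0" using radius_pos[of 0] by simp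
  ultimately show "card fixed_coords = 2 * m + 2" by (simp add: fixed_coords_def)
qed

lemma flip_fixed_points: "{x. F x = 0 \<and> flip x = x} = (\<lambda>t. (0, t *\<^sub>R e)) ` fixed_coords"
proof (intro set_eqI iffI)
  fix x assume x: "x \<in> {x. F x = 0 \<and> flip x = x}"
  then have "- fst x = fst x" "(2 * (snd x \<bullet> e)) *\<^sub>R e - snd x = snd x"
    by (auto simp: flip_def prod_eq_iff)
  then have f: "fst x = 0" "(2 * (snd x \<bullet> e)) *\<^sub>R e = 2 *\<^sub>R snd x" by (auto simp: scaleR_2 algebra_simps)
  then have "(1/2) *\<^sub>R ((2 * (snd x \<bullet> e)) *\<^sub>R e) = (1/2) *\<^sub>R (2 *\<^sub>R snd x)" by simp
  then have s: "snd x = (snd x \<bullet> e) *\<^sub>R e" by simp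
  have "poly (snd x) = 0" using x f(1) by (simp add: F_def)
  then have "snd x \<bullet> e \<in> fixed_coords" unfolding fixed_coords_eq using s by simp
  moreover have "x = (0, (snd x \<bullet> e) *\<^sub>R e)" using f(1) s by (simp add: prod_eq_iff)
  ultimately show "x \<in> (\<lambda>t. (0, t *\<^sub>R e)) ` fixed_coords" by (rule rev_image_eqI)
next
  fix x :: "real \<times> (real^'n)" assume "x \<in> (\<lambda>t. (0, t *\<^sub>R e)) ` fixed_coords"
  then obtain t where "poly (t *\<^sub>R e) = 0" "x = (0, t *\<^sub>R e)" unfolding fixed_coords_eq by blast
  then show "x \<in> {x. F x = 0 \<and> flip x = x}"
  proof -
    have i: "(t *\<^sub>R e) \<bullet> e = t" by (simp add: inner_axis_axis)
    have "(2 * t) *\<^sub>R e - t *\<^sub>R e = t *\<^sub>R e" by (simp only: scaleR_left_diff_distrib[symmetric]) simp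
    then show ?thesis using \<open>poly (t *\<^sub>R e) = 0\<close> \<open>x = _\<close> by (simp only: F_def flip_def i) simp
  qed
qed

text \<open>At a fixed point the gradient of \<open>F\<close> is a nonzero multiple of the axis, so
  tangent vectors are orthogonal to the axis, and there the half turn is \<open>-1\<close>.\<close>

lemma flip_tangent:
  assumes "F x = 0" "flip x = x" "frechet_derivative F (at x) v = 0"
  shows "flip v = - v"
proof -
  obtain t where t: "poly (t *\<^sub>R e) = 0" "x = (0, t *\<^sub>R e)"
    using assms(1,2) flip_fixed_points unfolding fixed_coords_eq by blast
  then obtain i where i: "i \<le> m" "sphere_eq i (t *\<^sub>R e) = 0" using poly_zero by blast
  obtain c where c: "c \<noteq> 0" "\<And>v. frechet_derivative poly (at (t *\<^sub>R e)) v = c * ((t *\<^sub>R e - center i) \<bullet> v)"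
    by (rule poly_derivative_at_zero[OF i]) blast
  have "(t *\<^sub>R e - center i) \<bullet> snd v = 0"
    using assms(3) c(1) by (simp add: F_derivative t(2) c(2))
  moreover have "t *\<^sub>R e - center i = (t - 4 * real i) *\<^sub>R e" by (simp add: center_def algebra_simps)
  moreover have "t - 4 * real i \<noteq> 0" using i(2) radius_pos[of i] unfolding sphere_eq_axis_zero by auto
  ultimately have "e \<bullet> snd v = 0" by simp
  then show ?thesis by (simp add: flip_def prod_eq_iff inner_commute)
qed

end

section \<open>From even graphs to actions\<close>

text \<open>The only edge at \<open>p\<close> is also the only edge at its other end, so no walk
  from \<open>p\<close> leaves these two vertices.\<close>

lemma card_vertices_valence_one:
  assumes "loopless_finite_graph \<Gamma>" "regular_graph 1 \<Gamma>" "connected_graph \<Gamma>" "verts \<Gamma> \<noteq> {}"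
  shows "card (verts \<Gamma>) = 2"
proof -
  obtain p where p: "p \<in> verts \<Gamma>" using assms(4) by blast
  have one: "card (edges_at \<Gamma> q) = 1" if "q \<in> verts \<Gamma>" for q
    using assms(2) that by (simp add: regular_graph_def)
  obtain a where a: "edges_at \<Gamma> p = {a}" using one[OF p] card_1_singletonE by metis
  then have ap: "a \<in> edges \<Gamma>" "p \<in> ends \<Gamma> a" unfolding edges_at_def by blast+
  then have ends: "ends \<Gamma> a \<subseteq> verts \<Gamma>" "card (ends \<Gamma> a) = 2"
    using assms(1) unfolding loopless_finite_graph_def by blast+
  have "q \<in> ends \<Gamma> a" if "(p, q) \<in> {(u, v). \<exists>e\<in>edges \<Gamma>. ends \<Gamma> e = {u, v}}\<^sup>*" for q
    using that
  proof (induction rule: rtrancl_induct)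
    case base
    show ?case by (rule ap(2))
  next
    case (step u v)
    then obtain b where b: "b \<in> edges \<Gamma>" "ends \<Gamma> b = {u, v}" by blast
    have "a \<in> edges_at \<Gamma> u" "b \<in> edges_at \<Gamma> u" using step.IH ap(1) b by (auto simp: edges_at_def)
    moreover have "u \<in> verts \<Gamma>" using step.IH ends(1) by blast
    then obtain d where "edges_at \<Gamma> u = {d}" using one card_1_singletonE by metis
    ultimately have "a = b" by simp
    then show ?case using b(2) by simp
  qed
  then have "verts \<Gamma> \<subseteq> ends \<Gamma> a"
    using assms(3) p unfolding connected_graph_def by blast
  then show ?thesis using ends by (simp add: subset_antisym)
qed

text \<open>The half turn always fixes the two poles of the outer sphere, so the graph without
  vertices calls for a free involution instead. Otherwise \<open>m\<close> holes realize
  \<open>2 m + 2\<close> fixed points, and in valence 1 connectedness of the graph forces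
  \<open>m = 0\<close>, which keeps the double connected.\<close>

lemma colored_graph_if_even:
  fixes \<Gamma> :: "('v, 'e) multigraph" and \<alpha> :: "'e \<Rightarrow> bit \<Rightarrow> bit"
  assumes sk: "abstract_1_skeleton CARD('n::finite) \<Gamma> \<alpha>"
    and conn: "CARD('n) = 1 \<Longrightarrow> connected_graph \<Gamma>"
    and even: "even (card (verts \<Gamma>))"
  shows "is_colored_graph_of_G_action TYPE('n) \<Gamma> \<alpha>"
proof -
  obtain enc :: "real \<times> (real^'n) \<Rightarrow> nat \<Rightarrow> real" where enc: "inj enc"
    using ex_injection_into_sequences by blast
  fix j :: 'n
  have pole: "holed_ball.F j m (0, holed_ball.radius m 0 *\<^sub>R axis j 1) = 0" for m
  proof -
    interpret holed_ball j m .
    have "sphere_eq 0 (radius 0 *\<^sub>R e) = 0" using radius_pos[of 0] by (simp add: sphere_eq_norm)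
    then have "poly (radius 0 *\<^sub>R e) = 0" using poly_zero by blast
    then show ?thesis by (simp only: F_def fst_conv snd_conv) simp
  qed
  show ?thesis
  proof (cases "card (verts \<Gamma>) = 0")
    case True
    interpret holed_ball j 0 .
    interpret hypersurface F enc by (rule hypersurface_F) (simp_all add: enc)
    have p: "poly w = (radius 0)\<^sup>2 - w \<bullet> w" for w by (simp add: poly_def sphere_eq_def)
    have sym: "F (- x) = F x" for x by (simp add: F_def p)
    have F0: "F 0 \<noteq> 0" using radius_pos[of 0] by (simp add: F_def p)
    have neg: "- x = x \<longleftrightarrow> x = 0" for x :: "real \<times> (real^'n)"
    proof
      assume "- x = x"
      then have "2 *\<^sub>R x = 0" by (simp add: scaleR_2 neg_eq_iff_add_eq_0)
      then show "x = 0" by simp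
    qed simp
    define x0 :: "real \<times> (real^'n)" where "x0 = (0, radius 0 *\<^sub>R e)"
    have none: "{x. F x = 0 \<and> - x = x} = {}" using F0 neg by auto
    show ?thesis
    proof (rule colored_graph_of_involution[where g = uminus])
      show "bounded_linear (uminus :: real \<times> (real^'n) \<Rightarrow> _)"
        using bounded_linear_minus[OF bounded_linear_ident] .
      show x0: "F x0 = 0" unfolding x0_def by (rule pole)
      show "- x0 \<noteq> x0" unfolding neg using x0 F0 by auto
      show "F (- x) = F x" for x by (rule sym)
      show "finite {x. F x = 0 \<and> - x = x}" unfolding none by simp
      show "card (verts \<Gamma>) = card {x. F x = 0 \<and> - x = x}" unfolding none using True by simp
    qed (simp_all add: sk)
  next
    case False
    then obtain m where m: "card (verts \<Gamma>) = 2 * m + 2" using even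
      by (metis add.commute dvdE mult_0_right mult_Suc_right not0_implies_Suc)
    interpret holed_ball j m .
    have "m = 0 \<or> CARD('n) \<ge> 2"
    proof (cases "CARD('n) = 1")
      case True
      have "card (verts \<Gamma>) = 2"
        using sk conn[OF True] False unfolding True
        by (intro card_vertices_valence_one) (auto simp: abstract_1_skeleton_def)
      then show ?thesis using m by simp
    next
      case False
      have "CARD('n) \<noteq> 0" by simp
      with False have "CARD('n) \<ge> 2" by linarith
      then show ?thesis ..
    qed
    then interpret hypersurface F enc by (rule hypersurface_F) (rule enc)
    have inj: "inj_on (\<lambda>t. (0 :: real, t *\<^sub>R e)) fixed_coords"
      by (rule inj_onI) (simp add: axis_eq_0_iff)
    have fin: "finite {x. F x = 0 \<and> flip x = x}" and card: "card {x. F x = 0 \<and> flip x = x} = 2 * m + 2"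
      unfolding flip_fixed_points using card_fixed_coords card_image[OF inj] by simp_all
    have "0 \<in> dom"
    proof -
      have "sphere_eq i 0 \<ge> 0" if "i \<le> m" for i
      proof (cases "i = 0")
        case True
        then show ?thesis using sphere_eq_0_nonneg_iff(1)[of 0] radius_pos[of 0] by simp
      next
        case False
        then show ?thesis using sphere_eq_pos_iff(1)[OF False, of 0] by (simp add: norm_center)
      qed
      then show ?thesis by (simp add: dom_def)
    qed
    then have "poly 0 \<ge> 0" using poly_nonneg_iff by blast
    moreover have "poly 0 \<noteq> 0"
    proof -
      have "sphere_eq i 0 \<noteq> 0" for i
      proof
        assume "sphere_eq i 0 = 0"
        then have "\<bar>0 - 4 * real i\<bar> = radius i" using sphere_eq_axis_zero[of i 0] by simp
        then show False by (cases "i = 0") (auto simp: radius_def)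
      qed
      then show ?thesis unfolding poly_zero by blast
    qed
    ultimately have pos: "poly 0 > 0" by simp
    show ?thesis
    proof (rule colored_graph_of_involution[OF flip_facts fin _ _ flip_tangent sk])
      \<comment> \<open>A point over the origin witnesses that the action is effective: the half
        turn moves it to the other sheet.\<close>
      show "F (sqrt (poly 0), 0) = 0" using pos by (simp add: F_def)
      show "flip (sqrt (poly 0), 0) \<noteq> (sqrt (poly 0), 0)" using pos by (simp add: flip_def)
      show "card (verts \<Gamma>) = card {x. F x = 0 \<and> flip x = x}" unfolding card by (rule m)
    qed
  qed
qed

theorem proposition2p1:
  fixes \<Gamma> :: "('v, 'e) multigraph"
    and \<alpha> :: "'e \<Rightarrow> bit \<Rightarrow> bit"
  assumes "abstract_1_skeleton CARD('n::finite) \<Gamma> \<alpha>"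
    and "CARD('n) = 1 \<Longrightarrow> connected_graph \<Gamma>"
  shows "is_colored_graph_of_G_action TYPE('n) \<Gamma> \<alpha> \<longleftrightarrow> even (card (verts \<Gamma>))"
  using even_card_vertices colored_graph_if_even[OF assms] by blast

end
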